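(* Let $r\in\mathbb N$, and let $\mathbf m=[\mathbf m_0,\mathbf m_1,\dots,\mathbf m_r,\mathbf m_{r+1}]$ be real with $\mathbf m_0=1$, $\mathbf m_{r+1}=0$ and $\mathbf m_k\neq 0$ for $1\le k\le r$; let $\mathbf p=[\mathbf p_0,\dots,\mathbf p_{r+1}]$ with $1\ge \mathbf p_0\ge \mathbf p_1\ge\dots\ge \mathbf p_r\ge \mathbf p_{r+1}=0$ and $\mathbf q=[\mathbf q_0,\dots,\mathbf q_{r+1}]$ with $1\ge \mathbf q_0\ge \mathbf q_1\ge\dots\ge \mathbf q_r\ge \mathbf q_{r+1}=0$. Let $\mathcal X=\{\mathbf x^{(1)},\dots,\mathbf x^{(l)}\}\subset\mathbb R^n$, $\mathcal Y=\{\mathbf y^{(1)},\dots,\mathbf y^{(l)}\}\subset\mathbb R^m$, $\beta>0$, $s\in\mathbb R\setminus\{0\}$ and $t\in[0,1]$ be given. Let $\psi(\mathcal X,\mathcal Y,\mathbf p,\mathbf q,\mathbf m,\beta,s,t)$ be the function and $\langle\cdot\rangle_{\gamma^{(r)}_{k+1}}$ the weighted sums defined in the context. For $k_1\in\{1,\dots,r\}$ set $$\begin{aligned}\phi^{(k_1,\mathbf p)} = {}& -(1-t)(\mathbf m_{k_1}-\mathbf m_{k_1+1})\,\mathbb E_{G,\mathcal U_{r+1}}\big\langle \|\mathbf x^{(i_1)}\|_2\|\mathbf x^{(p_1)}\|_2(\mathbf y^{(p_2)})^T\mathbf y^{(i_2)}\big\rangle_{\gamma_{k_1+1}^{(r)}}\\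 & - t\,\mathbf q_{k_1}(\mathbf m_{k_1}-\mathbf m_{k_1+1})\,\mathbb E_{G,\mathcal U_{r+1}}\big\langle \|\mathbf x^{(i_1)}\|_2\|\mathbf x^{(p_1)}\|_2\|\mathbf y^{(i_2)}\|_2\|\mathbf y^{(p_2)}\|_2\big\rangle_{\gamma_{k_1+1}^{(r)}},\\ \phi^{(k_1,\mathbf q)} = {}& -(1-t)(\mathbf m_{k_1}-\mathbf m_{k_1+1})\,\mathbb E_{G,\mathcal U_{r+1}}\big\langle \|\mathbf y^{(i_2)}\|_2\|\mathbf y^{(p_2)}\|_2(\mathbf x^{(i_1)})^T\mathbf x^{(p_1)}\big\rangle_{\gamma_{k_1+1}^{(r)}}\\ & - t\,\mathbf p_{k_1}(\mathbf m_{k_1}-\mathbf m_{k_1+1})\,\mathbb E_{G,\mathcal U_{r+1}}\big\langle \|\mathbf x^{(i_1)}\|_2\|\mathbf x^{(p_1)}\|_2\|\mathbf y^{(i_2)}\|_2\|\mathbf y^{(p_2)}\|_2\big\rangle_{\gamma_{k_1+1}^{(r)}}.\end{aligned}$$ Then for every $k_1\in\{1,2,\dots,r\}$ $$\frac{d\psi(\mathcal X,\mathcal Y,\mathbf p,\mathbf q,\mathbf m,\beta,s,t)}{d\mathbf p_{k_1}}=\frac{\mathrm{sign}(s)\,s\,\beta}{2\sqrt n}\,\phi^{(k_1,\mathbf p)},\qquad \frac{d\psi(\mathcal X,\mathcal Y,\mathbf p,\mathbf q,\mathbf m,\beta,s,t)}{d\mathbf q_{k_1}}=\frac{\mathrm{sign}(s)\,s\,\beta}{2\sqrt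 n}\,\phi^{(k_1,\mathbf q)}.$$
   Context: Random quantities. $G\in\mathbb R^{m\times n}$ and, for $k\in\{1,\dots,r+1\}$, $u^{(4,k)}\in\mathbb R$, $\mathbf u^{(2,k)}\in\mathbb R^m$, $\mathbf h^{(k)}\in\mathbb R^n$ all have i.i.d. standard normal components and are mutually independent. $\mathcal U_k=[u^{(4,k)},\mathbf u^{(2,k)},\mathbf h^{(k)}]$. $\mathbb E$ with a subscript is expectation with respect to the subscripted randomness only (the rest is held fixed). Scalings. $a_k=\sqrt{\mathbf p_{k-1}\mathbf q_{k-1}-\mathbf p_k\mathbf q_k}$, $b_k=\sqrt{\mathbf p_{k-1}-\mathbf p_k}$, $c_k=\sqrt{\mathbf q_{k-1}-\mathbf q_k}$ for $1\le k\le r+1$. Interpolating function. For $1\le i_1,i_2\le l$, $$\begin{aligned}D_0^{(i_1,i_2)}={}&\sqrt t\,(\mathbf y^{(i_2)})^TG\mathbf x^{(i_1)}+\sqrt{1-t}\,\|\mathbf x^{(i_1)}\|_2(\mathbf y^{(i_2)})^T\Big(\sum_{k=1}^{r+1}b_k\mathbf u^{(2,k)}\Big)\\&+\sqrt t\,\|\mathbf x^{(i_1)}\|_2\|\mathbf y^{(i_2)}\|_2\Big(\sum_{k=1}^{r+1}a_ku^{(4,k)}\Big)+\sqrt{1-t}\,\|\mathbf y^{(i_2)}\|_2\Big(\sum_{k=1}^{r+1}c_k\mathbf h^{(k)}\Big)^T\mathbf x^{(i_1)},\end{aligned}$$ $A^{(i_1,i_2)}=e^{\beta D_0^{(i_1,i_2)}}$,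 $C^{(i_1)}=\sum_{i_2=1}^lA^{(i_1,i_2)}$, $Z=\sum_{i_1=1}^l(C^{(i_1)})^s$. Put $\zeta_0=Z$ and $\zeta_k=\mathbb E_{\mathcal U_k}\big[\zeta_{k-1}^{\mathbf m_k/\mathbf m_{k-1}}\big]$ for $1\le k\le r$. Then $$\psi(\mathcal X,\mathcal Y,\mathbf p,\mathbf q,\mathbf m,\beta,s,t)=\mathbb E_{G,\mathcal U_{r+1}}\frac{1}{\beta|s|\sqrt n\,\mathbf m_r}\log\zeta_r .$$ Measures. $\Phi_{\mathcal U_k}$ is the operator $\Phi_{\mathcal U_k}(\cdot)=\mathbb E_{\mathcal U_k}\Big[\frac{\zeta_{k-1}^{\mathbf m_k/\mathbf m_{k-1}}}{\zeta_k}\,(\cdot)\Big]$. Products $\prod_{k=b}^{a}\Phi_{\mathcal U_k}$ with $b\ge a$ denote the composition $\Phi_{\mathcal U_b}\Phi_{\mathcal U_{b-1}}\cdots\Phi_{\mathcal U_a}$ (decreasing index order, $\Phi_{\mathcal U_a}$ applied first); for $b<a$ it is the identity. Let $\gamma_0(i_1,i_2)=\frac{(C^{(i_1)})^s}{Z}\frac{A^{(i_1,i_2)}}{C^{(i_1)}}$ and $$\gamma^{(r)}_{k_1+1}=\prod_{k=r}^{k_1+1}\Phi_{\mathcal U_k}\Big(\prod_{k=k_1}^{1}\Phi_{\mathcal U_k}\gamma_0(i_1,i_2)\times\prod_{k=k_1}^{1}\Phi_{\mathcal U_k}\gamma_0(p_1,p_2)\Big),$$ a (random) probability weight on quadruples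 $(i_1,i_2,p_1,p_2)\in\{1,\dots,l\}^4$. $\langle f\rangle_{\gamma^{(r)}_{k_1+1}}=\sum_{i_1,i_2,p_1,p_2=1}^{l}\gamma^{(r)}_{k_1+1}(i_1,i_2,p_1,p_2)\,f(i_1,i_2,p_1,p_2)$. The derivative with respect to $\mathbf p_{k_1}$ (resp. $\mathbf q_{k_1}$) is taken with all other parameters fixed, within the admissible range $[\mathbf p_{k_1+1},\mathbf p_{k_1-1}]$ (resp. $[\mathbf q_{k_1+1},\mathbf q_{k_1-1}]$), assumed to be a nondegenerate interval, one-sided at its endpoints. *)

theory Defs
  imports "HOL-Probability.Probability"
begin

section \<open>Gaussian measures\<close>

definition std_gauss :: "real measure" where
  "std_gauss = density lborel std_normal_density"

definition gauss_vec :: "(real ^ 'a::finite) measure" where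
  "gauss_vec = distr (\<Pi>\<^sub>M i\<in>UNIV. std_gauss) borel (\<lambda>f. \<chi> i. f i)"

definition gauss_mat :: "(real ^ 'n::finite ^ 'm::finite) measure" where
  "gauss_mat = distr (\<Pi>\<^sub>M ij\<in>UNIV. std_gauss) borel (\<lambda>f. \<chi> i j. f (i, j))"

text \<open>The triple \<open>(u\<^sup>4, u\<^sup>2, h)\<close> of Gaussian variables attached to one level.\<close>

type_synonym ('n, 'm) level = "real \<times> (real ^ 'm) \<times> (real ^ 'n)"

definition gauss_level :: "('n::finite, 'm::finite) level measure" where
  "gauss_level = std_gauss \<Otimes>\<^sub>M (gauss_vec \<Otimes>\<^sub>M gauss_vec)"

text \<open>A random quantity is a function of the matrix \<open>G\<close> and of the family \<open>U\<close> of level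
  variables, of which only \<open>U 1, \<dots>, U (r + 1)\<close> matter.\<close>

type_synonym ('n, 'm) rv = "real ^ 'n ^ 'm \<Rightarrow> (nat \<Rightarrow> ('n, 'm) level) \<Rightarrow> real"

definition E_level :: "nat \<Rightarrow> ('n::finite, 'm::finite) rv \<Rightarrow> ('n, 'm) rv" where
  "E_level k F = (\<lambda>G U. \<integral>u. F G (U(k := u)) \<partial>gauss_level)"

text \<open>Expectation over \<open>G\<close> and the last level. It is applied only to quantities in which the
  levels \<open>1, \<dots>, r\<close> have been integrated out already, so the value \<open>0\<close> assigned to the
  other coordinates is irrelevant.\<close>

definition E_outer :: "nat \<Rightarrow> ('n::finite, 'm::finite) rv \<Rightarrow> real" where
  "E_outer r F =
     (\<integral>(G, u). F G ((\<lambda>_. 0)(r + 1 := u)) \<partial>(gauss_mat \<Otimes>\<^sub>M gauss_level))"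


section \<open>The interpolating function\<close>

definition a_coef :: "(nat \<Rightarrow> real) \<Rightarrow> (nat \<Rightarrow> real) \<Rightarrow> nat \<Rightarrow> real" where
  "a_coef p q k = sqrt (p (k - 1) * q (k - 1) - p k * q k)"

definition b_coef :: "(nat \<Rightarrow> real) \<Rightarrow> nat \<Rightarrow> real" where
  "b_coef p k = sqrt (p (k - 1) - p k)"

definition c_coef :: "(nat \<Rightarrow> real) \<Rightarrow> nat \<Rightarrow> real" where
  "c_coef q k = sqrt (q (k - 1) - q k)"

definition D0 :: "nat \<Rightarrow> (nat \<Rightarrow> real ^ 'n::finite) \<Rightarrow> (nat \<Rightarrow> real ^ 'm::finite) \<Rightarrow>
    (nat \<Rightarrow> real) \<Rightarrow> (nat \<Rightarrow> real) \<Rightarrow> real \<Rightarrow> nat \<Rightarrow> nat \<Rightarrow> ('n, 'm) rv" where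
  "D0 r x y p q t i1 i2 G U =
     sqrt t * (y i2 \<bullet> (G *v x i1))
   + sqrt (1 - t) * norm (x i1) * (y i2 \<bullet> (\<Sum>k=1..r+1. b_coef p k *\<^sub>R fst (snd (U k))))
   + sqrt t * norm (x i1) * norm (y i2) * (\<Sum>k=1..r+1. a_coef p q k * fst (U k))
   + sqrt (1 - t) * norm (y i2) * ((\<Sum>k=1..r+1. c_coef q k *\<^sub>R snd (snd (U k))) \<bullet> x i1)"

definition A_wt :: "nat \<Rightarrow> (nat \<Rightarrow> real ^ 'n::finite) \<Rightarrow> (nat \<Rightarrow> real ^ 'm::finite) \<Rightarrow>
    (nat \<Rightarrow> real) \<Rightarrow> (nat \<Rightarrow> real) \<Rightarrow> real \<Rightarrow> real \<Rightarrow> nat \<Rightarrow> nat \<Rightarrow> ('n, 'm) rv" where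
  "A_wt r x y p q \<beta> t i1 i2 G U = exp (\<beta> * D0 r x y p q t i1 i2 G U)"

definition C_wt :: "nat \<Rightarrow> nat \<Rightarrow> (nat \<Rightarrow> real ^ 'n::finite) \<Rightarrow> (nat \<Rightarrow> real ^ 'm::finite) \<Rightarrow>
    (nat \<Rightarrow> real) \<Rightarrow> (nat \<Rightarrow> real) \<Rightarrow> real \<Rightarrow> real \<Rightarrow> nat \<Rightarrow> ('n, 'm) rv" where
  "C_wt r l x y p q \<beta> t i1 G U = (\<Sum>i2=1..l. A_wt r x y p q \<beta> t i1 i2 G U)"

definition Z_part :: "nat \<Rightarrow> nat \<Rightarrow> (nat \<Rightarrow> real ^ 'n::finite) \<Rightarrow> (nat \<Rightarrow> real ^ 'm::finite) \<Rightarrow>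
    (nat \<Rightarrow> real) \<Rightarrow> (nat \<Rightarrow> real) \<Rightarrow> real \<Rightarrow> real \<Rightarrow> real \<Rightarrow> ('n, 'm) rv" where
  "Z_part r l x y p q \<beta> s t G U = (\<Sum>i1=1..l. C_wt r l x y p q \<beta> t i1 G U powr s)"

text \<open>The recursion for \<open>\<zeta>\<close> and the operators \<open>\<Phi>\<close>, for a given starting quantity \<open>Z\<close>.\<close>

primrec zeta :: "(nat \<Rightarrow> real) \<Rightarrow> ('n::finite, 'm::finite) rv \<Rightarrow> nat \<Rightarrow> ('n, 'm) rv" where
  "zeta m Z 0 = Z"
| "zeta m Z (Suc k) = E_level (Suc k) (\<lambda>G U. zeta m Z k G U powr (m (Suc k) / m k))"

definition psi :: "nat \<Rightarrow> nat \<Rightarrow> (nat \<Rightarrow> real ^ 'n::finite) \<Rightarrow> (nat \<Rightarrow> real ^ 'm::finite) \<Rightarrow>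
    (nat \<Rightarrow> real) \<Rightarrow> (nat \<Rightarrow> real) \<Rightarrow> (nat \<Rightarrow> real) \<Rightarrow> real \<Rightarrow> real \<Rightarrow> real \<Rightarrow> real" where
  "psi r l x y p q m \<beta> s t =
     E_outer r (\<lambda>G U. 1 / (\<beta> * \<bar>s\<bar> * sqrt (real CARD('n)) * m r)
                      * ln (zeta m (Z_part r l x y p q \<beta> s t) r G U))"


section \<open>The weights\<close>

definition Phi :: "(nat \<Rightarrow> real) \<Rightarrow> ('n::finite, 'm::finite) rv \<Rightarrow> nat \<Rightarrow> ('n, 'm) rv \<Rightarrow> ('n, 'm) rv"
  where
  "Phi m Z k F =
     E_level k (\<lambda>G U. zeta m Z (k - 1) G U powr (m k / m (k - 1)) / zeta m Z k G U * F G U)"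

text \<open>The composition \<open>\<Phi>\<^sub>b \<circ> \<dots> \<circ> \<Phi>\<^sub>a\<close>, with \<open>\<Phi>\<^sub>a\<close> applied first; the identity if \<open>b < a\<close>.\<close>

definition Phi_prod :: "(nat \<Rightarrow> real) \<Rightarrow> ('n::finite, 'm::finite) rv \<Rightarrow> nat \<Rightarrow> nat \<Rightarrow>
    ('n, 'm) rv \<Rightarrow> ('n, 'm) rv" where
  "Phi_prod m Z b a F = fold (Phi m Z) [a..<Suc b] F"

definition gamma0 :: "nat \<Rightarrow> nat \<Rightarrow> (nat \<Rightarrow> real ^ 'n::finite) \<Rightarrow> (nat \<Rightarrow> real ^ 'm::finite) \<Rightarrow>
    (nat \<Rightarrow> real) \<Rightarrow> (nat \<Rightarrow> real) \<Rightarrow> real \<Rightarrow> real \<Rightarrow> real \<Rightarrow> nat \<Rightarrow> nat \<Rightarrow> ('n, 'm) rv" where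
  "gamma0 r l x y p q \<beta> s t i1 i2 G U =
     C_wt r l x y p q \<beta> t i1 G U powr s / Z_part r l x y p q \<beta> s t G U
     * (A_wt r x y p q \<beta> t i1 i2 G U / C_wt r l x y p q \<beta> t i1 G U)"

text \<open>With argument \<open>k1\<close>, this is the weight written \<open>\<gamma>\<close> with lower index \<open>k1 + 1\<close> and upper
  index \<open>(r)\<close>.\<close>

definition gamma_wt :: "nat \<Rightarrow> nat \<Rightarrow> (nat \<Rightarrow> real ^ 'n::finite) \<Rightarrow> (nat \<Rightarrow> real ^ 'm::finite) \<Rightarrow>
    (nat \<Rightarrow> real) \<Rightarrow> (nat \<Rightarrow> real) \<Rightarrow> (nat \<Rightarrow> real) \<Rightarrow> real \<Rightarrow> real \<Rightarrow> real \<Rightarrow> nat \<Rightarrow>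
    nat \<Rightarrow> nat \<Rightarrow> nat \<Rightarrow> nat \<Rightarrow> ('n, 'm) rv" where
  "gamma_wt r l x y p q m \<beta> s t k1 i1 i2 p1 p2 =
     (let Z = Z_part r l x y p q \<beta> s t; g = gamma0 r l x y p q \<beta> s t in
      Phi_prod m Z r (k1 + 1)
        (\<lambda>G U. Phi_prod m Z k1 1 (g i1 i2) G U * Phi_prod m Z k1 1 (g p1 p2) G U))"

text \<open>The outer expectation of the \<open>\<gamma>\<close>-weighted sum of \<open>f\<close>.\<close>

definition E_gamma :: "nat \<Rightarrow> nat \<Rightarrow> (nat \<Rightarrow> real ^ 'n::finite) \<Rightarrow> (nat \<Rightarrow> real ^ 'm::finite) \<Rightarrow>
    (nat \<Rightarrow> real) \<Rightarrow> (nat \<Rightarrow> real) \<Rightarrow> (nat \<Rightarrow> real) \<Rightarrow> real \<Rightarrow> real \<Rightarrow> real \<Rightarrow> nat \<Rightarrow>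
    (nat \<Rightarrow> nat \<Rightarrow> nat \<Rightarrow> nat \<Rightarrow> real) \<Rightarrow> real" where
  "E_gamma r l x y p q m \<beta> s t k1 f =
     E_outer r (\<lambda>G U. \<Sum>i1=1..l. \<Sum>i2=1..l. \<Sum>p1=1..l. \<Sum>p2=1..l.
        gamma_wt r l x y p q m \<beta> s t k1 i1 i2 p1 p2 G U * f i1 i2 p1 p2)"

definition phi_p :: "nat \<Rightarrow> nat \<Rightarrow> (nat \<Rightarrow> real ^ 'n::finite) \<Rightarrow> (nat \<Rightarrow> real ^ 'm::finite) \<Rightarrow>
    (nat \<Rightarrow> real) \<Rightarrow> (nat \<Rightarrow> real) \<Rightarrow> (nat \<Rightarrow> real) \<Rightarrow> real \<Rightarrow> real \<Rightarrow> real \<Rightarrow> nat \<Rightarrow> real" where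
  "phi_p r l x y p q m \<beta> s t k1 =
     - (1 - t) * (m k1 - m (k1 + 1)) * E_gamma r l x y p q m \<beta> s t k1
         (\<lambda>i1 i2 p1 p2. norm (x i1) * norm (x p1) * (y p2 \<bullet> y i2))
     - t * q k1 * (m k1 - m (k1 + 1)) * E_gamma r l x y p q m \<beta> s t k1
         (\<lambda>i1 i2 p1 p2. norm (x i1) * norm (x p1) * norm (y i2) * norm (y p2))"

definition phi_q :: "nat \<Rightarrow> nat \<Rightarrow> (nat \<Rightarrow> real ^ 'n::finite) \<Rightarrow> (nat \<Rightarrow> real ^ 'm::finite) \<Rightarrow>
    (nat \<Rightarrow> real) \<Rightarrow> (nat \<Rightarrow> real) \<Rightarrow> (nat \<Rightarrow> real) \<Rightarrow> real \<Rightarrow> real \<Rightarrow> real \<Rightarrow> nat \<Rightarrow> real" where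
  "phi_q r l x y p q m \<beta> s t k1 =
     - (1 - t) * (m k1 - m (k1 + 1)) * E_gamma r l x y p q m \<beta> s t k1
         (\<lambda>i1 i2 p1 p2. norm (y i2) * norm (y p2) * (x i1 \<bullet> x p1))
     - t * p k1 * (m k1 - m (k1 + 1)) * E_gamma r l x y p q m \<beta> s t k1
         (\<lambda>i1 i2 p1 p2. norm (x i1) * norm (x p1) * norm (y i2) * norm (y p2))"

end

theory Submission
  imports Defs
begin

text \<open>
  Write \<open>\<zeta>\<^sub>k = exp (m\<^sub>k F\<^sub>k)\<close>. Then \<open>F\<^sub>k\<close> is the free energy \<open>ln (E exp (m\<^sub>k F\<^sub>k\<^sub>-\<^sub>1)) / m\<^sub>k\<close> over the
  noise of level \<open>k\<close>, and \<open>\<Phi>\<close> is the corresponding tilted mean. Increasing \<open>p\<^sub>k\<close> by \<open>h\<close> moves an independent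
  Gaussian increment of variance proportional to \<open>h\<close> from level \<open>k\<close> to level \<open>k + 1\<close>; the only effect is that
  this increment is integrated with exponent \<open>m\<^sub>k\<^sub>+\<^sub>1\<close> instead of \<open>m\<^sub>k\<close>. For a small Gaussian increment the free
  energy with exponent \<open>m\<close> is mean plus \<open>m/2\<close> times variance up to \<open>O(h\<^sup>3\<^sup>/\<^sup>2)\<close>, so the means cancel in the
  difference and the variance, a quadratic form in the gradient of \<open>F\<^sub>k\<close>, remains. This needs only that \<open>F\<^sub>k\<close> is
  Lipschitz with Lipschitz gradient, which every level preserves: by Hoeffding's lemma a perturbation of size \<open>c\<close>
  changes the free energy by its tilted mean up to \<open>\<bar>m\<bar> c\<^sup>2/2\<close>. The same estimate carries the increment through the
  remaining levels. Since square roots of the parameters are never differentiated, the end points of the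
  parameter intervals need no special treatment.
\<close>

section \<open>Free energies and tilted means\<close>

definition exp_integrable :: "'a measure \<Rightarrow> ('a \<Rightarrow> real) \<Rightarrow> bool" where
  "exp_integrable M f \<longleftrightarrow> f \<in> borel_measurable M \<and> (\<forall>c. integrable M (\<lambda>u. exp (c * f u)))"

definition free_energy :: "'a measure \<Rightarrow> real \<Rightarrow> ('a \<Rightarrow> real) \<Rightarrow> real" where
  "free_energy M m f = (if m = 0 then \<integral>u. f u \<partial>M else ln (\<integral>u. exp (m * f u) \<partial>M) / m)"

definition tilted_mean :: "'a measure \<Rightarrow> real \<Rightarrow> ('a \<Rightarrow> real) \<Rightarrow> ('a \<Rightarrow> real) \<Rightarrow> real" where
  "tilted_mean M m f g = (\<integral>u. exp (m * f u) * g u \<partial>M) / (\<integral>u. exp (m * f u) \<partial>M)"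

lemma exp_integrableD:
  assumes "exp_integrable M f"
  shows "f \<in> borel_measurable M" and "integrable M (\<lambda>u. exp (c * f u))"
  using assms by (auto simp: exp_integrable_def)

lemma exp_integrable_integrable:
  assumes "exp_integrable M f"
  shows "integrable M f"
proof (rule Bochner_Integration.integrable_bound)
  show "integrable M (\<lambda>u. exp (1 * f u) + exp (-1 * f u))"
    using assms by (intro Bochner_Integration.integrable_add exp_integrableD)
  show "AE u in M. norm (f u) \<le> norm (exp (1 * f u) + exp (-1 * f u))"
  proof (intro AE_I2)
    fix u
    have "f u \<le> exp (f u)" "- f u \<le> exp (- f u)"
      using exp_ge_add_one_self[of "f u"] exp_ge_add_one_self[of "- f u"] by linarith+
    moreover have "0 < exp (f u)" "0 < exp (- f u)" by simp_all
    ultimately have "\<bar>f u\<bar> \<le> exp (f u) + exp (- f u)" by linarith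
    then show "norm (f u) \<le> norm (exp (1 * f u) + exp (-1 * f u))" by simp
  qed
qed (use assms in \<open>auto simp: exp_integrable_def\<close>)

lemma (in prob_space) integral_exp_pos:
  assumes "exp_integrable M f"
  shows "0 < (\<integral>u. exp (c * f u) \<partial>M)"
  by (rule expectation_greater) (use exp_integrableD[OF assms] in auto)

lemma exp_integrable_mult_bounded:
  assumes f: "exp_integrable M f" and g: "g \<in> borel_measurable M" "\<And>u. \<bar>g u\<bar> \<le> R"
  shows "integrable M (\<lambda>u. exp (c * f u) * g u)"
proof (rule Bochner_Integration.integrable_bound)
  show "integrable M (\<lambda>u. R * exp (c * f u))"
    using exp_integrableD[OF f] by auto
  show "AE u in M. norm (exp (c * f u) * g u) \<le> norm (R * exp (c * f u))"
    using g(2) by (intro AE_I2) (auto simp: abs_mult intro!: mult_right_mono order_trans[OF g(2)])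
qed (use exp_integrableD[OF f] g in auto)

lemma exp_integrable_perturb:
  assumes f: "exp_integrable M f" and f': "f' \<in> borel_measurable M"
    and d: "\<And>u. \<bar>f' u - f u\<bar> \<le> c"
  shows "exp_integrable M f'"
  unfolding exp_integrable_def
proof (intro conjI allI f')
  fix a
  have [measurable]: "f \<in> borel_measurable M" "f' \<in> borel_measurable M"
    using f f' by (auto simp: exp_integrable_def)
  have "integrable M (\<lambda>u. exp (a * f u) * exp (a * (f' u - f u)))"
  proof (rule exp_integrable_mult_bounded[OF f])
    fix u
    have "a * (f' u - f u) \<le> \<bar>a\<bar> * c"
      by (metis abs_ge_self abs_ge_zero abs_mult d mult_left_mono order_trans)
    then show "\<bar>exp (a * (f' u - f u))\<bar> \<le> exp (\<bar>a\<bar> * c)" by simp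
  qed auto
  then show "integrable M (\<lambda>u. exp (a * f' u))"
    by (simp add: exp_add[symmetric] algebra_simps)
qed

lemma exp_integrable_bounded:
  assumes "prob_space M" "f \<in> borel_measurable M" "\<And>u. \<bar>f u\<bar> \<le> R"
  shows "exp_integrable M f"
proof -
  interpret prob_space M by fact
  have "exp_integrable M (\<lambda>u. 0)" by (auto simp: exp_integrable_def)
  from exp_integrable_perturb[OF this assms(2), of R] assms(3) show ?thesis by simp
qed

lemma (in prob_space) tilted_mean_mono:
  assumes f: "exp_integrable M f"
    and g: "g \<in> borel_measurable M" "\<And>u. \<bar>g u\<bar> \<le> R"
    and h: "h \<in> borel_measurable M" "\<And>u. \<bar>h u\<bar> \<le> R'"
    and le: "\<And>u. g u \<le> h u"
  shows "tilted_mean M m f g \<le> tilted_mean M m f h"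
  unfolding tilted_mean_def
  by (intro divide_right_mono integral_mono exp_integrable_mult_bounded[OF f g]
      exp_integrable_mult_bounded[OF f h] mult_left_mono le less_imp_le[OF integral_exp_pos] f) auto

lemma (in prob_space) tilted_mean_const:
  assumes f: "exp_integrable M f"
  shows "tilted_mean M m f (\<lambda>u. c) = c"
  using integral_exp_pos[OF f, of m] by (simp add: tilted_mean_def)

lemma (in prob_space) tilted_mean_bound:
  assumes f: "exp_integrable M f"
    and g: "g \<in> borel_measurable M" "\<And>u. \<bar>g u\<bar> \<le> R"
  shows "\<bar>tilted_mean M m f g\<bar> \<le> R"
proof -
  have R: "0 \<le> R" using g(2)[of undefined] by linarith
  have "tilted_mean M m f g \<le> tilted_mean M m f (\<lambda>u. R)"
    by (rule tilted_mean_mono[OF f g, where R' = R]) (use g R abs_le_D1 in auto)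
  moreover have "tilted_mean M m f (\<lambda>u. -R) \<le> tilted_mean M m f g"
    by (rule tilted_mean_mono[OF f _ _ g, where R = R])
       (use g(2) R in \<open>auto simp: abs_le_iff minus_le_iff\<close>)
  ultimately show ?thesis by (simp add: tilted_mean_const[OF f])
qed

lemma tilted_mean_cmult:
  "tilted_mean M m f (\<lambda>u. c * g u) = c * tilted_mean M m f g"
  "tilted_mean M m f (\<lambda>u. g u * c) = tilted_mean M m f g * c"
proof -
  show *: "tilted_mean M m f (\<lambda>u. c * g u) = c * tilted_mean M m f g" for c g
    by (simp add: tilted_mean_def mult.left_commute[of _ c])
  show "tilted_mean M m f (\<lambda>u. g u * c) = tilted_mean M m f g * c"
    using *[of c g] by (simp add: mult.commute)
qed

lemma tilted_mean_diff:
  assumes f: "exp_integrable M f"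
    and g: "g \<in> borel_measurable M" "\<And>u. \<bar>g u\<bar> \<le> R"
    and h: "h \<in> borel_measurable M" "\<And>u. \<bar>h u\<bar> \<le> R'"
  shows "tilted_mean M m f (\<lambda>u. g u - h u) = tilted_mean M m f g - tilted_mean M m f h"
  unfolding tilted_mean_def
  by (simp add: right_diff_distrib diff_divide_distrib
      Bochner_Integration.integral_diff[OF exp_integrable_mult_bounded[OF f g] exp_integrable_mult_bounded[OF f h]])

lemma tilted_mean_sum:
  assumes f: "exp_integrable M f" and "finite J"
    and g: "\<And>j. j \<in> J \<Longrightarrow> g j \<in> borel_measurable M" "\<And>j u. j \<in> J \<Longrightarrow> \<bar>g j u\<bar> \<le> R j"
  shows "tilted_mean M m f (\<lambda>u. \<Sum>j\<in>J. g j u) = (\<Sum>j\<in>J. tilted_mean M m f (g j))"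
  unfolding tilted_mean_def
  by (simp add: sum_distrib_left sum_divide_distrib
      Bochner_Integration.integral_sum[OF exp_integrable_mult_bounded[OF f g]])

lemma (in prob_space) tilted_mean_close:
  assumes f: "exp_integrable M f"
    and g: "g \<in> borel_measurable M" "\<And>u. \<bar>g u\<bar> \<le> R"
    and h: "h \<in> borel_measurable M" "\<And>u. \<bar>h u\<bar> \<le> R'"
    and le: "\<And>u. \<bar>g u - h u\<bar> \<le> e"
  shows "\<bar>tilted_mean M m f g - tilted_mean M m f h\<bar> \<le> e"
  unfolding tilted_mean_diff[OF f g h, symmetric]
  by (rule tilted_mean_bound[OF f]) (use g h le in auto)

lemma (in prob_space) free_energy_mono:
  assumes f: "exp_integrable M f" and f': "exp_integrable M f'" and le: "\<And>u. f u \<le> f' u"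
  shows "free_energy M m f \<le> free_energy M m f'"
proof -
  consider "m = 0" | "m > 0" | "m < 0" by linarith
  then show ?thesis
  proof cases
    case 1
    then show ?thesis
      unfolding free_energy_def
      using integral_mono[OF exp_integrable_integrable[OF f] exp_integrable_integrable[OF f']] le by simp
  next
    case 2
    have "(\<integral>u. exp (m * f u) \<partial>M) \<le> (\<integral>u. exp (m * f' u) \<partial>M)"
      by (intro integral_mono exp_integrableD f f') (use le 2 in auto)
    then show ?thesis
      using 2 integral_exp_pos[OF f, of m] by (simp add: free_energy_def divide_right_mono)
  next
    case 3
    have "(\<integral>u. exp (m * f' u) \<partial>M) \<le> (\<integral>u. exp (m * f u) \<partial>M)"
      by (intro integral_mono exp_integrableD f f') (use le 3 in auto)
    then show ?thesis
      using 3 integral_exp_pos[OF f', of m] by (simp add: free_energy_def divide_right_mono_neg)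
  qed
qed

lemma (in prob_space) free_energy_add_const:
  assumes f: "exp_integrable M f"
  shows "free_energy M m (\<lambda>u. f u + c) = free_energy M m f + c"
proof (cases "m = 0")
  case True
  then show ?thesis
    using exp_integrable_integrable[OF f] by (simp add: free_energy_def prob_space)
next
  case False
  have "(\<integral>u. exp (m * (f u + c)) \<partial>M) = exp (m * c) * (\<integral>u. exp (m * f u) \<partial>M)"
    by (simp add: distrib_left exp_add mult.commute)
  then have "ln (\<integral>u. exp (m * (f u + c)) \<partial>M) = m * c + ln (\<integral>u. exp (m * f u) \<partial>M)"
    using integral_exp_pos[OF f, of m] by (simp add: ln_mult)
  then show ?thesis using False by (simp add: free_energy_def field_simps)
qed

lemma (in prob_space) free_energy_nonexpansive:
  assumes f: "exp_integrable M f" and f': "f' \<in> borel_measurable M"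
    and d: "\<And>u. \<bar>f' u - f u\<bar> \<le> c"
  shows "\<bar>free_energy M m f' - free_energy M m f\<bar> \<le> c"
proof -
  have e': "exp_integrable M f'" by (rule exp_integrable_perturb[OF f f' d])
  have plus: "exp_integrable M (\<lambda>u. g u + c)" if g: "exp_integrable M g" for g
    by (rule exp_integrable_perturb[OF g, where c = "\<bar>c\<bar>"]) (use g in \<open>auto simp: exp_integrable_def\<close>)
  have 1: "f' u \<le> f u + c" "f u \<le> f' u + c" for u using d[of u] by linarith+
  have "free_energy M m f' \<le> free_energy M m f + c"
    using free_energy_mono[OF e' plus[OF f] 1(1), of m] free_energy_add_const[OF f, of m c] by simp
  moreover have "free_energy M m f \<le> free_energy M m f' + c"
    using free_energy_mono[OF f plus[OF e'] 1(2), of m] free_energy_add_const[OF e', of m c] by simp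
  ultimately show ?thesis by linarith
qed

lemma (in prob_space) ln_integral_exp_bounded:
  fixes X :: "'a \<Rightarrow> real"
  assumes X: "X \<in> borel_measurable M" "\<And>u. \<bar>X u\<bar> \<le> c"
  shows "0 \<le> ln (\<integral>u. exp (m * X u) \<partial>M) - m * (\<integral>u. X u \<partial>M)"
    and "ln (\<integral>u. exp (m * X u) \<partial>M) - m * (\<integral>u. X u \<partial>M) \<le> m\<^sup>2 * c\<^sup>2 / 2"
proof -
  have eX: "exp_integrable M X" by (rule exp_integrable_bounded[OF prob_space_axioms X])
  note iX = exp_integrable_integrable[OF eX]
  have pos: "0 < (\<integral>u. exp (m * X u) \<partial>M)" by (rule integral_exp_pos[OF eX])
  define \<mu> where "\<mu> = (\<integral>u. X u \<partial>M)"
  have shift: "(\<integral>u. exp (m * (X u - \<mu>)) \<partial>M) = exp (- m * \<mu>) * (\<integral>u. exp (m * X u) \<partial>M)"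
    by (simp add: algebra_simps exp_diff exp_minus field_simps)
  have ie: "integrable M (\<lambda>u. exp (m * (X u - \<mu>)))"
    using exp_integrableD(2)[OF eX, of m] by (simp add: right_diff_distrib exp_diff)
  have "(\<integral>u. 1 + m * (X u - \<mu>) \<partial>M) \<le> (\<integral>u. exp (m * (X u - \<mu>)) \<partial>M)"
    using iX ie by (intro integral_mono) auto
  moreover have "(\<integral>u. 1 + m * (X u - \<mu>) \<partial>M) = 1"
    using iX by (simp add: prob_space \<mu>_def)
  ultimately have 1: "1 \<le> exp (- m * \<mu>) * (\<integral>u. exp (m * X u) \<partial>M)"
    using shift by simp
  then have "0 \<le> ln (exp (- m * \<mu>) * (\<integral>u. exp (m * X u) \<partial>M))"
    by simp
  then show "0 \<le> ln (\<integral>u. exp (m * X u) \<partial>M) - m * (\<integral>u. X u \<partial>M)"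
    using pos by (simp add: ln_mult \<mu>_def)
  have upper: "(\<integral>u. exp (l * (Y u - (\<integral>u. Y u \<partial>M))) \<partial>M) \<le> exp (l\<^sup>2 * c\<^sup>2 / 2)"
    if l: "l > 0" and Y: "Y \<in> borel_measurable M" "\<And>u. \<bar>Y u\<bar> \<le> c" for l and Y :: "'a \<Rightarrow> real"
  proof -
    interpret interval_bounded_random_variable M Y "-c" c
      by unfold_locales (use Y(1) abs_le_D1[OF Y(2)] abs_le_D2[OF Y(2)] in \<open>auto simp: minus_le_iff\<close>)
    have eY: "exp_integrable M Y" by (rule exp_integrable_bounded[OF prob_space_axioms Y])
    have ie: "integrable M (\<lambda>u. exp (l * (Y u - (\<integral>u. Y u \<partial>M))))"
      using exp_integrableD(2)[OF eY, of l] by (simp add: right_diff_distrib exp_diff)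
    have "ennreal (\<integral>u. exp (l * (Y u - (\<integral>u. Y u \<partial>M))) \<partial>M) \<le> ennreal (exp (l\<^sup>2 * (c - (-c))\<^sup>2 / 8))"
      using Hoeffdings_lemma_nn_integral[OF l] by (simp add: nn_integral_eq_integral[OF ie])
    moreover have "(c - (-c))\<^sup>2 = 4 * c\<^sup>2" by (simp add: power2_eq_square algebra_simps)
    ultimately show ?thesis by (subst (asm) ennreal_le_iff) (simp_all add: mult.commute)
  qed
  have "(\<integral>u. exp (m * (X u - \<mu>)) \<partial>M) \<le> exp (m\<^sup>2 * c\<^sup>2 / 2)"
  proof -
    consider "m = 0" | "m > 0" | "m < 0" by linarith
    then show ?thesis
    proof cases
      case 2 then show ?thesis using upper[of m X] X by (simp add: \<mu>_def)
    next
      case 3 then show ?thesis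
        using upper[of "-m" "\<lambda>u. - X u"] X iX by (simp add: \<mu>_def algebra_simps)
    qed (simp add: prob_space)
  qed
  then have "ln (exp (- m * \<mu>) * (\<integral>u. exp (m * X u) \<partial>M)) \<le> ln (exp (m\<^sup>2 * c\<^sup>2 / 2))"
    unfolding shift using pos by (subst ln_le_cancel_iff) auto
  then show "ln (\<integral>u. exp (m * X u) \<partial>M) - m * (\<integral>u. X u \<partial>M) \<le> m\<^sup>2 * c\<^sup>2 / 2"
    using pos by (simp add: ln_mult \<mu>_def)
qed

lemma (in prob_space) free_energy_diff:
  assumes f: "exp_integrable M f" and f': "f' \<in> borel_measurable M"
    and d: "\<And>u. \<bar>f' u - f u\<bar> \<le> c"
  shows "\<bar>free_energy M m f' - free_energy M m f - tilted_mean M m f (\<lambda>u. f' u - f u)\<bar> \<le> \<bar>m\<bar> * c\<^sup>2 / 2"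
proof (cases "m = 0")
  case True
  have e': "exp_integrable M f'" by (rule exp_integrable_perturb[OF f f' d])
  show ?thesis
    using True exp_integrable_integrable[OF f] exp_integrable_integrable[OF e']
    by (simp add: free_energy_def tilted_mean_def prob_space)
next
  case False
  have [measurable]: "f \<in> borel_measurable M" "f' \<in> borel_measurable M"
    using f f' by (auto simp: exp_integrable_def)
  have e': "exp_integrable M f'" by (rule exp_integrable_perturb[OF f f' d])
  define z where "z = (\<integral>u. exp (m * f u) \<partial>M)"
  have z: "z > 0" unfolding z_def by (rule integral_exp_pos[OF f])
  define N where "N = density M (\<lambda>u. ennreal (exp (m * f u) / z))"
  have "(\<integral>\<^sup>+ u. ennreal (exp (m * f u) / z) \<partial>M) = 1"
    using exp_integrableD(2)[OF f, of m] z
    by (subst nn_integral_eq_integral) (auto simp: z_def)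
  then interpret N: prob_space N
    by (intro prob_spaceI) (simp add: N_def emeasure_density)
  have N_int: "(\<integral>u. g u \<partial>N) = (\<integral>u. exp (m * f u) * g u \<partial>M) / z" if "g \<in> borel_measurable M" for g :: "'a \<Rightarrow> real"
    unfolding N_def using that z by (subst integral_real_density) auto
  let ?X = "\<lambda>u. f' u - f u"
  have X: "?X \<in> borel_measurable N" by (simp add: N_def)
  have a: "(\<integral>u. ?X u \<partial>N) = tilted_mean M m f ?X"
    by (simp add: N_int tilted_mean_def z_def)
  have b: "(\<integral>u. exp (m * ?X u) \<partial>N) = (\<integral>u. exp (m * f' u) \<partial>M) / z"
    by (simp add: N_int exp_add[symmetric] algebra_simps)
  have "ln (\<integral>u. exp (m * ?X u) \<partial>N) = m * (free_energy M m f' - free_energy M m f)"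
    unfolding b using False z integral_exp_pos[OF e', of m]
    by (simp add: free_energy_def ln_div z_def field_simps)
  with N.ln_integral_exp_bounded[OF X d, where m = m] a
  have "\<bar>m * (free_energy M m f' - free_energy M m f - tilted_mean M m f ?X)\<bar> \<le> m\<^sup>2 * c\<^sup>2 / 2"
    by (simp add: right_diff_distrib)
  then have "\<bar>m\<bar> * \<bar>free_energy M m f' - free_energy M m f - tilted_mean M m f ?X\<bar> \<le> \<bar>m\<bar> * (\<bar>m\<bar> * c\<^sup>2 / 2)"
    by (simp add: abs_mult power2_eq_square)
  then show ?thesis using False by simp
qed

definition exp_moments :: "'b::real_normed_vector measure \<Rightarrow> bool" where
  "exp_moments M \<longleftrightarrow> prob_space M \<and> sets M = sets borel \<and> (\<forall>c. integrable M (\<lambda>u. exp (c * norm u)))"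

lemma exp_moments_prob_space: "exp_moments M \<Longrightarrow> prob_space M"
  by (simp add: exp_moments_def)

lemma exp_moments_sets [measurable_cong]: "exp_moments M \<Longrightarrow> sets M = sets borel"
  by (simp add: exp_moments_def)

lemma exp_moments_borel:
  assumes "exp_moments M" "f \<in> borel_measurable borel"
  shows "f \<in> borel_measurable M"
  using assms measurable_cong_sets[OF exp_moments_sets[OF assms(1)] refl] by blast

lemma exp_moments_continuous:
  fixes f :: "'b::real_normed_vector \<Rightarrow> 'c::topological_space"
  assumes "exp_moments M" "continuous_on UNIV f"
  shows "f \<in> borel_measurable M"
  by (rule exp_moments_borel[OF assms(1) borel_measurable_continuous_onI[OF assms(2)]])

lemma exp_moments_exp_integrable:
  assumes M: "exp_moments M" and f: "f \<in> borel_measurable M" and b: "\<And>u. \<bar>f u\<bar> \<le> C + B * norm u"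
  shows "exp_integrable M f"
  unfolding exp_integrable_def
proof (intro conjI allI f)
  fix c
  show "integrable M (\<lambda>u. exp (c * f u))"
  proof (rule Bochner_Integration.integrable_bound)
    show "integrable M (\<lambda>u. exp (\<bar>c\<bar> * C) * exp ((\<bar>c\<bar> * B) * norm u))"
      using M by (auto simp: exp_moments_def)
    show "AE u in M. norm (exp (c * f u)) \<le> norm (exp (\<bar>c\<bar> * C) * exp ((\<bar>c\<bar> * B) * norm u))"
    proof (rule AE_I2)
      fix u
      have "c * f u \<le> \<bar>c\<bar> * \<bar>f u\<bar>" by (metis abs_ge_self abs_mult)
      also have "\<dots> \<le> \<bar>c\<bar> * (C + B * norm u)" by (intro mult_left_mono b) auto
      finally show "norm (exp (c * f u)) \<le> norm (exp (\<bar>c\<bar> * C) * exp ((\<bar>c\<bar> * B) * norm u))"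
        by (simp add: exp_add[symmetric] algebra_simps)
    qed
  qed (use f in auto)
qed

lemma power_le_exp:
  fixes x :: real
  assumes "0 \<le> x"
  shows "x ^ k \<le> fact k * exp x"
proof -
  have "x ^ k / fact k \<le> exp x"
    using sum_le_suminf[OF summable_exp_generic[of x], of "{k}"] assms
    by (simp add: exp_def divide_inverse mult.commute)
  then show ?thesis by (simp add: field_simps)
qed

lemma exp_moments_power:
  assumes M: "exp_moments M"
  shows "integrable M (\<lambda>u. norm u ^ k * exp (c * norm u))"
proof (rule Bochner_Integration.integrable_bound)
  show "integrable M (\<lambda>u. fact k * exp ((1 + c) * norm u))"
    using M by (auto simp: exp_moments_def)
  have "norm u ^ k * exp (c * norm u) \<le> fact k * exp (norm u) * exp (c * norm u)" for u :: 'a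
    by (intro mult_right_mono power_le_exp) auto
  then show "AE u in M. norm (norm u ^ k * exp (c * norm u)) \<le> norm (fact k * exp ((1 + c) * norm u))"
    by (intro AE_I2) (simp add: exp_add distrib_right mult.assoc)
  show "(\<lambda>u. norm u ^ k * exp (c * norm u)) \<in> borel_measurable M"
    by (intro exp_moments_continuous[OF M] continuous_intros)
qed

lemma exp_moments_power': "exp_moments M \<Longrightarrow> integrable M (\<lambda>u. norm u ^ k)"
  using exp_moments_power[of M k 0] by simp

lemma exp_moments_integrable_growth:
  fixes f :: "'b::real_normed_vector \<Rightarrow> real"
  assumes M: "exp_moments M" and f: "f \<in> borel_measurable M" and b: "\<And>u. \<bar>f u\<bar> \<le> C * norm u ^ k"
  shows "integrable M f"
proof (rule Bochner_Integration.integrable_bound[where g = f])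
  show "integrable M (\<lambda>u. C * norm u ^ k)" using exp_moments_power'[OF M] by auto
  show "AE u in M. norm (f u) \<le> norm (C * norm u ^ k)"
    using order_trans[OF b abs_ge_self] by (intro AE_I2) simp
qed fact

lemma exp_third_order_remainder:
  fixes x :: real
  shows "\<bar>exp x - 1 - x - x\<^sup>2 / 2\<bar> \<le> \<bar>x\<bar> ^ 3 * exp \<bar>x\<bar>"
proof -
  obtain t where t: "\<bar>t\<bar> \<le> \<bar>x\<bar>" "exp x = (\<Sum>k<3. (x ^ k) / fact k) + (exp t / fact 3) * x ^ 3"
    using Maclaurin_exp_le by blast
  have "exp x - 1 - x - x\<^sup>2 / 2 = exp t / 6 * x ^ 3"
    using t(2) by (simp add: eval_nat_numeral)
  then have "\<bar>exp x - 1 - x - x\<^sup>2 / 2\<bar> = exp t / 6 * \<bar>x\<bar> ^ 3"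
    by (simp only: abs_mult power_abs) simp
  also have "\<dots> \<le> exp \<bar>x\<bar> * \<bar>x\<bar> ^ 3"
  proof (rule mult_right_mono)
    have "exp t \<le> exp \<bar>x\<bar>" using t(1) by simp
    then show "exp t / 6 \<le> exp \<bar>x\<bar>" using exp_gt_zero[of t] by linarith
  qed auto
  finally show ?thesis by (simp add: mult.commute)
qed

lemma ln_integral_exp_small:
  fixes M :: "'b::real_normed_vector measure"
  assumes M: "exp_moments M" and a: "0 \<le> a" and b: "0 \<le> b"
  obtains C \<delta> :: real where "0 \<le> C" "0 < \<delta>" "\<delta> \<le> 1"
    "\<And>X Y h. \<lbrakk>0 \<le> h; h \<le> \<delta>; X \<in> borel_measurable M; Y \<in> borel_measurable M;
      \<And>u. \<bar>X u\<bar> \<le> a * sqrt h * norm u; \<And>u. \<bar>Y u\<bar> \<le> a * norm u;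
      \<And>u. \<bar>X u - sqrt h * Y u\<bar> \<le> b * h * norm u ^ 2; (\<integral>u. Y u \<partial>M) = 0\<rbrakk> \<Longrightarrow>
      \<bar>ln (\<integral>u. exp (X u) \<partial>M) - (\<integral>u. X u \<partial>M) - h / 2 * (\<integral>u. Y u ^ 2 \<partial>M)\<bar> \<le> C * (h * sqrt h)"
proof -
  interpret prob_space M by (rule exp_moments_prob_space[OF M])
  define N2 where "N2 = (\<integral>u. norm u ^ 2 \<partial>M)"
  define N3 where "N3 = (\<integral>u. norm u ^ 3 \<partial>M)"
  define E3 where "E3 = (\<integral>u. norm u ^ 3 * exp (a * norm u) \<partial>M)"
  have N: "0 \<le> N2" "0 \<le> N3" "0 \<le> E3" by (simp_all add: N2_def N3_def E3_def)
  define c where "c = b * N2 + a\<^sup>2 * N2 / 2 + a ^ 3 * E3"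
  have c: "0 \<le> c" using a b N by (simp add: c_def)
  define \<delta> where "\<delta> = 1 / (2 * c + 1)"
  define C where "C = 2 * c\<^sup>2 + a * b * N3 + a ^ 3 * E3"
  show thesis
  proof (rule that[of C \<delta>])
    show "0 \<le> C" using a b c N by (simp add: C_def)
    show "0 < \<delta>" "\<delta> \<le> 1" using c by (simp_all add: \<delta>_def)
    fix X Y :: "'b \<Rightarrow> real" and h :: real
    assume h: "0 \<le> h" "h \<le> \<delta>"
      and meas[measurable]: "X \<in> borel_measurable M" "Y \<in> borel_measurable M"
      and X: "\<And>u. \<bar>X u\<bar> \<le> a * sqrt h * norm u" and Y: "\<And>u. \<bar>Y u\<bar> \<le> a * norm u"
      and XY: "\<And>u. \<bar>X u - sqrt h * Y u\<bar> \<le> b * h * norm u ^ 2" and Y0: "(\<integral>u. Y u \<partial>M) = 0"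
    have h1: "h \<le> 1" using h \<open>\<delta> \<le> 1\<close> by linarith
    have sq: "sqrt h \<le> 1" "sqrt h * sqrt h = h" "0 \<le> sqrt h" using h1 h by auto
    have hh: "h * sqrt h \<le> h" using mult_left_mono[OF sq(1) h(1)] by simp
    have hh2: "h * h \<le> h * sqrt h"
      using mult_left_mono[OF mult_left_mono[OF sq(1) sq(3)] h(1)] sq by simp
    have iX: "integrable M X"
      by (rule exp_moments_integrable_growth[OF M, where k = 1 and C = "a * sqrt h"]) (use X in auto)
    have iY: "integrable M Y"
      by (rule exp_moments_integrable_growth[OF M, where k = 1 and C = a]) (use Y in auto)
    have X2: "X u ^ 2 \<le> a\<^sup>2 * h * norm u ^ 2" for u
    proof -
      have "X u ^ 2 \<le> (a * sqrt h * norm u) ^ 2"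
        using power_mono[OF X[of u] abs_ge_zero, of 2] by simp
      also have "\<dots> = a\<^sup>2 * h * norm u ^ 2" using h by (simp add: power_mult_distrib)
      finally show ?thesis .
    qed
    have Y2: "Y u ^ 2 \<le> a\<^sup>2 * norm u ^ 2" for u
      using power_mono[OF Y[of u] abs_ge_zero, of 2] by (simp add: power_mult_distrib)
    have iX2: "integrable M (\<lambda>u. X u ^ 2)"
      by (rule exp_moments_integrable_growth[OF M, where k = 2 and C = "a\<^sup>2 * h"]) (use X2 in auto)
    have iY2: "integrable M (\<lambda>u. Y u ^ 2)"
      by (rule exp_moments_integrable_growth[OF M, where k = 2 and C = "a\<^sup>2"]) (use Y2 in auto)
    have eX: "exp_integrable M X"
      by (rule exp_moments_exp_integrable[OF M, where C = 0 and B = "a * sqrt h"]) (use X in auto)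
    have ie: "integrable M (\<lambda>u. exp (X u))" using exp_integrableD(2)[OF eX, of 1] by simp
    define \<rho> where "\<rho> u = exp (X u) - 1 - X u - X u ^ 2 / 2" for u
    have i\<rho>: "integrable M \<rho>" unfolding \<rho>_def using ie iX iX2 by auto
    have \<rho>: "\<bar>\<rho> u\<bar> \<le> (a ^ 3 * (h * sqrt h)) * (norm u ^ 3 * exp (a * norm u))" for u
    proof -
      have "\<bar>\<rho> u\<bar> \<le> \<bar>X u\<bar> ^ 3 * exp \<bar>X u\<bar>" unfolding \<rho>_def by (rule exp_third_order_remainder)
      also have "\<dots> \<le> (a * sqrt h * norm u) ^ 3 * exp (a * norm u)"
      proof (intro mult_mono power_mono X)
        have "\<bar>X u\<bar> \<le> a * 1 * norm u"
          by (rule order_trans[OF X]) (use a sq in \<open>intro mult_right_mono mult_left_mono; auto\<close>)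
        then show "exp \<bar>X u\<bar> \<le> exp (a * norm u)" by simp
      qed (use a sq in auto)
      also have "\<dots> = (a ^ 3 * (sqrt h * sqrt h * sqrt h)) * (norm u ^ 3 * exp (a * norm u))"
        by (simp add: power_mult_distrib power3_eq_cube mult_ac)
      finally show ?thesis using sq by simp
    qed
    have E\<rho>: "\<bar>\<integral>u. \<rho> u \<partial>M\<bar> \<le> a ^ 3 * (h * sqrt h) * E3"
    proof -
      have "\<bar>\<integral>u. \<rho> u \<partial>M\<bar> \<le> (\<integral>u. \<bar>\<rho> u\<bar> \<partial>M)" by (rule integral_abs_bound)
      also have "\<dots> \<le> (\<integral>u. (a ^ 3 * (h * sqrt h)) * (norm u ^ 3 * exp (a * norm u)) \<partial>M)"
        using i\<rho> exp_moments_power[OF M, of 3 a] by (intro integral_mono \<rho>) auto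
      finally show ?thesis by (simp add: E3_def)
    qed
    have EX: "\<bar>\<integral>u. X u \<partial>M\<bar> \<le> b * h * N2"
    proof -
      have "(\<integral>u. X u \<partial>M) = (\<integral>u. X u - sqrt h * Y u \<partial>M)" using iX iY Y0 by simp
      also have "\<bar>\<dots>\<bar> \<le> (\<integral>u. \<bar>X u - sqrt h * Y u\<bar> \<partial>M)" by (rule integral_abs_bound)
      also have "\<dots> \<le> (\<integral>u. b * h * norm u ^ 2 \<partial>M)"
        using iX iY exp_moments_power'[OF M, of 2] by (intro integral_mono XY) auto
      finally show ?thesis by (simp add: N2_def)
    qed
    have EX2: "\<bar>\<integral>u. X u ^ 2 \<partial>M\<bar> \<le> a\<^sup>2 * h * N2"
    proof -
      have "(\<integral>u. X u ^ 2 \<partial>M) \<le> (\<integral>u. a\<^sup>2 * h * norm u ^ 2 \<partial>M)"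
        using iX2 exp_moments_power'[OF M, of 2] by (intro integral_mono X2) auto
      then show ?thesis by (simp add: N2_def)
    qed
    have EXY: "\<bar>(\<integral>u. X u ^ 2 \<partial>M) - h * (\<integral>u. Y u ^ 2 \<partial>M)\<bar> \<le> 2 * a * b * (h * sqrt h) * N3"
    proof -
      have pw: "\<bar>X u ^ 2 - h * Y u ^ 2\<bar> \<le> 2 * a * b * (h * sqrt h) * norm u ^ 3" for u
      proof -
        have "X u ^ 2 - (r * r) * Y u ^ 2 = (X u - r * Y u) * (X u + r * Y u)" for r :: real
          by algebra
        from this[of "sqrt h"] have "X u ^ 2 - h * Y u ^ 2 = (X u - sqrt h * Y u) * (X u + sqrt h * Y u)"
          by (simp only: sq(2))
        moreover have "\<bar>X u + sqrt h * Y u\<bar> \<le> 2 * (a * sqrt h * norm u)"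
        proof -
          have "\<bar>sqrt h * Y u\<bar> \<le> a * sqrt h * norm u"
            using mult_left_mono[OF Y[of u] sq(3)] sq by (simp add: abs_mult mult_ac)
          then show ?thesis using X[of u] by linarith
        qed
        ultimately have "\<bar>X u ^ 2 - h * Y u ^ 2\<bar> \<le> (b * h * norm u ^ 2) * (2 * (a * sqrt h * norm u))"
          using b h by (simp only: abs_mult) (intro mult_mono XY, auto)
        then show ?thesis by (simp add: power2_eq_square power3_eq_cube mult_ac)
      qed
      have "(\<integral>u. X u ^ 2 \<partial>M) - h * (\<integral>u. Y u ^ 2 \<partial>M) = (\<integral>u. X u ^ 2 - h * Y u ^ 2 \<partial>M)"
        using iX2 iY2 by simp
      also have "\<bar>\<dots>\<bar> \<le> (\<integral>u. \<bar>X u ^ 2 - h * Y u ^ 2\<bar> \<partial>M)" by (rule integral_abs_bound)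
      also have "\<dots> \<le> (\<integral>u. 2 * a * b * (h * sqrt h) * norm u ^ 3 \<partial>M)"
        using iX2 iY2 exp_moments_power'[OF M, of 3] by (intro integral_mono pw) auto
      finally show ?thesis by (simp add: N3_def)
    qed
    define z where "z = (\<integral>u. exp (X u) \<partial>M) - 1"
    have z: "z = (\<integral>u. X u \<partial>M) + (\<integral>u. X u ^ 2 \<partial>M) / 2 + (\<integral>u. \<rho> u \<partial>M)"
      unfolding z_def \<rho>_def using ie iX iX2 by (simp add: prob_space)
    have "\<bar>z\<bar> \<le> b * h * N2 + a\<^sup>2 * h * N2 / 2 + a ^ 3 * (h * sqrt h) * E3"
      unfolding z using EX EX2 E\<rho> by linarith
    also have "\<dots> \<le> b * h * N2 + a\<^sup>2 * h * N2 / 2 + a ^ 3 * h * E3"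
      using hh h a N by (intro add_mono mult_right_mono mult_left_mono) auto
    also have "\<dots> = c * h" by (simp add: c_def algebra_simps)
    finally have zc: "\<bar>z\<bar> \<le> c * h" .
    have "c * h \<le> c * \<delta>" using h c by (intro mult_left_mono)
    also have "\<dots> \<le> 1 / 2" using c by (simp add: \<delta>_def field_simps)
    finally have z2: "\<bar>z\<bar> \<le> 1 / 2" using zc by linarith
    have "\<bar>ln (1 + z) - z\<bar> \<le> 2 * z\<^sup>2" by (rule abs_ln_one_plus_x_minus_x_bound[OF z2])
    also have "\<dots> \<le> 2 * (c * h)\<^sup>2"
      using power_mono[OF zc abs_ge_zero, of 2] by simp
    also have "\<dots> \<le> 2 * c\<^sup>2 * (h * sqrt h)"
      using mult_left_mono[OF hh2, of "2 * c\<^sup>2"] by (simp add: power2_eq_square mult_ac)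
    finally have ln: "\<bar>ln (1 + z) - z\<bar> \<le> 2 * c\<^sup>2 * (h * sqrt h)" .
    have "\<bar>ln (1 + z) - (\<integral>u. X u \<partial>M) - h / 2 * (\<integral>u. Y u ^ 2 \<partial>M)\<bar>
       \<le> 2 * c\<^sup>2 * (h * sqrt h) + (2 * a * b * (h * sqrt h) * N3) / 2 + a ^ 3 * (h * sqrt h) * E3"
    proof -
      have *: "\<bar>L - x - h / 2 * y\<bar> \<le> p + q / 2 + w"
        if "\<bar>L - v\<bar> \<le> p" "\<bar>s - h * y\<bar> \<le> q" "\<bar>r\<bar> \<le> w" "v = x + s / 2 + r" for L v p s y q r w x :: real
      proof -
        have "h / 2 * y = (h * y) / 2" by simp
        then show ?thesis using that by linarith
      qed
      show ?thesis by (rule *[OF ln EXY E\<rho> z])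
    qed
    moreover have "2 * c\<^sup>2 * H + (2 * a * b * H * N3) / 2 + a ^ 3 * H * E3 = C * H" for H
      by (simp add: C_def distrib_right)
    moreover have "1 + z = (\<integral>u. exp (X u) \<partial>M)" by (simp add: z_def)
    ultimately show "\<bar>ln (\<integral>u. exp (X u) \<partial>M) - (\<integral>u. X u \<partial>M) - h / 2 * (\<integral>u. Y u ^ 2 \<partial>M)\<bar> \<le> C * (h * sqrt h)"
      by (simp only:)
  qed
qed

lemma tilted_mean_tendsto:
  fixes M :: "'b::real_normed_vector measure"
  assumes M: "exp_moments M"
    and f: "\<And>n. f n \<in> borel_measurable M" "\<And>n u. \<bar>f n u\<bar> \<le> C + B * norm u"
      "\<And>u. (\<lambda>n. f n u) \<longlonglongrightarrow> f' u"
    and g: "\<And>n. g n \<in> borel_measurable M" "\<And>n u. \<bar>g n u\<bar> \<le> R" "\<And>u. (\<lambda>n. g n u) \<longlonglongrightarrow> g' u"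
  shows "(\<lambda>n. tilted_mean M m (f n) (g n)) \<longlonglongrightarrow> tilted_mean M m f' g'"
    and "(\<lambda>n. free_energy M m (f n)) \<longlonglongrightarrow> free_energy M m f'"
proof -
  interpret prob_space M by (rule exp_moments_prob_space[OF M])
  have f': "f' \<in> borel_measurable M" by (rule borel_measurable_LIMSEQ_metric[OF f(1,3)])
  have g': "g' \<in> borel_measurable M" by (rule borel_measurable_LIMSEQ_metric[OF g(1,3)])
  note [measurable] = f(1) g(1) f' g'
  have f'b: "\<bar>f' u\<bar> \<le> C + B * norm u" for u
    by (rule LIMSEQ_le_const2[OF tendsto_rabs[OF f(3)]]) (use f(2) in auto)
  have R: "0 \<le> R" using g(2)[of undefined undefined] by linarith
  define w where "w u = exp (\<bar>m\<bar> * C) * exp ((\<bar>m\<bar> * B) * norm u)" for u :: 'b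
  have w: "integrable M w" using M unfolding w_def[abs_def] by (auto simp: exp_moments_def)
  have bw: "exp (m * f n u) \<le> w u" for n u
  proof -
    have "m * f n u \<le> \<bar>m\<bar> * \<bar>f n u\<bar>" by (metis abs_ge_self abs_mult)
    also have "\<dots> \<le> \<bar>m\<bar> * (C + B * norm u)" by (intro mult_left_mono f) auto
    finally show ?thesis by (simp add: w_def exp_add[symmetric] algebra_simps)
  qed
  have 1: "(\<lambda>n. \<integral>u. exp (m * f n u) * g n u \<partial>M) \<longlonglongrightarrow> (\<integral>u. exp (m * f' u) * g' u \<partial>M)"
  proof (rule integral_dominated_convergence[where w = "\<lambda>u. w u * R"])
    show "AE u in M. norm (exp (m * f n u) * g n u) \<le> w u * R" for n
      using R by (intro AE_I2) (auto simp: abs_mult w_def intro!: mult_mono bw[unfolded w_def] g)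
  qed (use w f g in \<open>auto intro!: AE_I2 tendsto_intros\<close>)
  have 2: "(\<lambda>n. \<integral>u. exp (m * f n u) \<partial>M) \<longlonglongrightarrow> (\<integral>u. exp (m * f' u) \<partial>M)"
    by (rule integral_dominated_convergence[where w = w])
       (use w f bw in \<open>auto intro!: AE_I2 tendsto_intros\<close>)
  have pos: "0 < (\<integral>u. exp (m * f' u) \<partial>M)"
    by (rule integral_exp_pos) (rule exp_moments_exp_integrable[OF M f' f'b])
  show "(\<lambda>n. tilted_mean M m (f n) (g n)) \<longlonglongrightarrow> tilted_mean M m f' g'"
    unfolding tilted_mean_def using pos by (intro tendsto_divide 1 2) auto
  have 3: "(\<lambda>n. \<integral>u. f n u \<partial>M) \<longlonglongrightarrow> (\<integral>u. f' u \<partial>M)"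
  proof (rule integral_dominated_convergence[where w = "\<lambda>u. C + B * norm u"])
    show "integrable M (\<lambda>u. C + B * norm u)" using exp_moments_power'[OF M, of 1] by auto
  qed (use f in \<open>auto intro!: AE_I2\<close>)
  show "(\<lambda>n. free_energy M m (f n)) \<longlonglongrightarrow> free_energy M m f'"
    unfolding free_energy_def using 2 3 pos by (auto intro!: tendsto_intros)
qed

section \<open>Energy steps of a noise tower\<close>

definition energy_step ::
    "'b measure \<Rightarrow> real \<Rightarrow> ('b \<Rightarrow> 's::euclidean_space) \<Rightarrow> ('s \<Rightarrow> real) \<Rightarrow> 's \<Rightarrow> real" where
  "energy_step M m A F s = free_energy M m (\<lambda>u. F (s + A u))"

definition mean_step ::
    "'b measure \<Rightarrow> real \<Rightarrow> ('b \<Rightarrow> 's::euclidean_space) \<Rightarrow> ('s \<Rightarrow> real) \<Rightarrow> ('s \<Rightarrow> real) \<Rightarrow> 's \<Rightarrow> real" where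
  "mean_step M m A F g s = tilted_mean M m (\<lambda>u. F (s + A u)) (\<lambda>u. g (s + A u))"

definition noise_map :: "real \<Rightarrow> ('b::euclidean_space \<Rightarrow> 's::euclidean_space) \<Rightarrow> bool" where
  "noise_map L A \<longleftrightarrow> 0 \<le> L \<and> continuous_on UNIV A \<and> (\<forall>u. norm (A u) \<le> L * norm u)"

definition noise_family ::
    "'p::metric_space set \<Rightarrow> real \<Rightarrow> ('p \<Rightarrow> 'b::euclidean_space \<Rightarrow> 's::euclidean_space) \<Rightarrow> bool" where
  "noise_family T L A \<longleftrightarrow> (\<forall>v\<in>T. noise_map L (A v)) \<and> (\<forall>u. continuous_on T (\<lambda>v. A v u))"

definition lip_family ::
    "'p::metric_space set \<Rightarrow> real \<Rightarrow> ('p \<Rightarrow> 's::euclidean_space \<Rightarrow> real) \<Rightarrow> bool" where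
  "lip_family T B F \<longleftrightarrow> continuous_on (T \<times> UNIV) (\<lambda>(v, s). F v s) \<and> (\<forall>v\<in>T. B-lipschitz_on UNIV (F v))"

definition bdd_family ::
    "'p::metric_space set \<Rightarrow> real \<Rightarrow> ('p \<Rightarrow> 's::euclidean_space \<Rightarrow> real) \<Rightarrow> bool" where
  "bdd_family T R g \<longleftrightarrow> continuous_on (T \<times> UNIV) (\<lambda>(v, s). g v s) \<and> (\<forall>v\<in>T. \<forall>s. \<bar>g v s\<bar> \<le> R)"

lemma family_continuous:
  assumes "continuous_on (T \<times> UNIV) (\<lambda>(v, s). g v s)" "v \<in> T"
  shows "continuous_on UNIV (g v)"
proof -
  have "continuous_on UNIV (\<lambda>s. (\<lambda>(v, s). g v s) (v, s))"
    by (rule continuous_on_compose2[OF assms(1)]) (use assms(2) in \<open>auto intro!: continuous_intros\<close>)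
  then show ?thesis by simp
qed

lemma lipschitz_add:
  fixes F :: "'s::euclidean_space \<Rightarrow> real"
  assumes "B-lipschitz_on UNIV F"
  shows "\<bar>F (s + w) - F s\<bar> \<le> B * norm w"
  using lipschitz_onD[OF assms, of "s + w" s] by (simp add: dist_norm)

lemma noise_mapD:
  assumes "noise_map L A"
  shows "0 \<le> L" "continuous_on UNIV A" "norm (A u) \<le> L * norm u"
  using assms by (auto simp: noise_map_def)

lemma shifted_continuous:
  assumes "continuous_on UNIV g" "noise_map L A"
  shows "continuous_on UNIV (\<lambda>u. g (s + A u))"
  by (rule continuous_on_compose2[OF assms(1)]) (auto intro!: continuous_intros noise_mapD[OF assms(2)])

lemma step_exp_integrable:
  assumes M: "exp_moments M" and F: "B-lipschitz_on UNIV F" and A: "noise_map L A"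
  shows "exp_integrable M (\<lambda>u. F (s + A u))"
proof (rule exp_moments_exp_integrable[OF M])
  show "(\<lambda>u. F (s + A u)) \<in> borel_measurable M"
    by (intro exp_moments_continuous[OF M] shifted_continuous[OF _ A] lipschitz_on_continuous_on[OF F])
  fix u
  have "\<bar>F (s + A u) - F s\<bar> \<le> B * norm (A u)" by (rule lipschitz_add[OF F])
  also have "\<dots> \<le> B * (L * norm u)"
    using noise_mapD(3)[OF A] lipschitz_on_nonneg[OF F] by (intro mult_left_mono) auto
  finally show "\<bar>F (s + A u)\<bar> \<le> \<bar>F s\<bar> + (B * L) * norm u" by (simp add: mult.assoc)
qed

lemma step_measurable:
  assumes M: "exp_moments M" and g: "continuous_on UNIV g" and A: "noise_map L A"
  shows "(\<lambda>u. g (s + A u)) \<in> borel_measurable M"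
  by (intro exp_moments_continuous[OF M] shifted_continuous[OF g A])

lemma mean_step_bound:
  assumes M: "exp_moments M" and F: "B-lipschitz_on UNIV F" and A: "noise_map L A"
    and g: "continuous_on UNIV g" "\<And>s. \<bar>g s\<bar> \<le> R"
  shows "\<bar>mean_step M m A F g s\<bar> \<le> R"
  unfolding mean_step_def
  by (rule prob_space.tilted_mean_bound[OF exp_moments_prob_space[OF M] step_exp_integrable[OF M F A]])
     (use step_measurable[OF M g(1) A] g(2) in auto)

lemma energy_step_lipschitz:
  assumes M: "exp_moments M" and F: "B-lipschitz_on UNIV F" and A: "noise_map L A"
  shows "B-lipschitz_on UNIV (energy_step M m A F)"
proof (rule lipschitz_onI)
  fix x y :: 'b
  have "\<bar>F (x + A u) - F (y + A u)\<bar> \<le> B * dist x y" for u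
    using lipschitz_onD[OF F, of "x + A u" "y + A u"] by (simp add: dist_norm)
  then show "dist (energy_step M m A F x) (energy_step M m A F y) \<le> B * dist x y"
    unfolding energy_step_def dist_real_def
    by (intro prob_space.free_energy_nonexpansive[OF exp_moments_prob_space[OF M] step_exp_integrable[OF M F A]]
        step_measurable[OF M lipschitz_on_continuous_on[OF F] A])
qed (rule lipschitz_on_nonneg[OF F])

lemma
  assumes M: "exp_moments M" and F: "lip_family T B F" and A: "noise_family T L A"
  shows energy_step_family: "lip_family T B (\<lambda>v. energy_step M m (A v) (F v))"
    and mean_step_family: "bdd_family T R g \<Longrightarrow> bdd_family T R (\<lambda>v. mean_step M m (A v) (F v) (g v))"
proof -
  have B: "0 \<le> B" if "v \<in> T" for v using F that lipschitz_on_nonneg by (auto simp: lip_family_def)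
  note cF = F[unfolded lip_family_def, THEN conjunct1]
  have lF: "B-lipschitz_on UNIV (F v)" if "v \<in> T" for v using F that by (simp add: lip_family_def)
  have nA: "noise_map L (A v)" if "v \<in> T" for v using A that by (simp add: noise_family_def)
  have lim:
    "(\<lambda>n. energy_step M m (A (fst (x n))) (F (fst (x n))) (snd (x n)))
       \<longlonglongrightarrow> energy_step M m (A (fst a)) (F (fst a)) (snd a) \<and>
     (\<lambda>n. mean_step M m (A (fst (x n))) (F (fst (x n))) (g (fst (x n))) (snd (x n)))
       \<longlonglongrightarrow> mean_step M m (A (fst a)) (F (fst a)) (g (fst a)) (snd a)"
    if x: "\<And>n. x n \<in> T \<times> UNIV" and a: "a \<in> T \<times> UNIV" and lim: "x \<longlonglongrightarrow> a" and g: "bdd_family T R g"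
    for x a g R
  proof -
    define v s where "v n = fst (x n)" and "s n = snd (x n)" for n
    obtain v0 s0 where a': "a = (v0, s0)" by fastforce
    have v: "v n \<in> T" for n using x[of n] by (auto simp: v_def mem_Times_iff)
    have v0: "v0 \<in> T" using a a' by simp
    have lv: "v \<longlonglongrightarrow> v0" and ls: "s \<longlonglongrightarrow> s0"
      using tendsto_fst[OF lim] tendsto_snd[OF lim] by (auto simp: a' v_def[abs_def] s_def[abs_def])
    have lA: "(\<lambda>n. A (v n) u) \<longlonglongrightarrow> A v0 u" for u
      using A v v0 lv by (intro continuous_on_tendsto_compose[where f = "\<lambda>v. A v u" and s = T])
        (auto simp: noise_family_def)
    have lp: "(\<lambda>n. (v n, s n + A (v n) u)) \<longlonglongrightarrow> (v0, s0 + A v0 u)" for u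
      by (intro tendsto_intros lv ls lA)
    have cont: "(\<lambda>n. G (v n) (s n + A (v n) u)) \<longlonglongrightarrow> G v0 (s0 + A v0 u)"
      if "continuous_on (T \<times> UNIV) (\<lambda>(v, s). G v s)" for G :: "_ \<Rightarrow> _ \<Rightarrow> real" and u
      using continuous_on_tendsto_compose[OF that lp[of u]] v v0 by simp
    have lF0: "(\<lambda>n. F (v n) 0) \<longlonglongrightarrow> F v0 0"
      using continuous_on_tendsto_compose[OF cF tendsto_Pair[OF lv tendsto_const[of 0]]] v v0 by simp
    have "(\<lambda>n. \<bar>F (v n) 0\<bar> + B * norm (s n)) \<longlonglongrightarrow> \<bar>F v0 0\<bar> + B * norm s0"
      by (intro tendsto_intros lF0 ls)
    then have "Bseq (\<lambda>n. \<bar>F (v n) 0\<bar> + B * norm (s n))"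
      by (intro convergent_imp_Bseq convergentI)
    then obtain C where C: "\<And>n. norm (\<bar>F (v n) 0\<bar> + B * norm (s n)) \<le> C" unfolding Bseq_def by blast
    have bF: "\<bar>F (v n) (s n + A (v n) u)\<bar> \<le> C + (B * L) * norm u" for n u
    proof -
      have "\<bar>F (v n) (s n + A (v n) u)\<bar> \<le> \<bar>F (v n) 0\<bar> + B * norm (s n + A (v n) u)"
        using lipschitz_add[OF lF[OF v[of n]], where s = 0 and w = "s n + A (v n) u"] by simp
      also have "\<dots> \<le> \<bar>F (v n) 0\<bar> + B * (norm (s n) + L * norm u)"
        using noise_mapD(3)[OF nA[OF v], of n u] B[OF v0] norm_triangle_ineq[of "s n" "A (v n) u"]
        by (intro add_left_mono mult_left_mono) auto
      also have "\<dots> \<le> C + (B * L) * norm u" using C[of n] by (simp add: algebra_simps)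
      finally show ?thesis .
    qed
    note cg = g[unfolded bdd_family_def, THEN conjunct1]
    have mF: "(\<lambda>u. F (v n) (s n + A (v n) u)) \<in> borel_measurable M" for n
      by (rule step_measurable[OF M family_continuous[OF cF v] nA[OF v]])
    have mg: "(\<lambda>u. g (v n) (s n + A (v n) u)) \<in> borel_measurable M" for n
      by (rule step_measurable[OF M family_continuous[OF cg v] nA[OF v]])
    have bg: "\<bar>g (v n) (s n + A (v n) u)\<bar> \<le> R" for n u
      using g v by (auto simp: bdd_family_def)
    show ?thesis
      using tilted_mean_tendsto[OF M mF bF cont[OF cF] mg bg cont[OF cg]]
      by (simp add: energy_step_def mean_step_def v_def s_def a')
  qed
  have "bdd_family T 0 (\<lambda>v s. 0)" by (simp add: bdd_family_def)
  note lim0 = lim[OF _ _ _ this, THEN conjunct1]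
  show "lip_family T B (\<lambda>v. energy_step M m (A v) (F v))"
    unfolding lip_family_def continuous_on_sequentially
    using lim0 energy_step_lipschitz[OF M lF nA] by (auto simp: comp_def case_prod_unfold)
  show "bdd_family T R (\<lambda>v. mean_step M m (A v) (F v) (g v))" if g: "bdd_family T R g" for R g
    unfolding bdd_family_def continuous_on_sequentially
  proof (intro conjI allI ballI impI)
    show "\<bar>mean_step M m (A v) (F v) (g v) s\<bar> \<le> R" if "v \<in> T" for v s
      by (rule mean_step_bound[OF M lF[OF that] nA[OF that]])
         (use g that family_continuous in \<open>auto simp: bdd_family_def\<close>)
  qed (use lim[OF _ _ _ g, THEN conjunct2] in \<open>auto simp: comp_def case_prod_unfold\<close>)
qed

lemma mean_step_continuous:
  assumes M: "exp_moments M" and F: "B-lipschitz_on UNIV F" and A: "noise_map L A"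
    and g: "continuous_on UNIV g" "\<And>s. \<bar>g s\<bar> \<le> R"
  shows "continuous_on UNIV (mean_step M m A F g)"
proof -
  have c: "continuous_on ({0::real} \<times> UNIV) (\<lambda>(v, s). G s)" if "continuous_on UNIV G" for G :: "_ \<Rightarrow> real"
    unfolding case_prod_unfold by (rule continuous_on_compose2[OF that]) (auto intro!: continuous_intros)
  have "bdd_family {0::real} R (\<lambda>v. mean_step M m A F g)"
    by (rule mean_step_family[OF M, where L = L and B = B])
       (use F A g c lipschitz_on_continuous_on[OF F] in \<open>auto simp: lip_family_def noise_family_def bdd_family_def\<close>)
  then show ?thesis using family_continuous[of "{0::real}" "\<lambda>_. mean_step M m A F g" 0]
    by (simp add: bdd_family_def)
qed

definition first_order ::
    "'j set \<Rightarrow> ('j \<Rightarrow> 's::euclidean_space \<Rightarrow> real) \<Rightarrow> real \<Rightarrow> ('s \<Rightarrow> real) \<Rightarrow> ('j \<Rightarrow> 's \<Rightarrow> real) \<Rightarrow> bool" where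
  "first_order J D K F \<Gamma> \<longleftrightarrow>
     (\<forall>s w. \<bar>F (s + w) - F s - (\<Sum>j\<in>J. \<Gamma> j s * D j w)\<bar> \<le> K * norm w ^ 2) \<and>
     (\<forall>j\<in>J. continuous_on UNIV (\<Gamma> j) \<and> (\<forall>s. \<bar>\<Gamma> j s\<bar> \<le> 1))"

lemma first_order_step:
  assumes M: "exp_moments M" and F: "B-lipschitz_on UNIV F" and A: "noise_map L A"
    and J: "finite J" and fo: "first_order J D K F \<Gamma>"
  shows "first_order J D (K + \<bar>m\<bar> * B\<^sup>2 / 2) (energy_step M m A F) (\<lambda>j. mean_step M m A F (\<Gamma> j))"
proof -
  interpret prob_space M by (rule exp_moments_prob_space[OF M])
  have \<Gamma>: "continuous_on UNIV (\<Gamma> j)" "\<bar>\<Gamma> j s\<bar> \<le> 1" if "j \<in> J" for j s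
    using fo that by (auto simp: first_order_def)
  have main: "\<bar>energy_step M m A F (s + w) - energy_step M m A F s - (\<Sum>j\<in>J. mean_step M m A F (\<Gamma> j) s * D j w)\<bar>
      \<le> (K + \<bar>m\<bar> * B\<^sup>2 / 2) * norm w ^ 2" for s w
  proof -
    define f where "f u = F (s + A u)" for u
    define f' where "f' u = F (s + w + A u)" for u
    have f: "exp_integrable M f" unfolding f_def by (rule step_exp_integrable[OF M F A])
    have f': "f' \<in> borel_measurable M" unfolding f'_def
      by (rule step_measurable[OF M lipschitz_on_continuous_on[OF F] A])
    have eq: "s + w + A u = (s + A u) + w" for u by simp
    have d: "\<bar>f' u - f u\<bar> \<le> B * norm w" for u
      unfolding f_def f'_def eq by (rule lipschitz_add[OF F])
    have 1: "\<bar>free_energy M m f' - free_energy M m f - tilted_mean M m f (\<lambda>u. f' u - f u)\<bar>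
        \<le> \<bar>m\<bar> * (B * norm w)\<^sup>2 / 2"
      by (rule free_energy_diff[OF f f' d])
    have mt: "(\<lambda>u. \<Gamma> j (s + A u) * D j w) \<in> borel_measurable M"
      and bt: "\<bar>\<Gamma> j (s + A u) * D j w\<bar> \<le> \<bar>D j w\<bar>" if "j \<in> J" for j u
      using step_measurable[OF M \<Gamma>(1)[OF that] A] mult_right_mono[OF \<Gamma>(2)[OF that], of "\<bar>D j w\<bar>"]
      by (auto simp: abs_mult)
    have 2: "\<bar>tilted_mean M m f (\<lambda>u. f' u - f u) - tilted_mean M m f (\<lambda>u. \<Sum>j\<in>J. \<Gamma> j (s + A u) * D j w)\<bar>
        \<le> K * norm w ^ 2"
    proof (rule tilted_mean_close[OF f _ d])
      show "(\<lambda>u. \<Sum>j\<in>J. \<Gamma> j (s + A u) * D j w) \<in> borel_measurable M"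
        by (intro borel_measurable_sum mt)
      show "\<bar>\<Sum>j\<in>J. \<Gamma> j (s + A u) * D j w\<bar> \<le> (\<Sum>j\<in>J. \<bar>D j w\<bar>)" for u
        by (rule order_trans[OF sum_abs]) (intro sum_mono bt)
      show "\<bar>f' u - f u - (\<Sum>j\<in>J. \<Gamma> j (s + A u) * D j w)\<bar> \<le> K * norm w ^ 2" for u
        unfolding f_def f'_def eq using fo unfolding first_order_def by blast
    qed (use f f' in \<open>auto simp: exp_integrable_def\<close>)
    have 3: "tilted_mean M m f (\<lambda>u. \<Sum>j\<in>J. \<Gamma> j (s + A u) * D j w) = (\<Sum>j\<in>J. mean_step M m A F (\<Gamma> j) s * D j w)"
      by (subst tilted_mean_sum[OF f J mt bt])
         (simp_all add: tilted_mean_cmult mean_step_def f_def[abs_def])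
    have "(K + \<bar>m\<bar> * B\<^sup>2 / 2) * norm w ^ 2 = K * norm w ^ 2 + \<bar>m\<bar> * (B * norm w)\<^sup>2 / 2"
      by (simp add: power_mult_distrib algebra_simps)
    then show ?thesis
      using 1 2 unfolding 3 energy_step_def f_def[symmetric] f'_def[symmetric] by linarith
  qed
  show ?thesis
    unfolding first_order_def
    using main mean_step_continuous[OF M F A \<Gamma>] mean_step_bound[OF M F A \<Gamma>] by blast
qed

lemma energy_step_comp:
  fixes A1 A2 A3 :: "'b::euclidean_space \<Rightarrow> 's::euclidean_space"
  assumes M: "exp_moments M" and F: "B-lipschitz_on UNIV F"
    and A: "noise_map L A1" "noise_map L A2" "noise_map L A3"
    and conv: "distr (M \<Otimes>\<^sub>M M) borel (\<lambda>(u, u'). A1 u + A2 u') = distr M borel A3"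
  shows "energy_step M m A2 (energy_step M m A1 F) = energy_step M m A3 F"
    and "energy_step M m A1 (energy_step M m A2 F) = energy_step M m A3 F"
proof -
  interpret prob_space M by (rule exp_moments_prob_space[OF M])
  interpret P: pair_prob_space M M ..
  note sets_M[measurable_cong] = exp_moments_sets[OF M]
  have [measurable]: "A1 \<in> borel_measurable M" "A2 \<in> borel_measurable M" "A3 \<in> borel_measurable M"
    using A by (auto intro!: exp_moments_continuous[OF M] noise_mapD)
  note nA3 = A(3)
  have cF: "continuous_on UNIV F" by (rule lipschitz_on_continuous_on[OF F])
  have [measurable]: "F \<in> borel_measurable borel" by (rule borel_measurable_continuous_onI[OF cF])
  have int: "(\<integral>u'. \<integral>u. G (A1 u + A2 u') \<partial>M \<partial>M) = (\<integral>u. G (A3 u) \<partial>M)"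
    "(\<integral>u. \<integral>u'. G (A1 u + A2 u') \<partial>M \<partial>M) = (\<integral>u. G (A3 u) \<partial>M)"
    if [measurable]: "G \<in> borel_measurable borel" and G: "integrable M (\<lambda>u. G (A3 u))" for G :: "'s \<Rightarrow> real"
  proof -
    have "integrable (distr M borel A3) G" using G by (subst integrable_distr_eq) auto
    then have i: "integrable (M \<Otimes>\<^sub>M M) (\<lambda>(u, u'). G (A1 u + A2 u'))"
      unfolding conv[symmetric] by (subst (asm) integrable_distr_eq) (auto simp: case_prod_unfold)
    have e: "(\<integral>(u, u'). G (A1 u + A2 u') \<partial>(M \<Otimes>\<^sub>M M)) = (\<integral>u. G (A3 u) \<partial>M)"
    proof -
      have "(\<integral>(u, u'). G (A1 u + A2 u') \<partial>(M \<Otimes>\<^sub>M M)) = (\<integral>w. G w \<partial>distr (M \<Otimes>\<^sub>M M) borel (\<lambda>(u, u'). A1 u + A2 u'))"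
        by (subst integral_distr) (auto simp: case_prod_unfold)
      also have "\<dots> = (\<integral>u. G (A3 u) \<partial>M)" unfolding conv by (subst integral_distr) auto
      finally show ?thesis .
    qed
    show "(\<integral>u'. \<integral>u. G (A1 u + A2 u') \<partial>M \<partial>M) = (\<integral>u. G (A3 u) \<partial>M)"
      using P.integral_snd[OF i] e by simp
    show "(\<integral>u. \<integral>u'. G (A1 u + A2 u') \<partial>M \<partial>M) = (\<integral>u. G (A3 u) \<partial>M)"
      using P.integral_fst[OF i] e by simp
  qed
  have exp_fe: "exp (m * free_energy M m f) = (\<integral>u. exp (m * f u) \<partial>M)" if "exp_integrable M f" "m \<noteq> 0" for f m
    using that integral_exp_pos[OF that(1), of m] by (simp add: free_energy_def)
  have e: "exp_integrable M (\<lambda>u. F (s + A u))" if "noise_map L A" for A s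
    by (rule step_exp_integrable[OF M F that])
  have comp: "energy_step M m A (energy_step M m A' F) = energy_step M m A3 F"
    if A: "noise_map L A'" and int: "\<And>G :: 's \<Rightarrow> real. \<lbrakk>G \<in> borel_measurable borel; integrable M (\<lambda>u. G (A3 u))\<rbrakk> \<Longrightarrow>
      (\<integral>u. \<integral>u'. G (A u + A' u') \<partial>M \<partial>M) = (\<integral>u. G (A3 u) \<partial>M)" for A A'
  proof
    fix s
    show "energy_step M m A (energy_step M m A' F) s = energy_step M m A3 F s"
    proof (cases "m = 0")
      case True
      then show ?thesis
        using int[of "\<lambda>w. F (s + w)"] exp_integrable_integrable[OF e[OF nA3, of s]]
        by (simp add: energy_step_def free_energy_def add.assoc)
    next
      case False
      then show ?thesis
        using int[of "\<lambda>w. exp (m * F (s + w))"] exp_integrableD(2)[OF e[OF nA3, of s], of m]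
        unfolding energy_step_def free_energy_def[of M m "\<lambda>u. free_energy M m (\<lambda>u'. F (s + A u + A' u'))"]
          exp_fe[OF e[OF A] False] free_energy_def[of M m "\<lambda>u. F (s + A3 u)"]
        by (simp add: add.assoc)
    qed
  qed
  show "energy_step M m A2 (energy_step M m A1 F) = energy_step M m A3 F"
    by (rule comp[OF A(1)]) (simp add: int(1) add.commute[of "A2 _"])
  show "energy_step M m A1 (energy_step M m A2 F) = energy_step M m A3 F"
    by (rule comp[OF A(2) int(2)])
qed

definition noise_cov :: "'b measure \<Rightarrow> ('j \<Rightarrow> 's \<Rightarrow> real) \<Rightarrow> ('b \<Rightarrow> 's) \<Rightarrow> 'j \<Rightarrow> 'j \<Rightarrow> real" where
  "noise_cov M D A i j = (\<integral>u. D i (A u) * D j (A u) \<partial>M)"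

definition quad_form :: "'j set \<Rightarrow> ('j \<Rightarrow> 'j \<Rightarrow> real) \<Rightarrow> ('j \<Rightarrow> 's \<Rightarrow> real) \<Rightarrow> 's \<Rightarrow> real" where
  "quad_form J c \<Gamma> s = (\<Sum>i\<in>J. \<Sum>j\<in>J. \<Gamma> i s * \<Gamma> j s * c i j)"

lemma noise_map_scaleR:
  assumes "noise_map L A" "0 \<le> h" "h \<le> 1"
  shows "noise_map L (\<lambda>u. sqrt h *\<^sub>R A u)"
proof -
  have "sqrt h * norm (A u) \<le> L * norm u" for u
    using mult_right_mono[of "sqrt h" 1 "norm (A u)"] assms noise_mapD(3)[OF assms(1), of u] by simp
  then show ?thesis
    using assms by (auto simp: noise_map_def intro!: continuous_intros)
qed

lemma energy_step_small:
  fixes A :: "'b::euclidean_space \<Rightarrow> 's::euclidean_space" and D :: "'j \<Rightarrow> 's \<Rightarrow> real"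
  assumes M: "exp_moments M" and B: "0 \<le> B" and K: "0 \<le> K" and J: "finite J"
    and D: "\<And>j. j \<in> J \<Longrightarrow> bounded_linear (D j)"
    and A: "noise_map L A" and A0: "\<And>j. j \<in> J \<Longrightarrow> (\<integral>u. D j (A u) \<partial>M) = 0"
  obtains C \<delta> :: real where "0 \<le> C" "0 < \<delta>" "\<delta> \<le> 1"
    "\<And>F \<Gamma> h s. \<lbrakk>B-lipschitz_on UNIV F; first_order J D K F \<Gamma>; 0 \<le> h; h \<le> \<delta>\<rbrakk> \<Longrightarrow>
      \<bar>energy_step M m (\<lambda>u. sqrt h *\<^sub>R A u) F s - (\<integral>u. F (s + sqrt h *\<^sub>R A u) \<partial>M)
         - m / 2 * h * quad_form J (noise_cov M D A) \<Gamma> s\<bar> \<le> C * (h * sqrt h)"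
proof (cases "m = 0")
  case True
  show thesis
    by (rule that[of 0 1]) (simp_all add: True energy_step_def free_energy_def)
next
  case False
  interpret prob_space M by (rule exp_moments_prob_space[OF M])
  define d where "d = (\<Sum>j\<in>J. onorm (D j))"
  have onn: "0 \<le> onorm (D j)" if "j \<in> J" for j by (rule onorm_pos_le[OF D[OF that]])
  have d: "0 \<le> d" unfolding d_def by (intro sum_nonneg onn)
  have L: "0 \<le> L" by (rule noise_mapD(1)[OF A])
  define a where "a = \<bar>m\<bar> * (B * L + d * L)"
  define b where "b = \<bar>m\<bar> * (K * L\<^sup>2)"
  have a: "0 \<le> a" and b: "0 \<le> b" using B L d K by (simp_all add: a_def b_def)
  obtain C \<delta> where C: "0 \<le> C" "0 < \<delta>" "\<delta> \<le> 1" and est: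
    "\<And>X Y h. \<lbrakk>0 \<le> h; h \<le> \<delta>; X \<in> borel_measurable M; Y \<in> borel_measurable M;
      \<And>u. \<bar>X u\<bar> \<le> a * sqrt h * norm u; \<And>u. \<bar>Y u\<bar> \<le> a * norm u;
      \<And>u. \<bar>X u - sqrt h * Y u\<bar> \<le> b * h * norm u ^ 2; (\<integral>u. Y u \<partial>M) = 0\<rbrakk> \<Longrightarrow>
      \<bar>ln (\<integral>u. exp (X u) \<partial>M) - (\<integral>u. X u \<partial>M) - h / 2 * (\<integral>u. Y u ^ 2 \<partial>M)\<bar> \<le> C * (h * sqrt h)"
    using ln_integral_exp_small[OF M a b] by blast
  have Db: "\<bar>D j (A u)\<bar> \<le> onorm (D j) * L * norm u" if "j \<in> J" for j u
  proof -
    have "\<bar>D j (A u)\<bar> \<le> onorm (D j) * norm (A u)" using onorm[OF D[OF that], of "A u"] by simp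
    also have "\<dots> \<le> onorm (D j) * (L * norm u)"
      by (intro mult_left_mono noise_mapD(3)[OF A] onn[OF that])
    finally show ?thesis by (simp add: mult.assoc)
  qed
  have Dm[measurable]: "(\<lambda>u. D j (A u)) \<in> borel_measurable M" if "j \<in> J" for j
    by (intro exp_moments_continuous[OF M] continuous_on_compose2[OF linear_continuous_on[OF D[OF that]]]
        noise_mapD(2)[OF A]) auto
  have Di: "integrable M (\<lambda>u. D j (A u))" if "j \<in> J" for j
    by (rule exp_moments_integrable_growth[OF M Dm[OF that], where k = 1]) (use Db[OF that] in simp)
  have DDi: "integrable M (\<lambda>u. D i (A u) * D j (A u))" if "i \<in> J" "j \<in> J" for i j
  proof (rule exp_moments_integrable_growth[OF M, where k = 2])
    show "\<bar>D i (A u) * D j (A u)\<bar> \<le> (onorm (D i) * L * (onorm (D j) * L)) * norm u ^ 2" for u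
      using mult_mono[OF Db[OF that(1), of u] Db[OF that(2), of u]] onn[OF that(1)] L
      by (simp add: abs_mult power2_eq_square mult_ac)
  qed (use that in measurable)
  show thesis
  proof (rule that[of "C / \<bar>m\<bar>" \<delta>])
    show "0 \<le> C / \<bar>m\<bar>" "0 < \<delta>" "\<delta> \<le> 1" using C by simp_all
    fix F \<Gamma> h s
    assume F: "B-lipschitz_on UNIV F" and fo: "first_order J D K F \<Gamma>" and h: "0 \<le> h" "h \<le> \<delta>"
    have div: "x \<le> C / \<bar>m\<bar> * k" if "\<bar>m\<bar> * x \<le> C * k" for x k
      using False that by (simp add: field_simps)
    have h1: "h \<le> 1" using h C by linarith
    have \<Gamma>: "\<bar>\<Gamma> j s\<bar> \<le> 1" if "j \<in> J" for j using fo that by (auto simp: first_order_def)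
    have nA: "noise_map L (\<lambda>u. sqrt h *\<^sub>R A u)" by (rule noise_map_scaleR[OF A h(1) h1])
    define X where "X u = m * (F (s + sqrt h *\<^sub>R A u) - F s)" for u
    define Y where "Y u = m * (\<Sum>j\<in>J. \<Gamma> j s * D j (A u))" for u
    have ef: "exp_integrable M (\<lambda>u. F (s + sqrt h *\<^sub>R A u))" by (rule step_exp_integrable[OF M F nA])
    have mF: "(\<lambda>u. F (s + sqrt h *\<^sub>R A u)) \<in> borel_measurable M" by (rule exp_integrableD(1)[OF ef])
    have EY: "(\<integral>u. Y u \<partial>M) = 0"
      unfolding Y_def using Di by (simp add: integral_sum A0)
    have EY2: "(\<integral>u. Y u ^ 2 \<partial>M) = m\<^sup>2 * quad_form J (noise_cov M D A) \<Gamma> s"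
    proof -
      have "Y u ^ 2 = m\<^sup>2 * (\<Sum>i\<in>J. \<Sum>j\<in>J. \<Gamma> i s * \<Gamma> j s * (D i (A u) * D j (A u)))" for u
        by (simp add: Y_def power_mult_distrib power2_eq_square sum_product mult_ac)
      then show ?thesis
        using DDi by (simp add: quad_form_def noise_cov_def integral_sum)
    qed
    have bX: "\<bar>X u\<bar> \<le> a * sqrt h * norm u" for u
    proof -
      have "\<bar>F (s + sqrt h *\<^sub>R A u) - F s\<bar> \<le> B * (sqrt h * norm (A u))"
        using lipschitz_add[OF F, of s "sqrt h *\<^sub>R A u"] h by simp
      also have "\<dots> \<le> B * (sqrt h * (L * norm u))"
        using B h by (intro mult_left_mono noise_mapD(3)[OF A]) auto
      also have "\<dots> = (B * L) * (sqrt h * norm u)" by simp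
      also have "\<dots> \<le> (B * L + d * L) * (sqrt h * norm u)"
        using d L h by (intro mult_right_mono) auto
      finally have "\<bar>m\<bar> * \<bar>F (s + sqrt h *\<^sub>R A u) - F s\<bar> \<le> \<bar>m\<bar> * ((B * L + d * L) * (sqrt h * norm u))"
        by (intro mult_left_mono) auto
      then show ?thesis by (simp add: X_def a_def abs_mult mult.assoc)
    qed
    have bY: "\<bar>Y u\<bar> \<le> a * norm u" for u
    proof -
      have "\<bar>\<Sum>j\<in>J. \<Gamma> j s * D j (A u)\<bar> \<le> (\<Sum>j\<in>J. onorm (D j) * L * norm u)"
      proof (rule order_trans[OF sum_abs], rule sum_mono)
        fix j assume j: "j \<in> J"
        have "\<bar>\<Gamma> j s * D j (A u)\<bar> \<le> 1 * (onorm (D j) * L * norm u)"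
          unfolding abs_mult by (intro mult_mono \<Gamma> Db j) auto
        then show "\<bar>\<Gamma> j s * D j (A u)\<bar> \<le> onorm (D j) * L * norm u" by simp
      qed
      also have "\<dots> = d * L * norm u" by (simp add: d_def sum_distrib_right)
      also have "\<dots> \<le> (B * L + d * L) * norm u" using B L by (intro mult_right_mono) auto
      finally have "\<bar>m\<bar> * \<bar>\<Sum>j\<in>J. \<Gamma> j s * D j (A u)\<bar> \<le> \<bar>m\<bar> * ((B * L + d * L) * norm u)"
        by (intro mult_left_mono) auto
      then show ?thesis by (simp add: Y_def a_def abs_mult mult.assoc)
    qed
    have bXY: "\<bar>X u - sqrt h * Y u\<bar> \<le> b * h * norm u ^ 2" for u
    proof -
      have lin: "(\<Sum>j\<in>J. \<Gamma> j s * D j (sqrt h *\<^sub>R A u)) = sqrt h * (\<Sum>j\<in>J. \<Gamma> j s * D j (A u))"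
        unfolding sum_distrib_left
        by (intro sum.cong refl) (simp add: bounded_linear.linear[OF D] linear_cmul)
      have "\<bar>F (s + sqrt h *\<^sub>R A u) - F s - (\<Sum>j\<in>J. \<Gamma> j s * D j (sqrt h *\<^sub>R A u))\<bar>
          \<le> K * norm (sqrt h *\<^sub>R A u) ^ 2"
        using fo unfolding first_order_def by blast
      also have "\<dots> = K * h * norm (A u) ^ 2" using h by (simp add: power_mult_distrib)
      also have "\<dots> \<le> K * h * (L * norm u) ^ 2"
        using K h by (intro mult_left_mono power_mono noise_mapD(3)[OF A]) auto
      finally have "\<bar>m\<bar> * \<bar>F (s + sqrt h *\<^sub>R A u) - F s - sqrt h * (\<Sum>j\<in>J. \<Gamma> j s * D j (A u))\<bar>
          \<le> \<bar>m\<bar> * (K * h * (L * norm u) ^ 2)"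
        unfolding lin by (intro mult_left_mono) auto
      moreover have "X u - sqrt h * Y u = m * (F (s + sqrt h *\<^sub>R A u) - F s - sqrt h * (\<Sum>j\<in>J. \<Gamma> j s * D j (A u)))"
        by (simp add: X_def Y_def algebra_simps)
      ultimately show ?thesis by (simp add: b_def abs_mult power_mult_distrib mult_ac)
    qed
    have "\<bar>ln (\<integral>u. exp (X u) \<partial>M) - (\<integral>u. X u \<partial>M) - h / 2 * (\<integral>u. Y u ^ 2 \<partial>M)\<bar> \<le> C * (h * sqrt h)"
    proof (rule est[OF h _ _ bX bY bXY EY])
      show "X \<in> borel_measurable M" unfolding X_def[abs_def] using mF by simp
      show "Y \<in> borel_measurable M" unfolding Y_def[abs_def] by (intro borel_measurable_times borel_measurable_sum Dm) auto
    qed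
    moreover have "ln (\<integral>u. exp (X u) \<partial>M) = m * (energy_step M m (\<lambda>u. sqrt h *\<^sub>R A u) F s - F s)"
    proof -
      have "(\<integral>u. exp (X u) \<partial>M) = exp (- m * F s) * (\<integral>u. exp (m * F (s + sqrt h *\<^sub>R A u)) \<partial>M)"
        by (simp add: X_def right_diff_distrib exp_diff exp_minus field_simps)
      then show ?thesis
        using False integral_exp_pos[OF ef, of m]
        by (simp add: ln_mult energy_step_def free_energy_def field_simps)
    qed
    moreover have "(\<integral>u. X u \<partial>M) = m * ((\<integral>u. F (s + sqrt h *\<^sub>R A u) \<partial>M) - F s)"
      unfolding X_def using exp_integrable_integrable[OF ef] by (simp add: prob_space)
    ultimately have "\<bar>m * (energy_step M m (\<lambda>u. sqrt h *\<^sub>R A u) F s - (\<integral>u. F (s + sqrt h *\<^sub>R A u) \<partial>M)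
         - m / 2 * h * quad_form J (noise_cov M D A) \<Gamma> s)\<bar> \<le> C * (h * sqrt h)"
      unfolding EY2 by (simp add: algebra_simps power2_eq_square)
    then show "\<bar>energy_step M m (\<lambda>u. sqrt h *\<^sub>R A u) F s - (\<integral>u. F (s + sqrt h *\<^sub>R A u) \<partial>M)
         - m / 2 * h * quad_form J (noise_cov M D A) \<Gamma> s\<bar> \<le> C / \<bar>m\<bar> * (h * sqrt h)"
      unfolding abs_mult[of m] by (rule div)
  qed
qed

lemma lip_family_compose:
  assumes "lip_family T B F" "continuous_on T' f" "f ` T' \<subseteq> T"
  shows "lip_family T' B (\<lambda>v. F (f v))"
proof -
  have f: "continuous_on (T' \<times> UNIV) (\<lambda>p. (f (fst p), snd p))"
    by (intro continuous_on_Pair continuous_on_compose2[OF assms(2)] continuous_on_fst continuous_on_snd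
        continuous_on_id) auto
  have "continuous_on (T' \<times> UNIV) (\<lambda>p. (\<lambda>(v, s). F v s) (f (fst p), snd p))"
    by (rule continuous_on_compose2[OF _ f, where t = "T \<times> UNIV"])
       (use assms in \<open>auto simp: lip_family_def\<close>)
  then show ?thesis using assms by (auto simp: lip_family_def case_prod_unfold)
qed

lemma bdd_family_compose:
  assumes "bdd_family T R g" "continuous_on T' f" "f ` T' \<subseteq> T"
  shows "bdd_family T' R (\<lambda>v. g (f v))"
proof -
  have f: "continuous_on (T' \<times> UNIV) (\<lambda>p. (f (fst p), snd p))"
    by (intro continuous_on_Pair continuous_on_compose2[OF assms(2)] continuous_on_fst continuous_on_snd
        continuous_on_id) auto
  have "continuous_on (T' \<times> UNIV) (\<lambda>p. (\<lambda>(v, s). g v s) (f (fst p), snd p))"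
    by (rule continuous_on_compose2[OF _ f, where t = "T \<times> UNIV"])
       (use assms in \<open>auto simp: bdd_family_def\<close>)
  then show ?thesis using assms by (auto simp: bdd_family_def case_prod_unfold)
qed

lemma noise_family_compose:
  assumes "noise_family T L A" "continuous_on T' f" "f ` T' \<subseteq> T"
  shows "noise_family T' L (\<lambda>v. A (f v))"
proof -
  have "continuous_on T' (\<lambda>v. A (f v) u)" for u
    by (rule continuous_on_compose2[OF _ assms(2,3)]) (use assms(1) in \<open>auto simp: noise_family_def\<close>)
  then show ?thesis using assms by (auto simp: noise_family_def)
qed

lemma bdd_family_quad_form:
  assumes "\<And>j. j \<in> J \<Longrightarrow> bdd_family T 1 (\<lambda>v. \<Gamma> v j)"
  shows "bdd_family T (\<Sum>i\<in>J. \<Sum>j\<in>J. \<bar>c i j\<bar>) (\<lambda>v. quad_form J c (\<Gamma> v))"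
  unfolding bdd_family_def
proof (intro conjI ballI allI)
  show "continuous_on (T \<times> UNIV) (\<lambda>(v, s). quad_form J c (\<Gamma> v) s)"
    using assms unfolding quad_form_def case_prod_unfold bdd_family_def
    by (intro continuous_intros) auto
  fix v s assume v: "v \<in> T"
  have \<Gamma>: "\<bar>\<Gamma> v j s\<bar> \<le> 1" if "j \<in> J" for j using assms[OF that] v by (auto simp: bdd_family_def)
  have "\<bar>quad_form J c (\<Gamma> v) s\<bar> \<le> (\<Sum>i\<in>J. \<bar>\<Sum>j\<in>J. \<Gamma> v i s * \<Gamma> v j s * c i j\<bar>)"
    unfolding quad_form_def by (rule sum_abs)
  also have "\<dots> \<le> (\<Sum>i\<in>J. \<Sum>j\<in>J. \<bar>\<Gamma> v i s * \<Gamma> v j s * c i j\<bar>)"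
    by (intro sum_mono sum_abs)
  also have "\<dots> \<le> (\<Sum>i\<in>J. \<Sum>j\<in>J. \<bar>c i j\<bar>)"
  proof (intro sum_mono)
    fix i j assume "i \<in> J" "j \<in> J"
    then have "\<bar>\<Gamma> v i s\<bar> * \<bar>\<Gamma> v j s\<bar> * \<bar>c i j\<bar> \<le> 1 * 1 * \<bar>c i j\<bar>"
      by (intro mult_mono \<Gamma>) auto
    then show "\<bar>\<Gamma> v i s * \<Gamma> v j s * c i j\<bar> \<le> \<bar>c i j\<bar>" by (simp add: abs_mult)
  qed
  finally show "\<bar>quad_form J c (\<Gamma> v) s\<bar> \<le> (\<Sum>i\<in>J. \<Sum>j\<in>J. \<bar>c i j\<bar>)" .
qed

text \<open>The derivative of \<open>F\<close> in the parameter is \<open>Q v v\<close>; keeping both end points of the increment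
  apart is what lets the expansion pass through the remaining levels.\<close>

definition increment_expansion ::
    "real set \<Rightarrow> (real \<Rightarrow> 's \<Rightarrow> real) \<Rightarrow> (real \<Rightarrow> real \<Rightarrow> 's \<Rightarrow> real) \<Rightarrow> bool" where
  "increment_expansion I F Q \<longleftrightarrow> (\<exists>C\<ge>0. \<exists>\<delta>>0. \<forall>a\<in>I. \<forall>b\<in>I. a \<le> b \<longrightarrow> b - a \<le> \<delta> \<longrightarrow>
     (\<forall>s. \<bar>F b s - F a s - (b - a) * Q a b s\<bar> \<le> C * ((b - a) * sqrt (b - a))))"

lemma energy_step_increment:
  assumes M: "exp_moments M" and F: "B-lipschitz_on UNIV F" "B'-lipschitz_on UNIV F'" and A: "noise_map L A"
    and Q: "continuous_on UNIV Q" "\<And>s. \<bar>Q s\<bar> \<le> R" and C: "0 \<le> C" and h: "0 \<le> h" "h \<le> 1"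
    and est: "\<And>s. \<bar>F' s - F s - h * Q s\<bar> \<le> C * (h * sqrt h)"
  shows "\<bar>energy_step M m A F' s - energy_step M m A F s - h * mean_step M m A F Q s\<bar>
      \<le> (C + \<bar>m\<bar> * (\<bar>R\<bar> + C)\<^sup>2 / 2) * (h * sqrt h)"
proof -
  interpret prob_space M by (rule exp_moments_prob_space[OF M])
  have sq: "0 \<le> sqrt h" "sqrt h \<le> 1" "sqrt h * sqrt h = h" using h by auto
  have hh: "h * sqrt h \<le> h * 1" using h sq by (intro mult_left_mono) auto
  have hh2: "h * h \<le> h * sqrt h"
    using mult_left_mono[OF mult_left_mono[OF sq(2) sq(1)] h(1)] sq by simp
  define f where "f u = F (s + A u)" for u
  define f' where "f' u = F' (s + A u)" for u
  define q where "q u = Q (s + A u)" for u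
  have q: "q \<in> borel_measurable M" "\<bar>q u\<bar> \<le> R" for u
    unfolding q_def[abs_def] using step_measurable[OF M Q(1) A] Q(2) by auto
  have f: "exp_integrable M f" unfolding f_def[abs_def] by (rule step_exp_integrable[OF M F(1) A])
  have f': "exp_integrable M f'" unfolding f'_def[abs_def] by (rule step_exp_integrable[OF M F(2) A])
  have e: "\<bar>f' u - f u - h * q u\<bar> \<le> C * (h * sqrt h)" for u
    unfolding f'_def f_def q_def by (rule est)
  have hq: "\<bar>h * q u\<bar> \<le> h * \<bar>R\<bar>" for u
    unfolding abs_mult using h q(2)[of u] by (intro mult_mono) auto
  have d: "\<bar>f' u - f u\<bar> \<le> (\<bar>R\<bar> + C) * h" for u
  proof -
    have "C * (h * sqrt h) \<le> C * h" using mult_left_mono[OF hh C] by simp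
    with e[of u] hq[of u] have "\<bar>f' u - f u\<bar> \<le> C * h + h * \<bar>R\<bar>" by linarith
    then show ?thesis by (simp add: algebra_simps)
  qed
  have 1: "\<bar>free_energy M m f' - free_energy M m f - tilted_mean M m f (\<lambda>u. f' u - f u)\<bar>
      \<le> \<bar>m\<bar> * ((\<bar>R\<bar> + C) * h)\<^sup>2 / 2"
    by (rule free_energy_diff[OF f exp_integrableD(1)[OF f'] d])
  have 2: "\<bar>tilted_mean M m f (\<lambda>u. f' u - f u) - tilted_mean M m f (\<lambda>u. h * q u)\<bar> \<le> C * (h * sqrt h)"
    by (rule tilted_mean_close[OF f _ d _ hq e])
       (use q(1) exp_integrableD(1)[OF f] exp_integrableD(1)[OF f'] in auto)
  have 3: "\<bar>m\<bar> * ((\<bar>R\<bar> + C) * h)\<^sup>2 / 2 \<le> \<bar>m\<bar> * (\<bar>R\<bar> + C)\<^sup>2 / 2 * (h * sqrt h)"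
    using mult_left_mono[OF hh2, of "\<bar>m\<bar> * (\<bar>R\<bar> + C)\<^sup>2 / 2"]
    by (simp add: power_mult_distrib power2_eq_square mult_ac)
  have "\<bar>free_energy M m f' - free_energy M m f - h * tilted_mean M m f q\<bar>
      \<le> C * (h * sqrt h) + \<bar>m\<bar> * (\<bar>R\<bar> + C)\<^sup>2 / 2 * (h * sqrt h)"
    using 1 2 3 unfolding tilted_mean_cmult by linarith
  then show ?thesis
    by (simp only: distrib_right energy_step_def mean_step_def f_def[abs_def] f'_def[abs_def] q_def[abs_def])
qed

lemma increment_expansion_step:
  assumes M: "exp_moments M" and F: "\<And>v. v \<in> I \<Longrightarrow> B-lipschitz_on UNIV (F v)" and A: "noise_map L A"
    and Q: "bdd_family (I \<times> I) R (\<lambda>(a, b). Q a b)" and inc: "increment_expansion I F Q"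
  shows "increment_expansion I (\<lambda>v. energy_step M m A (F v)) (\<lambda>a b. mean_step M m A (F a) (Q a b))"
proof -
  obtain C \<delta> where C: "0 \<le> C" "0 < \<delta>" and est: "\<And>a b s. \<lbrakk>a \<in> I; b \<in> I; a \<le> b; b - a \<le> \<delta>\<rbrakk> \<Longrightarrow>
      \<bar>F b s - F a s - (b - a) * Q a b s\<bar> \<le> C * ((b - a) * sqrt (b - a))"
    using inc unfolding increment_expansion_def by blast
  define C' where "C' = C + \<bar>m\<bar> * (\<bar>R\<bar> + C)\<^sup>2 / 2"
  have "\<bar>energy_step M m A (F b) s - energy_step M m A (F a) s - (b - a) * mean_step M m A (F a) (Q a b) s\<bar>
      \<le> C' * ((b - a) * sqrt (b - a))"
    if ab: "a \<in> I" "b \<in> I" "a \<le> b" "b - a \<le> min \<delta> 1" for a b s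
    unfolding C'_def
  proof (rule energy_step_increment[OF M F[OF ab(1)] F[OF ab(2)] A])
    show "continuous_on UNIV (Q a b)"
      using family_continuous[of "I \<times> I" "\<lambda>(a, b). Q a b" "(a, b)"] Q ab by (auto simp: bdd_family_def)
    show "\<bar>Q a b s\<bar> \<le> R" for s using Q ab by (auto simp: bdd_family_def)
    show "\<bar>F b s - F a s - (b - a) * Q a b s\<bar> \<le> C * ((b - a) * sqrt (b - a))" for s
      using ab by (intro est) auto
  qed (use C ab in auto)
  moreover have "0 \<le> C'" "0 < min \<delta> 1" using C by (simp_all add: C'_def)
  ultimately show ?thesis unfolding increment_expansion_def by blast
qed

lemma increment_expansion_derivative:
  assumes inc: "increment_expansion I F Q" and Q: "bdd_family (I \<times> I) R (\<lambda>(a, b). Q a b)" and v: "v \<in> I"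
  shows "((\<lambda>v. F v s) has_real_derivative Q v v s) (at v within I)"
proof -
  obtain C \<delta> where C: "0 \<le> C" "0 < \<delta>" and est: "\<And>a b s. \<lbrakk>a \<in> I; b \<in> I; a \<le> b; b - a \<le> \<delta>\<rbrakk> \<Longrightarrow>
      \<bar>F b s - F a s - (b - a) * Q a b s\<bar> \<le> C * ((b - a) * sqrt (b - a))"
    using inc unfolding increment_expansion_def by blast
  define q where "q w = Q (min v w) (max v w) s" for w
  have f: "continuous_on I (\<lambda>w. ((min v w, max v w), s))"
    by (intro continuous_on_Pair continuous_on_min continuous_on_max continuous_on_const continuous_on_id)
  have "continuous_on I (\<lambda>w. (\<lambda>(p, s). (\<lambda>(a, b). Q a b) p s) ((min v w, max v w), s))"
    by (rule continuous_on_compose2[OF _ f, where t = "(I \<times> I) \<times> UNIV"])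
       (use Q v in \<open>auto simp: bdd_family_def min_def max_def\<close>)
  then have "continuous_on I q" by (simp add: q_def[abs_def])
  then have lq: "(q \<longlongrightarrow> q v) (at v within I)" using v by (simp add: continuous_on)
  have scale: "\<bar>x / h - y\<bar> \<le> k" if "0 < h" "\<bar>x - h * y\<bar> \<le> h * k" for x y h k :: real
  proof -
    have "x / h - y = (x - h * y) / h" using that(1) by (simp add: diff_divide_distrib)
    then show ?thesis using that by (simp add: pos_divide_le_eq mult.commute)
  qed
  have bnd: "\<bar>(F w s - F v s) / (w - v) - q w\<bar> \<le> C * sqrt \<bar>w - v\<bar>"
    if w: "w \<in> I" "w \<noteq> v" "\<bar>w - v\<bar> \<le> \<delta>" for w
  proof (cases "v < w")
    case True
    define h where "h = w - v"
    have h: "0 < h" using True by (simp add: h_def)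
    have "\<bar>F w s - F v s - h * q w\<bar> \<le> h * (C * sqrt h)"
      using est[OF v w(1), of s] w True by (simp add: q_def h_def mult_ac)
    then have "\<bar>(F w s - F v s) / h - q w\<bar> \<le> C * sqrt h" by (rule scale[OF h])
    then show ?thesis using h by (simp add: h_def)
  next
    case False
    define h where "h = v - w"
    have h: "0 < h" using False w by (simp add: h_def)
    have "\<bar>F v s - F w s - h * q w\<bar> \<le> h * (C * sqrt h)"
      using est[OF w(1) v, of s] w False by (simp add: q_def h_def mult_ac)
    then have "\<bar>(F v s - F w s) / h - q w\<bar> \<le> C * sqrt h" by (rule scale[OF h])
    moreover have "(F v s - F w s) / h = (F w s - F v s) / (w - v)"
      using h by (simp add: h_def field_simps)
    moreover have "\<bar>w - v\<bar> = h" using h by (simp add: h_def)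
    ultimately show ?thesis using h by simp
  qed
  have ls: "((\<lambda>w. C * sqrt \<bar>w - v\<bar>) \<longlongrightarrow> 0) (at v within I)"
    by (rule tendsto_eq_intros refl | simp)+
  have "((\<lambda>w. (F w s - F v s) / (w - v) - q w) \<longlongrightarrow> 0) (at v within I)"
  proof (rule Lim_null_comparison[OF _ ls])
    show "\<forall>\<^sub>F w in at v within I. norm ((F w s - F v s) / (w - v) - q w) \<le> C * sqrt \<bar>w - v\<bar>"
      unfolding eventually_at using C bnd by (intro exI[of _ \<delta>]) (auto simp: dist_real_def)
  qed
  from tendsto_add[OF this lq] show ?thesis
    by (simp add: has_field_derivative_iff q_def)
qed

section \<open>Exchanging variance between two adjacent levels\<close>

lemma bdd_family_cmult:
  assumes "bdd_family T R g"
  shows "bdd_family T (\<bar>c\<bar> * R) (\<lambda>v s. c * g v s)"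
  using assms unfolding bdd_family_def case_prod_unfold
  by (auto simp: abs_mult intro!: continuous_intros mult_left_mono)

lemma increment_expansion_two_levels:
  fixes \<tau> :: "'b::euclidean_space \<Rightarrow> 's::euclidean_space" and D :: "'j \<Rightarrow> 's \<Rightarrow> real" and m m' :: real
  assumes M: "exp_moments M" and J: "finite J" and D: "\<And>j. j \<in> J \<Longrightarrow> bounded_linear (D j)"
    and \<tau>: "noise_map L \<tau>" and \<tau>0: "\<And>j. j \<in> J \<Longrightarrow> (\<integral>u. D j (\<tau> u) \<partial>M) = 0"
    and F: "B-lipschitz_on UNIV F" and fo: "first_order J D K F \<Gamma>" and K: "0 \<le> K"
    and A: "noise_family I L A" and A': "noise_family I L A'"
    and conv: "\<And>a b. \<lbrakk>a \<in> I; b \<in> I; a \<le> b\<rbrakk> \<Longrightarrow>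
      distr (M \<Otimes>\<^sub>M M) borel (\<lambda>(u, u'). A b u + sqrt (b - a) *\<^sub>R \<tau> u') = distr M borel (A a)"
    and conv': "\<And>a b. \<lbrakk>a \<in> I; b \<in> I; a \<le> b\<rbrakk> \<Longrightarrow>
      distr (M \<Otimes>\<^sub>M M) borel (\<lambda>(u, u'). A' a u + sqrt (b - a) *\<^sub>R \<tau> u') = distr M borel (A' b)"
  defines "H \<equiv> \<lambda>v. energy_step M m (A v) F"
    and "V \<equiv> \<lambda>v s. (m' - m) / 2 * quad_form J (noise_cov M D \<tau>) (\<lambda>j. mean_step M m (A v) F (\<Gamma> j)) s"
  shows "increment_expansion I (\<lambda>v. energy_step M m' (A' v) (H v)) (\<lambda>a b. mean_step M m' (A' a) (H a) (V b))"
      (is ?inc)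
    and "\<exists>R. bdd_family (I \<times> I) R (\<lambda>(a, b). mean_step M m' (A' a) (H a) (V b))" (is ?bdd)
proof -
  have \<Gamma>: "continuous_on UNIV (\<Gamma> j)" "\<bar>\<Gamma> j s\<bar> \<le> 1" if "j \<in> J" for j s
    using fo that by (auto simp: first_order_def)
  have nA: "noise_map L (A v)" "noise_map L (A' v)" if "v \<in> I" for v
    using A A' that by (auto simp: noise_family_def)
  have const: "continuous_on (I \<times> UNIV) (\<lambda>(v, s). G s)" if "continuous_on UNIV G" for G :: "'s \<Rightarrow> real"
    unfolding case_prod_unfold by (rule continuous_on_compose2[OF that]) (auto intro!: continuous_intros)
  have lipF: "lip_family I B (\<lambda>v. F)"
    using F const lipschitz_on_continuous_on[OF F] by (auto simp: lip_family_def)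
  have bdd\<Gamma>: "bdd_family I 1 (\<lambda>v. \<Gamma> j)" if "j \<in> J" for j
    using \<Gamma>[OF that] const by (auto simp: bdd_family_def)
  have bddG: "bdd_family I 1 (\<lambda>v. mean_step M m (A v) F (\<Gamma> j))" if "j \<in> J" for j
    by (rule mean_step_family[OF M lipF A bdd\<Gamma>[OF that]])
  define R where "R = \<bar>(m' - m) / 2\<bar> * (\<Sum>i\<in>J. \<Sum>j\<in>J. \<bar>noise_cov M D \<tau> i j\<bar>)"
  have bddV: "bdd_family I R V"
    unfolding V_def R_def by (intro bdd_family_cmult bdd_family_quad_form bddG)
  have lipH: "lip_family I B H" unfolding H_def by (rule energy_step_family[OF M lipF A])
  have pr: "fst ` (I \<times> I) \<subseteq> I" "snd ` (I \<times> I) \<subseteq> I" by auto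
  have "bdd_family (I \<times> I) R (\<lambda>p. mean_step M m' (A' (fst p)) (H (fst p)) (V (snd p)))"
    by (rule mean_step_family[OF M lip_family_compose[OF lipH _ pr(1)] noise_family_compose[OF A' _ pr(1)]
        bdd_family_compose[OF bddV _ pr(2)]]) (intro continuous_intros)+
  then show ?bdd by (auto simp: case_prod_unfold)
  have B: "0 \<le> B" by (rule lipschitz_on_nonneg[OF F])
  define K' where "K' = K + \<bar>m\<bar> * B\<^sup>2 / 2"
  have K': "0 \<le> K'" using K by (simp add: K'_def)
  have H: "B-lipschitz_on UNIV (H v)" if "v \<in> I" for v using lipH that by (auto simp: lip_family_def)
  have foH: "first_order J D K' (H v) (\<lambda>j. mean_step M m (A v) F (\<Gamma> j))" if "v \<in> I" for v
    unfolding H_def K'_def by (rule first_order_step[OF M F nA(1)[OF that] J fo])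
  obtain C1 \<delta>1 where 1: "0 \<le> C1" "0 < \<delta>1" "\<delta>1 \<le> 1" and small1:
    "\<And>F \<Gamma> h s. \<lbrakk>B-lipschitz_on UNIV F; first_order J D K' F \<Gamma>; 0 \<le> h; h \<le> \<delta>1\<rbrakk> \<Longrightarrow>
      \<bar>energy_step M m (\<lambda>u. sqrt h *\<^sub>R \<tau> u) F s - (\<integral>u. F (s + sqrt h *\<^sub>R \<tau> u) \<partial>M)
         - m / 2 * h * quad_form J (noise_cov M D \<tau>) \<Gamma> s\<bar> \<le> C1 * (h * sqrt h)"
    using energy_step_small[where D = D and m = m, OF M B K' J D \<tau> \<tau>0] by blast
  obtain C2 \<delta>2 where 2: "0 \<le> C2" "0 < \<delta>2" "\<delta>2 \<le> 1" and small2: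
    "\<And>F \<Gamma> h s. \<lbrakk>B-lipschitz_on UNIV F; first_order J D K' F \<Gamma>; 0 \<le> h; h \<le> \<delta>2\<rbrakk> \<Longrightarrow>
      \<bar>energy_step M m' (\<lambda>u. sqrt h *\<^sub>R \<tau> u) F s - (\<integral>u. F (s + sqrt h *\<^sub>R \<tau> u) \<partial>M)
         - m' / 2 * h * quad_form J (noise_cov M D \<tau>) \<Gamma> s\<bar> \<le> C2 * (h * sqrt h)"
    using energy_step_small[where D = D and m = m', OF M B K' J D \<tau> \<tau>0] by blast
  define C where "C = C1 + C2"
  define C' where "C' = C + \<bar>m'\<bar> * (\<bar>R\<bar> + C)\<^sup>2 / 2"
  have C: "0 \<le> C" using 1 2 by (simp add: C_def)
  have "\<bar>energy_step M m' (A' b) (H b) s - energy_step M m' (A' a) (H a) s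
        - (b - a) * mean_step M m' (A' a) (H a) (V b) s\<bar> \<le> C' * ((b - a) * sqrt (b - a))"
    if ab: "a \<in> I" "b \<in> I" "a \<le> b" "b - a \<le> min \<delta>1 \<delta>2" for a b s
  proof -
    define h where "h = b - a"
    have h: "0 \<le> h" "h \<le> 1" "h \<le> \<delta>1" "h \<le> \<delta>2" using ab 1 by (auto simp: h_def)
    note ns = noise_map_scaleR[OF \<tau> h(1,2)]
    define G where "G = energy_step M m' (\<lambda>u. sqrt h *\<^sub>R \<tau> u) (H b)"
    have Ha: "H a = energy_step M m (\<lambda>u. sqrt h *\<^sub>R \<tau> u) (H b)"
      unfolding H_def h_def
      by (rule energy_step_comp(1)[OF M F nA(1)[OF ab(2)] ns[unfolded h_def] nA(1)[OF ab(1)] conv[OF ab(1-3)], symmetric])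
    have Hb: "energy_step M m' (A' b) (H b) = energy_step M m' (A' a) G"
      unfolding G_def h_def
      by (rule energy_step_comp(2)[OF M H[OF ab(2)] nA(2)[OF ab(1)] ns[unfolded h_def] nA(2)[OF ab(2)] conv'[OF ab(1-3)], symmetric])
    have G: "B-lipschitz_on UNIV G" unfolding G_def by (rule energy_step_lipschitz[OF M H[OF ab(2)] ns])
    have est: "\<bar>G s - H a s - h * V b s\<bar> \<le> C * (h * sqrt h)" for s
    proof -
      have *: "\<bar>g - k - h * ((m' - m) / 2 * q)\<bar> \<le> (C1 + C2) * z"
        if "\<bar>k - e - m / 2 * h * q\<bar> \<le> C1 * z" "\<bar>g - e - m' / 2 * h * q\<bar> \<le> C2 * z" for g k e q z
      proof -
        have "h * ((m' - m) / 2 * q) = m' / 2 * h * q - m / 2 * h * q" by (simp add: field_simps)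
        moreover have "(C1 + C2) * z = C1 * z + C2 * z" by (rule distrib_right)
        ultimately show ?thesis using that by linarith
      qed
      show ?thesis
        unfolding Ha G_def V_def C_def
        by (rule *[OF small1[OF H[OF ab(2)] foH[OF ab(2)] h(1) h(3)] small2[OF H[OF ab(2)] foH[OF ab(2)] h(1) h(4)]])
    qed
    show ?thesis
      unfolding Hb h_def[symmetric] C'_def
    proof (rule energy_step_increment[OF M H[OF ab(1)] G nA(2)[OF ab(1)] _ _ C h(1,2) est])
      show "continuous_on UNIV (V b)" using family_continuous[of I V b] bddV ab by (auto simp: bdd_family_def)
      show "\<bar>V b s\<bar> \<le> R" for s using bddV ab by (auto simp: bdd_family_def)
    qed
  qed
  moreover have "0 \<le> C'" "0 < min \<delta>1 \<delta>2" using C 1 2 by (simp_all add: C'_def)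
  ultimately show ?inc unfolding increment_expansion_def by blast
qed

lemma increment_expansion_cong:
  assumes "increment_expansion I F Q" "\<And>v. v \<in> I \<Longrightarrow> F v = F' v"
  shows "increment_expansion I F' Q"
  using assms(1) unfolding increment_expansion_def by (simp add: assms(2) cong: ball_cong)

primrec tower_energy ::
    "'b measure \<Rightarrow> (nat \<Rightarrow> real) \<Rightarrow> (nat \<Rightarrow> 'b \<Rightarrow> 's::euclidean_space) \<Rightarrow> ('s \<Rightarrow> real) \<Rightarrow> nat \<Rightarrow> 's \<Rightarrow> real" where
  "tower_energy M m A F 0 = F"
| "tower_energy M m A F (Suc n) = energy_step M (m (Suc n)) (A (Suc n)) (tower_energy M m A F n)"

primrec tower_mean ::
    "'b measure \<Rightarrow> (nat \<Rightarrow> real) \<Rightarrow> (nat \<Rightarrow> 'b \<Rightarrow> 's::euclidean_space) \<Rightarrow> ('s \<Rightarrow> real) \<Rightarrow> nat \<Rightarrow> ('s \<Rightarrow> real) \<Rightarrow>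
      nat \<Rightarrow> 's \<Rightarrow> real" where
  "tower_mean M m A F k g 0 = g"
| "tower_mean M m A F k g (Suc n) =
     mean_step M (m (Suc (k + n))) (A (Suc (k + n))) (tower_energy M m A F (k + n)) (tower_mean M m A F k g n)"

lemma tower_energy_cong:
  assumes "\<And>i. 1 \<le> i \<Longrightarrow> i \<le> n \<Longrightarrow> A i = A' i"
  shows "tower_energy M m A F n = tower_energy M m A' F n"
  using assms by (induction n) auto

lemma tower_mean_cong:
  assumes "\<And>i. 1 \<le> i \<Longrightarrow> i \<le> k + n \<Longrightarrow> A i = A' i"
  shows "tower_mean M m A F k g n = tower_mean M m A' F k g n"
  using assms
proof (induction n)
  case (Suc n)
  then show ?case using tower_energy_cong[of "k + n" A A'] by simp
qed simp

lemma tower_energy_lipschitz: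
  assumes M: "exp_moments M" and F: "B-lipschitz_on UNIV F" and A: "\<And>i. noise_map L (A i)"
  shows "B-lipschitz_on UNIV (tower_energy M m A F n)"
  by (induction n) (auto intro: F energy_step_lipschitz[OF M _ A])

lemma tower_energy_family:
  assumes M: "exp_moments M" and F: "B-lipschitz_on UNIV F" and A: "\<And>i. noise_family I L (A i)"
  shows "lip_family I B (\<lambda>v. tower_energy M m (\<lambda>i. A i v) F n)"
proof -
  have const: "continuous_on (I \<times> UNIV) (\<lambda>(v, s). F s)"
    unfolding case_prod_unfold
    by (rule continuous_on_compose2[OF lipschitz_on_continuous_on[OF F]]) (auto intro!: continuous_intros)
  then show ?thesis
    by (induction n) (use F in \<open>auto simp: lip_family_def[of _ _ "\<lambda>v. F"] intro: energy_step_family[OF M _ A]\<close>)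
qed

lemma tower_mean_bounded_continuous:
  assumes M: "exp_moments M" and F: "B-lipschitz_on UNIV F" and A: "\<And>i. noise_map L (A i)"
    and g: "continuous_on UNIV g" "\<And>s. \<bar>g s\<bar> \<le> R"
  shows "continuous_on UNIV (tower_mean M m A F k g n)" "\<bar>tower_mean M m A F k g n s\<bar> \<le> R"
proof -
  have "continuous_on UNIV (tower_mean M m A F k g n) \<and> (\<forall>s. \<bar>tower_mean M m A F k g n s\<bar> \<le> R)"
    by (induction n)
       (use g in \<open>auto intro!: mean_step_continuous[OF M tower_energy_lipschitz[OF M F A] A]
          mean_step_bound[OF M tower_energy_lipschitz[OF M F A] A]\<close>)
  then show "continuous_on UNIV (tower_mean M m A F k g n)" "\<bar>tower_mean M m A F k g n s\<bar> \<le> R" by auto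
qed

lemma tower_first_order:
  assumes M: "exp_moments M" and F: "B-lipschitz_on UNIV F" and A: "\<And>i. noise_map L (A i)"
    and J: "finite J" and fo: "first_order J D K F \<Gamma>" and K: "0 \<le> K"
  shows "\<exists>K'\<ge>0. first_order J D K' (tower_energy M m A F n) (\<lambda>j. tower_mean M m A F 0 (\<Gamma> j) n)"
proof (induction n)
  case 0
  then show ?case using fo K by auto
next
  case (Suc n)
  then obtain K' where K': "0 \<le> K'"
    and fo': "first_order J D K' (tower_energy M m A F n) (\<lambda>j. tower_mean M m A F 0 (\<Gamma> j) n)" by blast
  show ?case
    using first_order_step[OF M tower_energy_lipschitz[OF M F A] A J fo', of "m (Suc n)"] K'
    by (intro exI[of _ "K' + \<bar>m (Suc n)\<bar> * B\<^sup>2 / 2"]) auto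
qed

lemma tower_increment_expansion:
  fixes A :: "nat \<Rightarrow> real \<Rightarrow> 'b::euclidean_space \<Rightarrow> 's::euclidean_space" and D :: "'j \<Rightarrow> 's \<Rightarrow> real"
  assumes M: "exp_moments M" and J: "finite J" and D: "\<And>j. j \<in> J \<Longrightarrow> bounded_linear (D j)"
    and \<tau>: "noise_map L \<tau>" and \<tau>0: "\<And>j. j \<in> J \<Longrightarrow> (\<integral>u. D j (\<tau> u) \<partial>M) = 0"
    and F: "B-lipschitz_on UNIV F" and fo: "first_order J D K F \<Gamma>" and K: "0 \<le> K"
    and A: "\<And>i. noise_family I L (A i)"
    and fixed: "\<And>i v v'. \<lbrakk>v \<in> I; v' \<in> I; i \<noteq> k; i \<noteq> Suc k\<rbrakk> \<Longrightarrow> A i v = A i v'"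
    and k: "1 \<le> k" and v0: "v0 \<in> I"
    and conv: "\<And>a b. \<lbrakk>a \<in> I; b \<in> I; a \<le> b\<rbrakk> \<Longrightarrow>
      distr (M \<Otimes>\<^sub>M M) borel (\<lambda>(u, u'). A k b u + sqrt (b - a) *\<^sub>R \<tau> u') = distr M borel (A k a)"
    and conv': "\<And>a b. \<lbrakk>a \<in> I; b \<in> I; a \<le> b\<rbrakk> \<Longrightarrow>
      distr (M \<Otimes>\<^sub>M M) borel (\<lambda>(u, u'). A (Suc k) a u + sqrt (b - a) *\<^sub>R \<tau> u') = distr M borel (A (Suc k) b)"
  shows "\<exists>Q R. increment_expansion I (\<lambda>v. tower_energy M m (\<lambda>i. A i v) F (Suc (k + n))) Q \<and>
     bdd_family (I \<times> I) R (\<lambda>(a, b). Q a b) \<and>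
     (\<forall>v\<in>I. Q v v = tower_mean M m (\<lambda>i. A i v) F k (\<lambda>s. (m (Suc k) - m k) / 2 *
        quad_form J (noise_cov M D \<tau>) (\<lambda>j. tower_mean M m (\<lambda>i. A i v) F 0 (\<Gamma> j) k) s) (Suc n))"
proof -
  obtain k0 where k0: "k = Suc k0" using k by (cases k) auto
  have nA: "noise_map L (A i v)" if "v \<in> I" for i v using A[of i] that by (simp add: noise_family_def)
  note nA0 = nA[OF v0]
  define E where "E = tower_energy M m (\<lambda>i. A i v0) F k0"
  define G where "G j = tower_mean M m (\<lambda>i. A i v0) F 0 (\<Gamma> j) k0" for j
  have E: "tower_energy M m (\<lambda>i. A i v) F k0 = E" if "v \<in> I" for v
    unfolding E_def by (rule tower_energy_cong) (use that v0 k0 in \<open>auto intro!: fixed\<close>)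
  have G: "tower_mean M m (\<lambda>i. A i v) F 0 (\<Gamma> j) k0 = G j" if "v \<in> I" for v j
    unfolding G_def by (rule tower_mean_cong) (use that v0 k0 in \<open>auto intro!: fixed\<close>)
  have lipE: "B-lipschitz_on UNIV E" unfolding E_def by (rule tower_energy_lipschitz[where A = "\<lambda>i. A i v0", OF M F nA0])
  obtain K' where K': "0 \<le> K'" "first_order J D K' E G"
    using tower_first_order[where A = "\<lambda>i. A i v0" and D = D and \<Gamma> = \<Gamma>, OF M F nA0 J fo K]
    unfolding E_def G_def[abs_def] by blast
  have lip: "B-lipschitz_on UNIV (tower_energy M m (\<lambda>i. A i v) F n)" if "v \<in> I" for v n
    by (rule tower_energy_lipschitz[where A = "\<lambda>i. A i v", OF M F nA[OF that]])
  note lipfam = tower_energy_family[where A = A, OF M F A]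
  show ?thesis
  proof (induction n)
    case 0
    let ?V = "\<lambda>v s. (m (Suc k) - m k) / 2 * quad_form J (noise_cov M D \<tau>) (\<lambda>j. mean_step M (m k) (A k v) E (G j)) s"
    let ?Q = "\<lambda>a b. mean_step M (m (Suc k)) (A (Suc k) a) (energy_step M (m k) (A k a) E) (?V b)"
    have en: "tower_energy M m (\<lambda>i. A i v) F (Suc k)
        = energy_step M (m (Suc k)) (A (Suc k) v) (energy_step M (m k) (A k v) E)" if "v \<in> I" for v
      by (simp add: k0 E[OF that])
    note two = increment_expansion_two_levels[where D = D and m = "m k" and m' = "m (Suc k)",
        OF M J D \<tau> \<tau>0 lipE K'(2) K'(1) A A conv conv']
    have "increment_expansion I (\<lambda>v. tower_energy M m (\<lambda>i. A i v) F (Suc k)) ?Q"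
      by (rule increment_expansion_cong[OF two(1)]) (simp_all only: en)
    moreover obtain R where "bdd_family (I \<times> I) R (\<lambda>(a, b). ?Q a b)" using two(2) by blast
    moreover have "?Q v v = tower_mean M m (\<lambda>i. A i v) F k (\<lambda>s. (m (Suc k) - m k) / 2 *
        quad_form J (noise_cov M D \<tau>) (\<lambda>j. tower_mean M m (\<lambda>i. A i v) F 0 (\<Gamma> j) k) s) (Suc 0)" if "v \<in> I" for v
      by (simp add: k0 E[OF that] G[OF that])
    ultimately show ?case by (intro exI[of _ ?Q] exI[of _ R]) auto
  next
    case (Suc n)
    then obtain Q R where Q: "increment_expansion I (\<lambda>v. tower_energy M m (\<lambda>i. A i v) F (Suc (k + n))) Q"
      "bdd_family (I \<times> I) R (\<lambda>(a, b). Q a b)"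
      "\<And>v. v \<in> I \<Longrightarrow> Q v v = tower_mean M m (\<lambda>i. A i v) F k (\<lambda>s. (m (Suc k) - m k) / 2 *
        quad_form J (noise_cov M D \<tau>) (\<lambda>j. tower_mean M m (\<lambda>i. A i v) F 0 (\<Gamma> j) k) s) (Suc n)"
      by blast
    let ?i = "Suc (Suc (k + n))"
    let ?Q = "\<lambda>a b. mean_step M (m ?i) (A ?i v0) (tower_energy M m (\<lambda>i. A i a) F (Suc (k + n))) (Q a b)"
    have eq: "A ?i v = A ?i v0" if "v \<in> I" for v using that v0 by (intro fixed) auto
    have "increment_expansion I (\<lambda>v. energy_step M (m ?i) (A ?i v0) (tower_energy M m (\<lambda>i. A i v) F (Suc (k + n)))) ?Q"
      by (rule increment_expansion_step[OF M lip nA0 Q(2,1)])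
    then have "increment_expansion I (\<lambda>v. tower_energy M m (\<lambda>i. A i v) F (Suc (k + Suc n))) ?Q"
      by (rule increment_expansion_cong) (simp only: tower_energy.simps(2)[of _ _ _ _ "Suc (k + n)"] add_Suc_right eq)
    moreover have "bdd_family (I \<times> I) R (\<lambda>(a, b). ?Q a b)"
    proof -
      have pr: "fst ` (I \<times> I) \<subseteq> I" by auto
      have "noise_family (I \<times> I) L (\<lambda>p. A ?i v0)" using nA0 by (simp add: noise_family_def)
      then have "bdd_family (I \<times> I) R (\<lambda>p. mean_step M (m ?i) (A ?i v0)
          (tower_energy M m (\<lambda>i. A i (fst p)) F (Suc (k + n))) ((\<lambda>(a, b). Q a b) p))"
        by (intro mean_step_family[OF M lip_family_compose[OF lipfam _ pr]] Q(2)) (intro continuous_intros)+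
      then show ?thesis by (simp add: case_prod_unfold)
    qed
    moreover have "?Q v v = tower_mean M m (\<lambda>i. A i v) F k (\<lambda>s. (m (Suc k) - m k) / 2 *
        quad_form J (noise_cov M D \<tau>) (\<lambda>j. tower_mean M m (\<lambda>i. A i v) F 0 (\<Gamma> j) k) s) (Suc (Suc n))"
      if "v \<in> I" for v
      unfolding tower_mean.simps(2)[of _ _ _ _ _ _ "Suc n"] add_Suc_right Q(3)[OF that, symmetric]
      by (simp only: eq[OF that])
    ultimately show ?case by (intro exI[of _ ?Q] exI[of _ R]) auto
  qed
qed

lemma tower_derivative:
  fixes A :: "nat \<Rightarrow> real \<Rightarrow> 'b::euclidean_space \<Rightarrow> 's::euclidean_space" and D :: "'j \<Rightarrow> 's \<Rightarrow> real"
    and A0 :: "'g::euclidean_space \<Rightarrow> 's"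
  assumes M: "exp_moments M" and J: "finite J" and D: "\<And>j. j \<in> J \<Longrightarrow> bounded_linear (D j)"
    and \<tau>: "noise_map L \<tau>" and \<tau>0: "\<And>j. j \<in> J \<Longrightarrow> (\<integral>u. D j (\<tau> u) \<partial>M) = 0"
    and F: "B-lipschitz_on UNIV F" and fo: "first_order J D K F \<Gamma>" and K: "0 \<le> K"
    and A: "\<And>i. noise_family I L (A i)"
    and fixed: "\<And>i v v'. \<lbrakk>v \<in> I; v' \<in> I; i \<noteq> k; i \<noteq> Suc k\<rbrakk> \<Longrightarrow> A i v = A i v'"
    and k: "1 \<le> k" and v: "v \<in> I"
    and conv: "\<And>a b. \<lbrakk>a \<in> I; b \<in> I; a \<le> b\<rbrakk> \<Longrightarrow>
      distr (M \<Otimes>\<^sub>M M) borel (\<lambda>(u, u'). A k b u + sqrt (b - a) *\<^sub>R \<tau> u') = distr M borel (A k a)"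
    and conv': "\<And>a b. \<lbrakk>a \<in> I; b \<in> I; a \<le> b\<rbrakk> \<Longrightarrow>
      distr (M \<Otimes>\<^sub>M M) borel (\<lambda>(u, u'). A (Suc k) a u + sqrt (b - a) *\<^sub>R \<tau> u') = distr M borel (A (Suc k) b)"
    and N: "exp_moments N" and A0: "noise_map L0 A0"
  shows "((\<lambda>v. \<integral>g. tower_energy M m (\<lambda>i. A i v) F (Suc (k + n)) (A0 g) \<partial>N) has_real_derivative
      (\<integral>g. tower_mean M m (\<lambda>i. A i v) F k (\<lambda>s. (m (Suc k) - m k) / 2 *
        quad_form J (noise_cov M D \<tau>) (\<lambda>j. tower_mean M m (\<lambda>i. A i v) F 0 (\<Gamma> j) k) s) (Suc n) (A0 g) \<partial>N))
      (at v within I)"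
proof -
  interpret N: prob_space N by (rule exp_moments_prob_space[OF N])
  have nA: "noise_map L (A i v)" if "v \<in> I" for i v using A[of i] that by (simp add: noise_family_def)
  obtain Q R where Q: "increment_expansion I (\<lambda>v. tower_energy M m (\<lambda>i. A i v) F (Suc (k + n))) Q"
    "bdd_family (I \<times> I) R (\<lambda>(a, b). Q a b)"
    "\<And>v. v \<in> I \<Longrightarrow> Q v v = tower_mean M m (\<lambda>i. A i v) F k (\<lambda>s. (m (Suc k) - m k) / 2 *
        quad_form J (noise_cov M D \<tau>) (\<lambda>j. tower_mean M m (\<lambda>i. A i v) F 0 (\<Gamma> j) k) s) (Suc n)"
    using tower_increment_expansion[where D = D and A = A, OF M J D \<tau> \<tau>0 F fo K A fixed k v conv conv'] by blast
  let ?E = "\<lambda>v. tower_energy M m (\<lambda>i. A i v) F (Suc (k + n))"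
  have lip: "B-lipschitz_on UNIV (?E v)" if "v \<in> I" for v
    by (rule tower_energy_lipschitz[where A = "\<lambda>i. A i v", OF M F nA[OF that]])
  note lipfam = tower_energy_family[where A = A, OF M F A]
  have "increment_expansion I (\<lambda>v. energy_step N 0 A0 (?E v)) (\<lambda>a b. mean_step N 0 A0 (?E a) (Q a b))"
    by (rule increment_expansion_step[OF N lip A0 Q(2,1)])
  moreover have "bdd_family (I \<times> I) R (\<lambda>(a, b). mean_step N 0 A0 (?E a) (Q a b))"
  proof -
    have pr: "fst ` (I \<times> I) \<subseteq> I" by auto
    have "noise_family (I \<times> I) L0 (\<lambda>p. A0)" using A0 by (simp add: noise_family_def)
    then have "bdd_family (I \<times> I) R (\<lambda>p. mean_step N 0 A0 (?E (fst p)) ((\<lambda>(a, b). Q a b) p))"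
      by (intro mean_step_family[OF N lip_family_compose[OF lipfam _ pr]] Q(2)) (intro continuous_intros)+
    then show ?thesis by (simp add: case_prod_unfold)
  qed
  ultimately have "((\<lambda>v. energy_step N 0 A0 (?E v) 0) has_real_derivative mean_step N 0 A0 (?E v) (Q v v) 0) (at v within I)"
    by (rule increment_expansion_derivative) (rule v)
  then show ?thesis
    unfolding Q(3)[OF v]
    by (simp add: energy_step_def free_energy_def mean_step_def tilted_mean_def N.prob_space del: tower_energy.simps tower_mean.simps)
qed

section \<open>Gaussian noise\<close>

lemma
  fixes f :: "'a \<Rightarrow> real" and g :: "'b \<Rightarrow> real"
  assumes M: "prob_space M" and N: "prob_space N" and f: "integrable M f" and g: "integrable N g"
  shows integrable_pair_mult: "integrable (M \<Otimes>\<^sub>M N) (\<lambda>(x, y). f x * g y)"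
    and integral_pair_mult: "(\<integral>(x, y). f x * g y \<partial>(M \<Otimes>\<^sub>M N)) = (\<integral>x. f x \<partial>M) * (\<integral>y. g y \<partial>N)"
proof -
  interpret M: prob_space M by fact
  interpret N: prob_space N by fact
  interpret P: pair_prob_space M N ..
  have [measurable]: "f \<in> borel_measurable M" "g \<in> borel_measurable N" using f g by auto
  show *: "integrable (M \<Otimes>\<^sub>M N) (\<lambda>(x, y). f x * g y)"
    by (rule P.Fubini_integrable) (use f g in \<open>auto simp: abs_mult\<close>)
  show "(\<integral>(x, y). f x * g y \<partial>(M \<Otimes>\<^sub>M N)) = (\<integral>x. f x \<partial>M) * (\<integral>y. g y \<partial>N)"
    using P.integral_fst[OF *] by simp
qed

lemma
  fixes f :: "'a \<Rightarrow> real" and g :: "'b \<Rightarrow> real"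
  assumes M: "prob_space M" and N: "prob_space N" and f: "integrable M f" and g: "integrable N g"
  shows integrable_pair_add: "integrable (M \<Otimes>\<^sub>M N) (\<lambda>(x, y). f x + g y)"
    and integral_pair_add: "(\<integral>(x, y). f x + g y \<partial>(M \<Otimes>\<^sub>M N)) = (\<integral>x. f x \<partial>M) + (\<integral>y. g y \<partial>N)"
proof -
  interpret M: prob_space M by fact
  interpret N: prob_space N by fact
  have 1: "integrable N (\<lambda>_. 1::real)" "integrable M (\<lambda>_. 1::real)" by auto
  note i1 = integrable_pair_mult[OF M N f 1(1)] integrable_pair_mult[OF M N 1(2) g]
  note i2 = integral_pair_mult[OF M N f 1(1)] integral_pair_mult[OF M N 1(2) g]
  have i1': "integrable (M \<Otimes>\<^sub>M N) (\<lambda>p. f (fst p))" "integrable (M \<Otimes>\<^sub>M N) (\<lambda>p. g (snd p))"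
    using i1 by (simp_all add: case_prod_unfold)
  have i2': "(\<integral>p. f (fst p) \<partial>(M \<Otimes>\<^sub>M N)) = (\<integral>x. f x \<partial>M)" "(\<integral>p. g (snd p) \<partial>(M \<Otimes>\<^sub>M N)) = (\<integral>y. g y \<partial>N)"
    using i2 by (simp_all add: case_prod_unfold M.prob_space N.prob_space)
  show "integrable (M \<Otimes>\<^sub>M N) (\<lambda>(x, y). f x + g y)"
    using i1' by (simp add: case_prod_unfold)
  show "(\<integral>(x, y). f x + g y \<partial>(M \<Otimes>\<^sub>M N)) = (\<integral>x. f x \<partial>M) + (\<integral>y. g y \<partial>N)"
    using i1' i2' by (simp add: case_prod_unfold)
qed

lemma integral_pair_centered:
  fixes f f' :: "'a \<Rightarrow> real" and g g' :: "'b \<Rightarrow> real"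
  assumes M: "prob_space M" and N: "prob_space N"
    and f: "integrable M f" "integrable M f'" "integrable M (\<lambda>x. f x * f' x)" "(\<integral>x. f x \<partial>M) = 0" "(\<integral>x. f' x \<partial>M) = 0"
    and g: "integrable N g" "integrable N g'" "integrable N (\<lambda>x. g x * g' x)" "(\<integral>x. g x \<partial>N) = 0" "(\<integral>x. g' x \<partial>N) = 0"
  shows "integrable (M \<Otimes>\<^sub>M N) (\<lambda>(x, y). (f x + g y) * (f' x + g' y))"
    "(\<integral>(x, y). (f x + g y) * (f' x + g' y) \<partial>(M \<Otimes>\<^sub>M N)) = (\<integral>x. f x * f' x \<partial>M) + (\<integral>y. g y * g' y \<partial>N)"
proof -
  have eq: "(\<lambda>(x, y). (f x + g y) * (f' x + g' y))
    = (\<lambda>p. (case p of (x, y) \<Rightarrow> f x * f' x + g y * g' y) + (case p of (x, y) \<Rightarrow> f x * g' y) + (case p of (x, y) \<Rightarrow> f' x * g y))"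
    by (auto simp: algebra_simps)
  note i = integrable_pair_add[OF M N f(3) g(3)] integrable_pair_mult[OF M N f(1) g(2)] integrable_pair_mult[OF M N f(2) g(1)]
  show "integrable (M \<Otimes>\<^sub>M N) (\<lambda>(x, y). (f x + g y) * (f' x + g' y))"
    unfolding eq using i by auto
  show "(\<integral>(x, y). (f x + g y) * (f' x + g' y) \<partial>(M \<Otimes>\<^sub>M N)) = (\<integral>x. f x * f' x \<partial>M) + (\<integral>y. g y * g' y \<partial>N)"
    unfolding eq using i f g
    by (simp add: integral_pair_add[OF M N f(3) g(3)] integral_pair_mult[OF M N f(1) g(2)] integral_pair_mult[OF M N f(2) g(1)])
qed

lemma exp_momentsI:
  fixes M :: "'b::euclidean_space measure"
  assumes "prob_space M" "sets M = sets borel"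
    and int: "\<And>c. 0 \<le> c \<Longrightarrow> integrable M (\<lambda>u. exp (c * norm u))"
  shows "exp_moments M"
  unfolding exp_moments_def
proof (intro conjI allI assms(1,2))
  fix c
  show "integrable M (\<lambda>u. exp (c * norm u))"
  proof (rule Bochner_Integration.integrable_bound[OF int[of "\<bar>c\<bar>"]])
    have "c * norm u \<le> \<bar>c\<bar> * norm u" for u :: 'b by (intro mult_right_mono) auto
    then show "AE u in M. norm (exp (c * norm u)) \<le> norm (exp (\<bar>c\<bar> * norm u))" by (intro AE_I2) simp
    show "(\<lambda>u. exp (c * norm u)) \<in> borel_measurable M"
      by (subst measurable_cong_sets[OF assms(2) refl]) measurable
  qed simp
qed

lemma exp_moments_pair:
  fixes M :: "'a::euclidean_space measure" and N :: "'b::euclidean_space measure"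
  assumes M: "exp_moments M" and N: "exp_moments N"
  shows "exp_moments (M \<Otimes>\<^sub>M N)"
proof (rule exp_momentsI)
  note pM = exp_moments_prob_space[OF M] and pN = exp_moments_prob_space[OF N]
  interpret M: prob_space M by fact
  interpret N: prob_space N by fact
  interpret P: pair_prob_space M N ..
  show "prob_space (M \<Otimes>\<^sub>M N)" by unfold_locales
  show s: "sets (M \<Otimes>\<^sub>M N) = sets (borel :: ('a \<times> 'b) measure)"
    unfolding borel_prod[symmetric] by (intro sets_pair_measure_cong exp_moments_sets M N)
  fix c :: real assume c: "0 \<le> c"
  show "integrable (M \<Otimes>\<^sub>M N) (\<lambda>u. exp (c * norm u))"
  proof (rule Bochner_Integration.integrable_bound)
    show "integrable (M \<Otimes>\<^sub>M N) (\<lambda>(x, y). exp (c * norm x) * exp (c * norm y))"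
      using M N by (intro integrable_pair_mult pM pN) (auto simp: exp_moments_def)
    have "c * norm u \<le> c * (norm (fst u) + norm (snd u))" for u :: "'a \<times> 'b"
      using norm_Pair_le[of "fst u" "snd u"] c by (intro mult_left_mono) auto
    then show "AE u in M \<Otimes>\<^sub>M N. norm (exp (c * norm u)) \<le> norm (case u of (x, y) \<Rightarrow> exp (c * norm x) * exp (c * norm y))"
      by (intro AE_I2) (simp add: case_prod_unfold exp_add[symmetric] distrib_left)
    show "(\<lambda>u. exp (c * norm u)) \<in> borel_measurable (M \<Otimes>\<^sub>M N)"
      by (subst measurable_cong_sets[OF s refl]) measurable
  qed
qed

lemma prob_space_std_gauss: "prob_space std_gauss"
  unfolding std_gauss_def by (rule prob_space_normal_density) simp

lemma sets_std_gauss [measurable_cong, simp]: "sets std_gauss = sets borel"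
  by (simp add: std_gauss_def)

lemma space_std_gauss [simp]: "space std_gauss = UNIV"
  by (simp add: std_gauss_def)

lemma measurable_std_gauss [simp]: "measurable std_gauss N = measurable borel N"
  by (intro measurable_cong_sets) simp_all

lemma exp_moments_std_gauss: "exp_moments std_gauss"
proof (rule exp_momentsI[OF prob_space_std_gauss sets_std_gauss])
  fix c :: real assume c: "0 \<le> c"
  have e: "std_normal_density x * exp (a * x) = exp (a\<^sup>2 / 2) * normal_density a 1 x" for a x
  proof -
    have "- x\<^sup>2 / 2 + a * x = a\<^sup>2 / 2 - (x - a)\<^sup>2 / 2" by (simp add: power2_eq_square field_simps)
    then have "exp (- x\<^sup>2 / 2) * exp (a * x) = exp (a\<^sup>2 / 2) * exp (- (x - a)\<^sup>2 / 2)"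
      by (simp add: exp_add[symmetric])
    then show ?thesis by (simp add: normal_density_def)
  qed
  have i: "integrable std_gauss (\<lambda>x. exp (a * x))" for a
    unfolding std_gauss_def by (subst integrable_real_density) (simp_all add: e)
  show "integrable std_gauss (\<lambda>x. exp (c * norm x))"
  proof (rule Bochner_Integration.integrable_bound)
    show "integrable std_gauss (\<lambda>x. exp (c * x) + exp ((- c) * x))"
      by (intro Bochner_Integration.integrable_add i)
    have "exp (c * \<bar>x\<bar>) \<le> exp (c * x) + exp (- c * x)" for x
      by (cases "0 \<le> x") auto
    then show "AE x in std_gauss. norm (exp (c * norm x)) \<le> norm (exp (c * x) + exp ((- c) * x))"
      by (intro AE_I2) simp
  qed simp
qed

lemma std_gauss_moments:
  "integrable std_gauss (\<lambda>x. x)" "(\<integral>x. x \<partial>std_gauss) = 0"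
  "integrable std_gauss (\<lambda>x. x * x)" "(\<integral>x. x * x \<partial>std_gauss) = 1"
proof -
  show "integrable std_gauss (\<lambda>x. x)" unfolding std_gauss_def
    using integrable_std_normal_moment[of 1] by (subst integrable_real_density) simp_all
  show "integrable std_gauss (\<lambda>x. x * x)" unfolding std_gauss_def
    using integrable_std_normal_moment[of 2]
    by (subst integrable_real_density) (simp_all add: power2_eq_square)
  show "(\<integral>x. x \<partial>std_gauss) = 0" unfolding std_gauss_def
    using integral_std_normal_moment_odd[of 0] by (subst integral_real_density) simp_all
  show "(\<integral>x. x * x \<partial>std_gauss) = 1" unfolding std_gauss_def
    using integral_std_normal_moment_even[of 1]
    by (subst integral_real_density) (simp_all add: power2_eq_square fact_numeral)
qed

text \<open>\<open>A1 u + A2 u'\<close> with independent \<open>u\<close> and \<open>u'\<close> has the law of \<open>A3 u\<close>. As an identity of iterated integrals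
  this passes to product measures by Fubini.\<close>

definition noise_sum :: "'b measure \<Rightarrow> ('b \<Rightarrow> 's::euclidean_space) \<Rightarrow> ('b \<Rightarrow> 's) \<Rightarrow> ('b \<Rightarrow> 's) \<Rightarrow> bool" where
  "noise_sum M A1 A2 A3 \<longleftrightarrow> (\<forall>f \<in> borel_measurable borel.
     (\<integral>\<^sup>+x. \<integral>\<^sup>+x'. f (A1 x + A2 x') \<partial>M \<partial>M) = (\<integral>\<^sup>+x. f (A3 x) \<partial>M))"

lemma noise_sum_distr:
  fixes A1 A2 A3 :: "'b \<Rightarrow> 's::euclidean_space"
  assumes M: "prob_space M" and s: "noise_sum M A1 A2 A3"
    and A[measurable]: "A1 \<in> borel_measurable M" "A2 \<in> borel_measurable M" "A3 \<in> borel_measurable M"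
  shows "distr (M \<Otimes>\<^sub>M M) borel (\<lambda>(u, u'). A1 u + A2 u') = distr M borel A3"
proof (rule measure_eqI)
  interpret prob_space M by fact
  fix X assume "X \<in> sets (distr (M \<Otimes>\<^sub>M M) borel (\<lambda>(u, u'). A1 u + A2 u'))"
  then have X[measurable]: "X \<in> sets borel" by simp
  have "emeasure (distr (M \<Otimes>\<^sub>M M) borel (\<lambda>(u, u'). A1 u + A2 u')) X
      = (\<integral>\<^sup>+w. indicator X w \<partial>distr (M \<Otimes>\<^sub>M M) borel (\<lambda>(u, u'). A1 u + A2 u'))"
    by simp
  also have "\<dots> = (\<integral>\<^sup>+p. indicator X (A1 (fst p) + A2 (snd p)) \<partial>(M \<Otimes>\<^sub>M M))"
    by (subst nn_integral_distr) (auto simp: case_prod_unfold)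
  also have "\<dots> = (\<integral>\<^sup>+x. \<integral>\<^sup>+x'. indicator X (A1 x + A2 x') \<partial>M \<partial>M)"
    by (subst nn_integral_fst[symmetric]) auto
  also have "\<dots> = (\<integral>\<^sup>+x. indicator X (A3 x) \<partial>M)"
    using s unfolding noise_sum_def by (rule bspec) simp
  also have "\<dots> = (\<integral>\<^sup>+w. indicator X w \<partial>distr M borel A3)"
    by (rule nn_integral_distr[symmetric]) auto
  also have "\<dots> = emeasure (distr M borel A3) X" by simp
  finally show "emeasure (distr (M \<Otimes>\<^sub>M M) borel (\<lambda>(u, u'). A1 u + A2 u')) X = emeasure (distr M borel A3) X" .
qed simp

lemma noise_sum_pair:
  fixes A1 A2 A3 :: "'a \<Rightarrow> 's::euclidean_space" and B1 B2 B3 :: "'b \<Rightarrow> 't::euclidean_space"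
  assumes M: "prob_space M" and N: "prob_space N"
    and s: "noise_sum M A1 A2 A3" and s': "noise_sum N B1 B2 B3"
    and A[measurable]: "A1 \<in> borel_measurable M" "A2 \<in> borel_measurable M" "A3 \<in> borel_measurable M"
    and B[measurable]: "B1 \<in> borel_measurable N" "B2 \<in> borel_measurable N" "B3 \<in> borel_measurable N"
  shows "noise_sum (M \<Otimes>\<^sub>M N) (\<lambda>(x, y). (A1 x, B1 y)) (\<lambda>(x, y). (A2 x, B2 y)) (\<lambda>(x, y). (A3 x, B3 y))"
  unfolding noise_sum_def
proof
  interpret M: prob_space M by fact
  interpret N: prob_space N by fact
  interpret P: pair_prob_space M N ..
  fix f :: "'s \<times> 't \<Rightarrow> ennreal" assume "f \<in> borel_measurable borel"
  then have [measurable]: "f \<in> borel_measurable (borel \<Otimes>\<^sub>M borel)" by (simp add: borel_prod)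
  have "(\<integral>\<^sup>+p. \<integral>\<^sup>+p'. f ((case p of (x, y) \<Rightarrow> (A1 x, B1 y)) + (case p' of (x, y) \<Rightarrow> (A2 x, B2 y))) \<partial>(M \<Otimes>\<^sub>M N) \<partial>(M \<Otimes>\<^sub>M N))
      = (\<integral>\<^sup>+x. \<integral>\<^sup>+y. \<integral>\<^sup>+x'. \<integral>\<^sup>+y'. f (A1 x + A2 x', B1 y + B2 y') \<partial>N \<partial>M \<partial>N \<partial>M)"
    by (simp add: N.nn_integral_fst[symmetric] case_prod_unfold)
  also have "\<dots> = (\<integral>\<^sup>+x. \<integral>\<^sup>+x'. \<integral>\<^sup>+y. \<integral>\<^sup>+y'. f (A1 x + A2 x', B1 y + B2 y') \<partial>N \<partial>N \<partial>M \<partial>M)"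
    by (intro nn_integral_cong P.Fubini') auto
  also have "\<dots> = (\<integral>\<^sup>+x. \<integral>\<^sup>+x'. \<integral>\<^sup>+y. f (A1 x + A2 x', B3 y) \<partial>N \<partial>M \<partial>M)"
    by (intro nn_integral_cong bspec[OF s'[unfolded noise_sum_def]]) auto
  also have "\<dots> = (\<integral>\<^sup>+x. \<integral>\<^sup>+y. f (A3 x, B3 y) \<partial>N \<partial>M)"
    by (rule bspec[OF s[unfolded noise_sum_def], of "\<lambda>z. \<integral>\<^sup>+y. f (z, B3 y) \<partial>N"]) measurable
  also have "\<dots> = (\<integral>\<^sup>+p. f (case p of (x, y) \<Rightarrow> (A3 x, B3 y)) \<partial>(M \<Otimes>\<^sub>M N))"
    by (simp add: N.nn_integral_fst[symmetric] case_prod_unfold)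
  finally show "(\<integral>\<^sup>+p. \<integral>\<^sup>+p'. f ((case p of (x, y) \<Rightarrow> (A1 x, B1 y)) + (case p' of (x, y) \<Rightarrow> (A2 x, B2 y))) \<partial>(M \<Otimes>\<^sub>M N) \<partial>(M \<Otimes>\<^sub>M N))
      = (\<integral>\<^sup>+p. f (case p of (x, y) \<Rightarrow> (A3 x, B3 y)) \<partial>(M \<Otimes>\<^sub>M N))" .
qed

lemma noise_sum_std_gauss:
  assumes "0 \<le> \<sigma>" "0 \<le> \<tau>"
  shows "noise_sum std_gauss ((*) \<sigma>) ((*) \<tau>) ((*) (sqrt (\<sigma>\<^sup>2 + \<tau>\<^sup>2)))"
  unfolding noise_sum_def
proof
  interpret prob_space std_gauss by (rule prob_space_std_gauss)
  interpret P: pair_prob_space std_gauss std_gauss ..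
  fix f :: "real \<Rightarrow> ennreal" assume f[measurable]: "f \<in> borel_measurable borel"
  consider "\<sigma> = 0" | "\<tau> = 0" | "0 < \<sigma>" "0 < \<tau>" using assms by linarith
  then show "(\<integral>\<^sup>+x. \<integral>\<^sup>+x'. f (\<sigma> * x + \<tau> * x') \<partial>std_gauss \<partial>std_gauss) = (\<integral>\<^sup>+x. f (sqrt (\<sigma>\<^sup>2 + \<tau>\<^sup>2) * x) \<partial>std_gauss)"
  proof cases
    case 3
    let ?P = "std_gauss \<Otimes>\<^sub>M std_gauss"
    have d1: "distr ?P std_gauss fst = std_gauss" by (rule distr_pair_fst)
    have d2: "distr ?P std_gauss snd = std_gauss"
    proof (rule measure_eqI)
      fix X assume X: "X \<in> sets (distr ?P std_gauss snd)"
      then have "snd -` X \<inter> space ?P = space std_gauss \<times> X"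
        by (auto simp: space_pair_measure)
      then show "emeasure (distr ?P std_gauss snd) X = emeasure std_gauss X"
        using X emeasure_space_1 by (simp add: emeasure_distr emeasure_pair_measure_Times)
    qed simp
    have dist: "distributed M lborel X std_normal_density"
      if "X \<in> borel_measurable M" "distr M std_gauss X = std_gauss" for M and X :: "'c \<Rightarrow> real"
      using that unfolding distributed_def
      by (auto simp: std_gauss_def cong: distr_cong)
    have m: "fst \<in> borel_measurable ?P" "snd \<in> borel_measurable ?P" 
      using measurable_fst[of std_gauss std_gauss] measurable_snd[of std_gauss std_gauss]
        measurable_cong_sets[OF refl sets_std_gauss] by blast+
    have mp: "(\<lambda>p. \<sigma> * fst p + \<tau> * snd p) \<in> borel_measurable ?P"
      by (intro borel_measurable_add borel_measurable_times borel_measurable_const m)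
    have "distributed ?P lborel (\<lambda>p. 0 + \<sigma> * fst p) (normal_density (0 + \<sigma> * 0) (\<bar>\<sigma>\<bar> * 1))"
      by (rule P.normal_density_affine[OF dist[OF m(1) d1]]) (use 3 in auto)
    moreover have "distributed ?P lborel (\<lambda>p. 0 + \<tau> * snd p) (normal_density (0 + \<tau> * 0) (\<bar>\<tau>\<bar> * 1))"
      by (rule P.normal_density_affine[OF dist[OF m(2) d2]]) (use 3 in auto)
    ultimately have n: "distributed ?P lborel (\<lambda>p. \<sigma> * fst p) (normal_density 0 \<sigma>)"
      "distributed ?P lborel (\<lambda>p. \<tau> * snd p) (normal_density 0 \<tau>)" using 3 by simp_all
    have "P.indep_var borel fst borel snd"
      unfolding P.indep_var_distribution_eq
    proof (intro conjI)
      have "distr ?P borel fst \<Otimes>\<^sub>M distr ?P borel snd = distr ?P std_gauss fst \<Otimes>\<^sub>M distr ?P std_gauss snd"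
        by (intro arg_cong2[where f = pair_measure] distr_cong) auto
      also have "\<dots> = distr ?P ?P (\<lambda>x. x)" unfolding d1 d2 by (rule distr_id[symmetric, unfolded id_def])
      also have "\<dots> = distr ?P (borel \<Otimes>\<^sub>M borel) (\<lambda>x. (fst x, snd x))"
        by (intro distr_cong) (auto intro!: sets_pair_measure_cong)
      finally show "distr ?P borel fst \<Otimes>\<^sub>M distr ?P borel snd = distr ?P (borel \<Otimes>\<^sub>M borel) (\<lambda>x. (fst x, snd x))" .
    qed (rule m)+
    from P.indep_var_compose[OF this, of "(*) \<sigma>" borel "(*) \<tau>" borel]
    have "P.indep_var borel (\<lambda>p. \<sigma> * fst p) borel (\<lambda>p. \<tau> * snd p)" by (simp add: comp_def)
    from P.add_indep_normal[OF this 3 n]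
    have a: "distributed ?P lborel (\<lambda>p. \<sigma> * fst p + \<tau> * snd p) (normal_density 0 (sqrt (\<sigma>\<^sup>2 + \<tau>\<^sup>2)))" by simp
    have pos: "0 < sqrt (\<sigma>\<^sup>2 + \<tau>\<^sup>2)" using 3 by (simp add: add_pos_pos)
    have "distributed std_gauss lborel (\<lambda>x. x) std_normal_density"
      by (rule dist) (simp_all add: distr_id[unfolded id_def])
    from normal_density_affine[OF this, of "sqrt (\<sigma>\<^sup>2 + \<tau>\<^sup>2)" 0] pos 3
    have b: "distributed std_gauss lborel (\<lambda>x. sqrt (\<sigma>\<^sup>2 + \<tau>\<^sup>2) * x) (normal_density 0 (sqrt (\<sigma>\<^sup>2 + \<tau>\<^sup>2)))" by auto
    have "(\<integral>\<^sup>+x. \<integral>\<^sup>+x'. f (\<sigma> * x + \<tau> * x') \<partial>std_gauss \<partial>std_gauss) = (\<integral>\<^sup>+p. f (\<sigma> * fst p + \<tau> * snd p) \<partial>?P)"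
      by (subst nn_integral_fst[symmetric]) (simp_all add: measurable_compose[OF mp f])
    also have "\<dots> = (\<integral>\<^sup>+w. f w \<partial>distr ?P lborel (\<lambda>p. \<sigma> * fst p + \<tau> * snd p))"
      by (subst nn_integral_distr) (use mp in auto)
    also have "\<dots> = (\<integral>\<^sup>+w. f w \<partial>distr std_gauss lborel (\<lambda>x. sqrt (\<sigma>\<^sup>2 + \<tau>\<^sup>2) * x))"
      using a b by (simp add: distributed_def)
    also have "\<dots> = (\<integral>\<^sup>+x. f (sqrt (\<sigma>\<^sup>2 + \<tau>\<^sup>2) * x) \<partial>std_gauss)"
      by (subst nn_integral_distr) auto
    finally show ?thesis .
  qed (use assms emeasure_space_1 in \<open>auto simp: mult.commute\<close>)
qed

lemma noise_sum_map:
  fixes V :: "'a \<Rightarrow> 's::euclidean_space"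
  assumes V: "V \<in> measurable M borel" and M: "prob_space M"
    and rect: "distr (M \<Otimes>\<^sub>M M) M (\<lambda>(x, y). h x y) = distr M M k"
    and h: "(\<lambda>(x, y). h x y) \<in> measurable (M \<Otimes>\<^sub>M M) M" and k: "k \<in> measurable M M"
    and A[measurable]: "A1 \<in> borel_measurable borel" "A2 \<in> borel_measurable borel" "A3 \<in> borel_measurable borel"
    and hV: "\<And>x y. V (h x y) = A1 (V x) + A2 (V y)" and kV: "\<And>x. V (k x) = A3 (V x)"
  shows "noise_sum (distr M borel V) A1 A2 A3"
  unfolding noise_sum_def
proof
  interpret prob_space M by fact
  note V[measurable] h[measurable] k[measurable]
  fix f :: "'s \<Rightarrow> ennreal" assume [measurable]: "f \<in> borel_measurable borel"
  have "(\<integral>\<^sup>+x. \<integral>\<^sup>+x'. f (A1 x + A2 x') \<partial>distr M borel V \<partial>distr M borel V)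
      = (\<integral>\<^sup>+x. \<integral>\<^sup>+y. f (V (h x y)) \<partial>M \<partial>M)"
    by (simp add: nn_integral_distr hV)
  also have "\<dots> = (\<integral>\<^sup>+p. f (V (case p of (x, y) \<Rightarrow> h x y)) \<partial>(M \<Otimes>\<^sub>M M))"
    by (subst nn_integral_fst[symmetric]) auto
  also have "\<dots> = (\<integral>\<^sup>+z. f (V z) \<partial>distr (M \<Otimes>\<^sub>M M) M (\<lambda>(x, y). h x y))"
    by (subst nn_integral_distr) auto
  also have "\<dots> = (\<integral>\<^sup>+x. f (A3 x) \<partial>distr M borel V)"
    unfolding rect by (simp add: nn_integral_distr kV)
  finally show "(\<integral>\<^sup>+x. \<integral>\<^sup>+x'. f (A1 x + A2 x') \<partial>distr M borel V \<partial>distr M borel V)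
      = (\<integral>\<^sup>+x. f (A3 x) \<partial>distr M borel V)" .
qed

abbreviation gauss_PiM :: "('i \<Rightarrow> real) measure" where
  "gauss_PiM \<equiv> \<Pi>\<^sub>M i\<in>UNIV. std_gauss"

lemma space_gauss_PiM [simp]: "space gauss_PiM = UNIV"
  by (simp add: space_PiM PiE_def extensional_def)

lemma prob_space_gauss_PiM: "prob_space gauss_PiM"
  by (intro prob_space_PiM prob_space_std_gauss)

lemma gauss_PiM_component [measurable]: "(\<lambda>f. f i) \<in> borel_measurable gauss_PiM"
proof -
  have "(\<lambda>f. f i) \<in> measurable gauss_PiM std_gauss" by (rule measurable_component_singleton) simp
  then show ?thesis using measurable_cong_sets[OF refl sets_std_gauss] by blast
qed

lemma measurable_gauss_PiM:
  assumes "\<And>i. (\<lambda>x. f x i) \<in> borel_measurable M"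
  shows "f \<in> measurable M gauss_PiM"
proof -
  have "(\<lambda>x. \<lambda>i\<in>UNIV. f x i) \<in> measurable M gauss_PiM"
    by (rule measurable_restrict) (use assms measurable_cong_sets[OF refl sets_std_gauss] in blast)
  then show ?thesis by (simp only: restrict_UNIV)
qed

lemma gauss_PiM_sum:
  fixes \<sigma> \<tau> :: real
  assumes "0 \<le> \<sigma>" "0 \<le> \<tau>"
  shows "distr (gauss_PiM \<Otimes>\<^sub>M gauss_PiM) gauss_PiM (\<lambda>(f, g). (\<lambda>i::'i::finite. \<sigma> * f i + \<tau> * g i))
    = distr gauss_PiM gauss_PiM (\<lambda>f i. sqrt (\<sigma>\<^sup>2 + \<tau>\<^sup>2) * f i)" (is "?L = ?R")
proof -
  let ?P = "gauss_PiM :: ('i \<Rightarrow> real) measure"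
  let ?r = "sqrt (\<sigma>\<^sup>2 + \<tau>\<^sup>2)"
  interpret G: prob_space std_gauss by (rule prob_space_std_gauss)
  interpret P: prob_space ?P by (rule prob_space_gauss_PiM)
  interpret S: product_sigma_finite "\<lambda>i::'i. std_gauss" ..
  define N where "N = distr std_gauss borel ((*) ?r)"
  interpret N: prob_space N unfolding N_def by (rule G.prob_space_distr) simp
  interpret SN: product_sigma_finite "\<lambda>i::'i. N" ..
  have setsN: "sets (PiM UNIV (\<lambda>i::'i. N)) = sets ?P"
    by (intro sets_PiM_cong) (simp_all add: N_def)
  have ind: "indicator (PiE UNIV A) f = (\<Prod>i\<in>UNIV. indicator (A i) (f i) :: ennreal)" for A and f :: "'i \<Rightarrow> real"
  proof (cases "\<forall>i. f i \<in> A i")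
    case False
    then obtain i where i: "f i \<notin> A i" by blast
    then have "(\<Prod>i\<in>UNIV. indicator (A i) (f i) :: ennreal) = 0"
      by (intro prod_zero bexI[of _ i]) auto
    then show ?thesis using i by (auto simp: indicator_def PiE_iff)
  qed (simp add: PiE_iff)
  have mL: "(\<lambda>(f, g). (\<lambda>i::'i. \<sigma> * f i + \<tau> * g i)) \<in> measurable (?P \<Otimes>\<^sub>M ?P) ?P"
    by (intro measurable_gauss_PiM) (simp add: case_prod_unfold, measurable)
  have mR: "(\<lambda>f (i::'i). ?r * f i) \<in> measurable ?P ?P"
    by (intro measurable_gauss_PiM) measurable
  have mi: "(\<lambda>x. \<integral>\<^sup>+y. indicator X (\<sigma> * x + \<tau> * y) \<partial>std_gauss) \<in> borel_measurable borel"
    if [measurable]: "X \<in> sets borel" for X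
    by (rule G.borel_measurable_nn_integral)
       (subst measurable_cong_sets[OF sets_pair_measure_cong[OF refl sets_std_gauss] refl], measurable)
  have "?L = PiM UNIV (\<lambda>i. N)"
  proof (rule SN.PiM_eqI)
    show "sets ?L = sets (PiM UNIV (\<lambda>i::'i. N))" using setsN by simp
    fix A :: "'i \<Rightarrow> real set" assume "\<And>i. i \<in> UNIV \<Longrightarrow> A i \<in> sets N"
    then have A[measurable]: "A i \<in> sets borel" for i by (simp add: N_def)
    note mi = mi[OF A]
    have mA: "PiE UNIV A \<in> sets ?P" by (rule sets_PiM_I_finite) auto
    then have mI: "(indicator (PiE UNIV A) :: _ \<Rightarrow> ennreal) \<in> borel_measurable ?L"
      unfolding measurable_distr_eq1 by (rule borel_measurable_indicator)
    have "emeasure ?L (PiE UNIV A) = (\<integral>\<^sup>+z. indicator (PiE UNIV A) z \<partial>?L)"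
      using mA by simp
    also have "\<dots> = (\<integral>\<^sup>+p. indicator (PiE UNIV A) (\<lambda>i. \<sigma> * fst p i + \<tau> * snd p i) \<partial>(?P \<Otimes>\<^sub>M ?P))"
      by (subst nn_integral_distr[OF mL mI]) (simp add: case_prod_unfold)
    also have "\<dots> = (\<integral>\<^sup>+p. (\<Prod>i\<in>UNIV. indicator (A i) (\<sigma> * fst p i + \<tau> * snd p i)) \<partial>(?P \<Otimes>\<^sub>M ?P))"
      by (simp only: ind)
    also have "\<dots> = (\<integral>\<^sup>+f. \<integral>\<^sup>+g. (\<Prod>i\<in>UNIV. indicator (A i) (\<sigma> * f i + \<tau> * g i)) \<partial>?P \<partial>?P)"
      by (subst P.nn_integral_fst[symmetric]) auto
    also have "\<dots> = (\<integral>\<^sup>+f. (\<Prod>i\<in>UNIV. \<integral>\<^sup>+y. indicator (A i) (\<sigma> * f i + \<tau> * y) \<partial>std_gauss) \<partial>?P)"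
      by (intro nn_integral_cong S.product_nn_integral_prod) auto
    also have "\<dots> = (\<Prod>i\<in>UNIV. \<integral>\<^sup>+x. \<integral>\<^sup>+y. indicator (A i) (\<sigma> * x + \<tau> * y) \<partial>std_gauss \<partial>std_gauss)"
      by (intro S.product_nn_integral_prod) (simp_all only: measurable_std_gauss mi finite)
    also have "\<dots> = (\<Prod>i\<in>UNIV. \<integral>\<^sup>+x. indicator (A i) (?r * x) \<partial>std_gauss)"
      by (intro prod.cong refl bspec[OF noise_sum_std_gauss[OF assms, unfolded noise_sum_def]]) auto
    also have "\<dots> = (\<Prod>i\<in>UNIV. emeasure N (A i))"
      unfolding N_def by (intro prod.cong refl) (simp add: nn_integral_distr flip: nn_integral_indicator)
    finally show "emeasure ?L (PiE UNIV A) = (\<Prod>i\<in>UNIV. emeasure N (A i))" .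
  qed auto
  moreover have "?R = PiM UNIV (\<lambda>i. N)"
  proof (rule SN.PiM_eqI)
    show "sets ?R = sets (PiM UNIV (\<lambda>i::'i. N))" using setsN by simp
    fix A :: "'i \<Rightarrow> real set" assume "\<And>i. i \<in> UNIV \<Longrightarrow> A i \<in> sets N"
    then have A[measurable]: "A i \<in> sets borel" for i by (simp add: N_def)
    have mA: "PiE UNIV A \<in> sets ?P" by (rule sets_PiM_I_finite) auto
    then have mI: "(indicator (PiE UNIV A) :: _ \<Rightarrow> ennreal) \<in> borel_measurable ?R"
      unfolding measurable_distr_eq1 by (rule borel_measurable_indicator)
    have "emeasure ?R (PiE UNIV A) = (\<integral>\<^sup>+z. indicator (PiE UNIV A) z \<partial>?R)"
      using mA by simp
    also have "\<dots> = (\<integral>\<^sup>+f. (\<Prod>i\<in>UNIV. indicator (A i) (?r * f i)) \<partial>?P)"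
      by (subst nn_integral_distr[OF mR mI]) (simp only: ind)
    also have "\<dots> = (\<Prod>i\<in>UNIV. \<integral>\<^sup>+x. indicator (A i) (?r * x) \<partial>std_gauss)"
      by (intro S.product_nn_integral_prod) auto
    also have "\<dots> = (\<Prod>i\<in>UNIV. emeasure N (A i))"
      unfolding N_def by (intro prod.cong refl) (simp add: nn_integral_distr flip: nn_integral_indicator)
    finally show "emeasure ?R (PiE UNIV A) = (\<Prod>i\<in>UNIV. emeasure N (A i))" .
  qed auto
  ultimately show ?thesis by simp
qed

lemma exp_moments_distr_gauss_PiM:
  fixes V :: "('i::finite \<Rightarrow> real) \<Rightarrow> 'e::euclidean_space"
  assumes V[measurable]: "V \<in> borel_measurable gauss_PiM" and b: "\<And>f. norm (V f) \<le> (\<Sum>i\<in>UNIV. \<bar>f i\<bar>)"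
  shows "exp_moments (distr gauss_PiM borel V)"
proof (rule exp_momentsI)
  interpret P: prob_space "gauss_PiM :: ('i \<Rightarrow> real) measure" by (rule prob_space_gauss_PiM)
  interpret G: prob_space std_gauss by (rule prob_space_std_gauss)
  interpret S: product_sigma_finite "\<lambda>i::'i. std_gauss" ..
  show "prob_space (distr gauss_PiM borel V)" by (rule P.prob_space_distr) measurable
  fix c :: real assume c: "0 \<le> c"
  have "integrable gauss_PiM (\<lambda>f. exp (c * norm (V f)))"
  proof (rule Bochner_Integration.integrable_bound)
    show "integrable gauss_PiM (\<lambda>f. \<Prod>i\<in>(UNIV::'i set). exp (c * \<bar>f i\<bar>))"
      using exp_moments_std_gauss by (intro S.product_integrable_prod) (auto simp: exp_moments_def)
    have "c * norm (V f) \<le> (\<Sum>i\<in>UNIV. c * \<bar>f i\<bar>)" for f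
      using mult_left_mono[OF b c] by (simp add: sum_distrib_left)
    then show "AE f in gauss_PiM. norm (exp (c * norm (V f))) \<le> norm (\<Prod>i\<in>UNIV. exp (c * \<bar>f i\<bar>))"
      by (intro AE_I2) (simp add: exp_sum[symmetric])
  qed measurable
  then show "integrable (distr gauss_PiM borel V) (\<lambda>u. exp (c * norm u))"
    by (subst integrable_distr_eq) auto
qed simp

lemma gauss_PiM_moments:
  fixes i j :: "'i::finite"
  shows "integrable gauss_PiM (\<lambda>f. f i)" "(\<integral>f. f i \<partial>gauss_PiM) = 0"
    "integrable gauss_PiM (\<lambda>f. f i * f j)" "(\<integral>f. f i * f j \<partial>gauss_PiM) = (if i = j then 1 else 0)"
proof -
  interpret G: prob_space std_gauss by (rule prob_space_std_gauss)
  interpret S: product_sigma_finite "\<lambda>i::'i. std_gauss" ..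
  note m = std_gauss_moments
  have one: "integrable std_gauss (\<lambda>x. 1::real)" "(\<integral>x. (1::real) \<partial>std_gauss) = 1"
    "measure std_gauss UNIV = 1"
    using G.prob_space by simp_all
  have e1: "(\<Prod>k\<in>UNIV. (if k = i then f k else 1)) = f i" for f :: "'i \<Rightarrow> real"
    by (simp add: prod.delta)
  have i1: "integrable std_gauss (\<lambda>x. if k = i then x else 1)" for k :: 'i
    by (cases "k = i") (simp_all only: simp_thms if_True if_False m one)
  show "integrable gauss_PiM (\<lambda>f. f i)"
    using S.product_integrable_prod[of UNIV "\<lambda>k x. if k = i then x else 1", OF finite i1] by (simp add: e1)
  have "(\<integral>f. f i \<partial>gauss_PiM) = (\<Prod>k\<in>UNIV. \<integral>x. (if k = i then x else 1) \<partial>std_gauss)"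
    using S.product_integral_prod[of UNIV "\<lambda>k x. if k = i then x else 1", OF finite i1] by (simp add: e1)
  also have "\<dots> = (\<Prod>k\<in>UNIV. if k = i then 0 else 1)"
    by (intro prod.cong) (auto simp: m one)
  also have "\<dots> = 0" by simp
  finally show "(\<integral>f. f i \<partial>gauss_PiM) = 0" .
  have e2: "(\<Prod>k\<in>UNIV. (if k = i then f k else 1) * (if k = j then f k else 1)) = f i * f j" for f :: "'i \<Rightarrow> real"
    by (simp add: prod.distrib)
  have i2: "integrable std_gauss (\<lambda>x. (if k = i then x else 1) * (if k = j then x else 1))" for k :: 'i
    by (cases "k = i"; cases "k = j") (simp_all only: simp_thms if_True if_False mult_1_left mult_1_right m one)
  show "integrable gauss_PiM (\<lambda>f. f i * f j)"
    using S.product_integrable_prod[of UNIV "\<lambda>k x. (if k = i then x else 1) * (if k = j then x else 1)", OF finite i2] by (simp add: e2)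
  have "(\<integral>f. f i * f j \<partial>gauss_PiM) = (\<Prod>k\<in>UNIV. \<integral>x. (if k = i then x else 1) * (if k = j then x else 1) \<partial>std_gauss)"
    using S.product_integral_prod[of UNIV "\<lambda>k x. (if k = i then x else 1) * (if k = j then x else 1)", OF finite i2] by (simp add: e2)
  also have "\<dots> = (\<Prod>k\<in>UNIV. if i = j then 1 else if k = i \<or> k = j then 0 else 1)"
    by (intro prod.cong) (auto simp: m one)
  also have "\<dots> = (if i = j then 1 else 0)" by (auto intro!: prod_zero)
  finally show "(\<integral>f. f i * f j \<partial>gauss_PiM) = (if i = j then 1 else 0)" .
qed

lemma measurable_vec_lambda_PiM [measurable]:
  "(\<lambda>f. \<chi> i. f i) \<in> borel_measurable (gauss_PiM :: ('a::finite \<Rightarrow> real) measure)"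
  by (subst borel_measurable_euclidean_space) (auto simp: Basis_vec_def inner_axis)

lemma measurable_mat_lambda_PiM [measurable]:
  "(\<lambda>f. \<chi> i j. f (i, j)) \<in> borel_measurable (gauss_PiM :: ('a::finite \<times> 'b::finite \<Rightarrow> real) measure)"
  by (subst borel_measurable_euclidean_space) (auto simp: Basis_vec_def inner_axis)

lemma exp_moments_gauss_vec: "exp_moments (gauss_vec :: (real ^ 'a::finite) measure)"
  unfolding gauss_vec_def
  by (rule exp_moments_distr_gauss_PiM[OF measurable_vec_lambda_PiM])
     (rule order_trans[OF norm_le_l1_cart], simp)

lemma exp_moments_gauss_mat: "exp_moments (gauss_mat :: (real ^ 'n::finite ^ 'm::finite) measure)"
  unfolding gauss_mat_def
proof (rule exp_moments_distr_gauss_PiM[OF measurable_mat_lambda_PiM])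
  fix f :: "'m \<times> 'n \<Rightarrow> real"
  have "norm (\<chi> i j. f (i, j)) \<le> (\<Sum>i\<in>UNIV. norm ((\<chi> i j. f (i, j)) $ i :: real ^ 'n))"
    unfolding norm_vec_def by (rule L2_set_le_sum) auto
  also have "\<dots> \<le> (\<Sum>i\<in>UNIV. \<Sum>j\<in>UNIV. \<bar>f (i, j)\<bar>)"
    by (intro sum_mono order_trans[OF norm_le_l1_cart]) auto
  also have "\<dots> = (\<Sum>p\<in>UNIV. \<bar>f p\<bar>)" by (simp add: sum.cartesian_product)
  finally show "norm (\<chi> i j. f (i, j)) \<le> (\<Sum>p\<in>UNIV. \<bar>f p\<bar>)" .
qed

lemma noise_sum_gauss_vec:
  assumes "0 \<le> \<sigma>" "0 \<le> \<tau>"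
  shows "noise_sum (gauss_vec :: (real ^ 'a::finite) measure) ((*\<^sub>R) \<sigma>) ((*\<^sub>R) \<tau>) ((*\<^sub>R) (sqrt (\<sigma>\<^sup>2 + \<tau>\<^sup>2)))"
  unfolding gauss_vec_def
  by (rule noise_sum_map[OF measurable_vec_lambda_PiM prob_space_gauss_PiM gauss_PiM_sum[OF assms]])
     (auto intro!: measurable_gauss_PiM simp: case_prod_unfold vec_eq_iff)

lemma gauss_vec_moments:
  fixes v w :: "real ^ 'a::finite"
  shows "integrable gauss_vec (\<lambda>u. v \<bullet> u)" "(\<integral>u. v \<bullet> u \<partial>gauss_vec) = 0"
    "integrable gauss_vec (\<lambda>u. (v \<bullet> u) * (w \<bullet> u))" "(\<integral>u. (v \<bullet> u) * (w \<bullet> u) \<partial>gauss_vec) = v \<bullet> w"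
proof -
  have e: "(v \<bullet> (\<chi> i. f i)) * (w \<bullet> (\<chi> i. f i)) = (\<Sum>i\<in>UNIV. \<Sum>j\<in>UNIV. (v $ i * w $ j) * (f i * f j))" for f
    by (simp add: inner_vec_def sum_product mult_ac)
  have d: "(\<Sum>j\<in>UNIV. v $ i * w $ j * (if i = j then 1 else 0)) = v $ i * w $ i" for i
    by (simp add: if_distrib cong: if_cong)
  show "integrable gauss_vec (\<lambda>u. v \<bullet> u)" unfolding gauss_vec_def
    by (subst integrable_distr_eq) (auto simp: inner_vec_def gauss_PiM_moments)
  show "(\<integral>u. v \<bullet> u \<partial>gauss_vec) = 0" unfolding gauss_vec_def
    by (subst integral_distr) (auto simp: inner_vec_def gauss_PiM_moments)
  show "integrable gauss_vec (\<lambda>u. (v \<bullet> u) * (w \<bullet> u))" unfolding gauss_vec_def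
    by (subst integrable_distr_eq) (auto simp: e gauss_PiM_moments)
  have "(\<integral>f. (v \<bullet> (\<chi> i. f i)) * (w \<bullet> (\<chi> i. f i)) \<partial>gauss_PiM) = v \<bullet> w"
    unfolding e by (simp add: gauss_PiM_moments d) (simp add: inner_vec_def)
  then show "(\<integral>u. (v \<bullet> u) * (w \<bullet> u) \<partial>gauss_vec) = v \<bullet> w" unfolding gauss_vec_def
    by (subst integral_distr) simp_all
qed

section \<open>The interpolating interp_field and its partition sum\<close>

lemma exp_moments_gauss_level: "exp_moments (gauss_level :: ('n::finite, 'm::finite) level measure)"
  unfolding gauss_level_def
  by (intro exp_moments_pair exp_moments_std_gauss exp_moments_gauss_vec)

type_synonym ('n, 'm) state = "(real ^ 'n ^ 'm) \<times> ('n, 'm) level"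

definition level_noise :: "real \<times> real \<times> real \<Rightarrow> ('n::finite, 'm::finite) level \<Rightarrow> ('n, 'm) state" where
  "level_noise \<sigma> u = (0, fst \<sigma> * fst u, fst (snd \<sigma>) *\<^sub>R fst (snd u), snd (snd \<sigma>) *\<^sub>R snd (snd u))"

lemma continuous_on_level_noise: "continuous_on UNIV (level_noise \<sigma>)"
  unfolding level_noise_def[abs_def] by (intro continuous_intros)

lemma noise_map_level_noise:
  assumes "\<bar>a\<bar> \<le> 1" "\<bar>b\<bar> \<le> 1" "\<bar>c\<bar> \<le> 1"
  shows "noise_map 1 (level_noise (a, b, c) :: ('n::finite, 'm::finite) level \<Rightarrow> _)"
proof -
  have "norm (level_noise (a, b, c) u) \<le> norm u" for u :: "('n, 'm) level"
  proof -
    obtain u1 u2 u3 where u: "u = (u1, u2, u3)" by (cases u)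
    have 1: "\<bar>k\<bar> * z \<le> z" if "\<bar>k\<bar> \<le> 1" "0 \<le> z" for k z :: real
      using mult_right_mono[OF that] by simp
    have "norm (level_noise (a, b, c) u) = sqrt ((\<bar>a\<bar> * \<bar>u1\<bar>)\<^sup>2 + ((\<bar>b\<bar> * norm u2)\<^sup>2 + (\<bar>c\<bar> * norm u3)\<^sup>2))"
      by (simp add: u level_noise_def norm_Pair abs_mult power_mult_distrib)
    also have "\<dots> \<le> sqrt (\<bar>u1\<bar>\<^sup>2 + ((norm u2)\<^sup>2 + (norm u3)\<^sup>2))"
      by (intro real_sqrt_le_mono add_mono power_mono 1 assms) auto
    also have "\<dots> = norm u" by (simp add: u norm_Pair)
    finally show ?thesis .
  qed
  then show ?thesis by (simp add: noise_map_def continuous_on_level_noise)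
qed

lemma noise_sum_lift:
  fixes V :: "'s::euclidean_space \<Rightarrow> 't::euclidean_space"
  assumes s: "noise_sum M A1 A2 A3" and V[measurable]: "V \<in> borel_measurable borel"
    and add: "\<And>x y. V (x + y) = V x + V y"
  shows "noise_sum M (\<lambda>u. V (A1 u)) (\<lambda>u. V (A2 u)) (\<lambda>u. V (A3 u))"
  unfolding noise_sum_def
proof
  fix f :: "'t \<Rightarrow> ennreal" assume [measurable]: "f \<in> borel_measurable borel"
  show "(\<integral>\<^sup>+x. \<integral>\<^sup>+x'. f (V (A1 x) + V (A2 x')) \<partial>M \<partial>M) = (\<integral>\<^sup>+x. f (V (A3 x)) \<partial>M)"
    unfolding add[symmetric]
    by (rule bspec[OF s[unfolded noise_sum_def], of "\<lambda>z. f (V z)"]) measurable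
qed

lemma level_noise_distr:
  fixes a b c a' b' c' :: real
  assumes nn: "0 \<le> a" "0 \<le> b" "0 \<le> c" "0 \<le> a'" "0 \<le> b'" "0 \<le> c'"
  shows "distr (gauss_level \<Otimes>\<^sub>M gauss_level) borel (\<lambda>(u, u'). level_noise (a, b, c) u + level_noise (a', b', c') u')
    = distr gauss_level borel
       (level_noise (sqrt (a\<^sup>2 + a'\<^sup>2), sqrt (b\<^sup>2 + b'\<^sup>2), sqrt (c\<^sup>2 + c'\<^sup>2)) :: ('n::finite, 'm::finite) level \<Rightarrow> _)"
proof (rule noise_sum_distr)
  note vM = exp_moments_prob_space[OF exp_moments_gauss_vec]
  note lM = exp_moments_prob_space[OF exp_moments_gauss_level]
  have mv: "(*\<^sub>R) k \<in> borel_measurable gauss_vec" for k :: real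
    by (rule exp_moments_borel[OF exp_moments_gauss_vec]) measurable
  have ms: "(*) k \<in> borel_measurable std_gauss" for k :: real by simp
  let ?S2 = "\<lambda>b c (y :: real ^ 'm, z :: real ^ 'n). (b *\<^sub>R y, c *\<^sub>R z)"
  let ?S = "\<lambda>a b c (x :: real, p). (a * x, ?S2 b c p)"
  note ev2 = exp_moments_pair[OF exp_moments_gauss_vec exp_moments_gauss_vec]
  have m2: "?S2 b c \<in> borel_measurable (gauss_vec \<Otimes>\<^sub>M gauss_vec)" for b c
    by (intro exp_moments_continuous[OF ev2]) (auto simp: case_prod_unfold intro!: continuous_intros)
  have s: "noise_sum gauss_level (?S a b c) (?S a' b' c') (?S (sqrt (a\<^sup>2 + a'\<^sup>2)) (sqrt (b\<^sup>2 + b'\<^sup>2)) (sqrt (c\<^sup>2 + c'\<^sup>2)))"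
    unfolding gauss_level_def
    by (intro noise_sum_pair noise_sum_std_gauss noise_sum_gauss_vec prob_space_std_gauss
        exp_moments_prob_space[OF ev2] vM mv ms m2 nn)
  have "noise_sum gauss_level (\<lambda>u. (0 :: real ^ 'n ^ 'm, ?S a b c u)) (\<lambda>u. (0, ?S a' b' c' u))
      (\<lambda>u. (0, ?S (sqrt (a\<^sup>2 + a'\<^sup>2)) (sqrt (b\<^sup>2 + b'\<^sup>2)) (sqrt (c\<^sup>2 + c'\<^sup>2)) u))"
    by (rule noise_sum_lift[OF s]) (auto intro!: borel_measurable_continuous_onI continuous_intros)
  then show "noise_sum gauss_level (level_noise (a, b, c)) (level_noise (a', b', c'))
      (level_noise (sqrt (a\<^sup>2 + a'\<^sup>2), sqrt (b\<^sup>2 + b'\<^sup>2), sqrt (c\<^sup>2 + c'\<^sup>2)) :: ('n, 'm) level \<Rightarrow> _)"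
    by (simp add: level_noise_def[abs_def] case_prod_unfold)
  show "prob_space (gauss_level :: ('n, 'm) level measure)" by (rule lM)
qed (intro exp_moments_continuous[OF exp_moments_gauss_level] continuous_on_level_noise)+

definition interp_field ::
    "(nat \<Rightarrow> real ^ 'n::finite) \<Rightarrow> (nat \<Rightarrow> real ^ 'm::finite) \<Rightarrow> real \<Rightarrow> nat \<times> nat \<Rightarrow> ('n, 'm) state \<Rightarrow> real" where
  "interp_field x y t j w =
     sqrt t * (y (snd j) \<bullet> (fst w *v x (fst j)))
   + sqrt (1 - t) * norm (x (fst j)) * (y (snd j) \<bullet> fst (snd (snd w)))
   + sqrt t * norm (x (fst j)) * norm (y (snd j)) * fst (snd w)
   + sqrt (1 - t) * norm (y (snd j)) * (snd (snd (snd w)) \<bullet> x (fst j))"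

lemma linear_field: "linear (interp_field x y t j)"
  by (rule linearI)
     (simp_all add: interp_field_def matrix_vector_mult_add_rdistrib inner_add_right inner_add_left
       scaleR_matrix_vector_assoc[symmetric] algebra_simps)

lemma bounded_linear_field: "bounded_linear (interp_field x y t j)"
  using linear_field by (simp add: linear_conv_bounded_linear)

lemma gauss_level_linear_moments:
  fixes v v' :: "real ^ 'm::finite" and w w' :: "real ^ 'n::finite" and k k' :: real
  defines "f \<equiv> \<lambda>k v w (u :: ('n, 'm) level). k * fst u + (v \<bullet> fst (snd u) + w \<bullet> snd (snd u))"
  shows "(\<integral>u. f k v w u \<partial>gauss_level) = 0"
    and "(\<integral>u. f k v w u * f k' v' w' u \<partial>gauss_level) = k * k' + (v \<bullet> v' + w \<bullet> w')"
proof -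
  note vM = exp_moments_prob_space[OF exp_moments_gauss_vec]
  note v2M = exp_moments_prob_space[OF exp_moments_pair[OF exp_moments_gauss_vec exp_moments_gauss_vec]]
  note gM = prob_space_std_gauss
  note m = gauss_vec_moments std_gauss_moments
  let ?g = "\<lambda>v w (y :: real ^ 'm, z :: real ^ 'n). v \<bullet> y + w \<bullet> z"
  have g: "integrable (gauss_vec \<Otimes>\<^sub>M gauss_vec) (?g v w)" "(\<integral>p. ?g v w p \<partial>(gauss_vec \<Otimes>\<^sub>M gauss_vec)) = 0"
    "integrable (gauss_vec \<Otimes>\<^sub>M gauss_vec) (\<lambda>p. ?g v w p * ?g v' w' p)"
    "(\<integral>p. ?g v w p * ?g v' w' p \<partial>(gauss_vec \<Otimes>\<^sub>M gauss_vec)) = v \<bullet> v' + w \<bullet> w'" for v w v' w'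
    using integrable_pair_add[OF vM vM m(1)[of v] m(1)[of w]] integral_pair_add[OF vM vM m(1)[of v] m(1)[of w]]
      integral_pair_centered[OF vM vM m(1)[of v] m(1)[of v'] m(3)[of v v'] m(2)[of v] m(2)[of v']
        m(1)[of w] m(1)[of w'] m(3)[of w w'] m(2)[of w] m(2)[of w']]
    by (simp_all add: m case_prod_unfold)
  have s: "integrable std_gauss (\<lambda>x. k * x)" "(\<integral>x. k * x \<partial>std_gauss) = 0"
    "integrable std_gauss (\<lambda>x. (k * x) * (k' * x))" "(\<integral>x. (k * x) * (k' * x) \<partial>std_gauss) = k * k'" for k k'
  proof -
    have e: "(k * x) * (k' * x) = (k * k') * (x * x)" for x by (simp add: mult_ac)
    show "integrable std_gauss (\<lambda>x. k * x)" "(\<integral>x. k * x \<partial>std_gauss) = 0"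
      "integrable std_gauss (\<lambda>x. (k * x) * (k' * x))" "(\<integral>x. (k * x) * (k' * x) \<partial>std_gauss) = k * k'"
      unfolding e using std_gauss_moments by simp_all
  qed
  show "(\<integral>u. f k v w u \<partial>gauss_level) = 0"
    using integral_pair_add[OF gM v2M s(1)[of k] g(1)[of v w]]
    by (simp only: f_def gauss_level_def case_prod_unfold s(2) g(2)[unfolded case_prod_unfold])
  show "(\<integral>u. f k v w u * f k' v' w' u \<partial>gauss_level) = k * k' + (v \<bullet> v' + w \<bullet> w')"
    using integral_pair_centered(2)[OF gM v2M s(1)[of k] s(1)[of k'] s(3)[of k k'] s(2)[of k] s(2)[of k']
        g(1)[of v w] g(1)[of v' w'] g(3)[of v w v' w'] g(2)[of v w] g(2)[of v' w']]
    by (simp only: f_def gauss_level_def case_prod_unfold s(4) g(4)[unfolded case_prod_unfold])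
qed

lemma
  fixes x :: "nat \<Rightarrow> real ^ 'n::finite" and y :: "nat \<Rightarrow> real ^ 'm::finite"
  assumes t: "0 \<le> t" "t \<le> 1"
  shows field_noise_mean: "(\<integral>u. interp_field x y t j (level_noise (a, b, c) u) \<partial>gauss_level) = 0"
    and field_noise_cov: "noise_cov gauss_level (interp_field x y t) (level_noise (a, b, c)) i j =
      (1 - t) * b\<^sup>2 * (norm (x (fst i)) * norm (x (fst j)) * (y (snd j) \<bullet> y (snd i)))
      + (1 - t) * c\<^sup>2 * (norm (y (snd i)) * norm (y (snd j)) * (x (fst i) \<bullet> x (fst j)))
      + t * a\<^sup>2 * (norm (x (fst i)) * norm (x (fst j)) * norm (y (snd i)) * norm (y (snd j)))"
proof -
  define k where "k j = sqrt t * norm (x (fst j)) * norm (y (snd j)) * a" for j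
  define v where "v j = (sqrt (1 - t) * norm (x (fst j)) * b) *\<^sub>R y (snd j)" for j
  define w where "w j = (sqrt (1 - t) * norm (y (snd j)) * c) *\<^sub>R x (fst j)" for j
  have e: "interp_field x y t j (level_noise (a, b, c) u) = k j * fst u + (v j \<bullet> fst (snd u) + w j \<bullet> snd (snd u))" for j u
    by (simp add: interp_field_def level_noise_def k_def v_def w_def inner_commute algebra_simps)
  show "(\<integral>u. interp_field x y t j (level_noise (a, b, c) u) \<partial>gauss_level) = 0"
    unfolding e by (rule gauss_level_linear_moments)
  have kk: "k i * k j = t * a\<^sup>2 * (norm (x (fst i)) * norm (x (fst j)) * norm (y (snd i)) * norm (y (snd j)))"
  proof -
    have "k i * k j = (sqrt t * sqrt t) * a\<^sup>2 * (norm (x (fst i)) * norm (x (fst j)) * norm (y (snd i)) * norm (y (snd j)))"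
      unfolding k_def by (simp only: power2_eq_square mult_ac)
    then show ?thesis using t by simp
  qed
  have vv: "v i \<bullet> v j = (1 - t) * b\<^sup>2 * (norm (x (fst i)) * norm (x (fst j)) * (y (snd j) \<bullet> y (snd i)))"
  proof -
    have "v i \<bullet> v j = (sqrt (1 - t) * sqrt (1 - t)) * b\<^sup>2 * (norm (x (fst i)) * norm (x (fst j)) * (y (snd j) \<bullet> y (snd i)))"
      unfolding v_def inner_scaleR_left inner_scaleR_right inner_commute[of "y (snd j)"] by (simp only: power2_eq_square mult_ac)
    then show ?thesis using t by simp
  qed
  have ww: "w i \<bullet> w j = (1 - t) * c\<^sup>2 * (norm (y (snd i)) * norm (y (snd j)) * (x (fst i) \<bullet> x (fst j)))"
  proof -
    have "w i \<bullet> w j = (sqrt (1 - t) * sqrt (1 - t)) * c\<^sup>2 * (norm (y (snd i)) * norm (y (snd j)) * (x (fst i) \<bullet> x (fst j)))"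
      unfolding w_def inner_scaleR_left inner_scaleR_right by (simp only: power2_eq_square mult_ac)
    then show ?thesis using t by simp
  qed
  show "noise_cov gauss_level (interp_field x y t) (level_noise (a, b, c)) i j =
      (1 - t) * b\<^sup>2 * (norm (x (fst i)) * norm (x (fst j)) * (y (snd j) \<bullet> y (snd i)))
      + (1 - t) * c\<^sup>2 * (norm (y (snd i)) * norm (y (snd j)) * (x (fst i) \<bullet> x (fst j)))
      + t * a\<^sup>2 * (norm (x (fst i)) * norm (x (fst j)) * norm (y (snd i)) * norm (y (snd j)))"
    unfolding noise_cov_def e gauss_level_linear_moments(2) kk vv ww by simp
qed

text \<open>Up to an additive constant, \<open>ln (\<Sum>i\<in>S. exp (m * f i))\<close> is \<open>m\<close> times the free energy of the uniform
  distribution on \<open>S\<close>, so the partition sum is handled by the same estimate as the Gaussian levels.\<close>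

lemma ln_sum_exp_diff:
  fixes f f' :: "'i \<Rightarrow> real"
  assumes S: "finite S" "S \<noteq> {}" and m: "m \<noteq> 0" and c: "0 \<le> c" and d: "\<And>i. i \<in> S \<Longrightarrow> \<bar>f' i - f i\<bar> \<le> c"
  shows "\<bar>ln (\<Sum>i\<in>S. exp (m * f' i)) - ln (\<Sum>i\<in>S. exp (m * f i))
      - m * ((\<Sum>i\<in>S. exp (m * f i) * (f' i - f i)) / (\<Sum>i\<in>S. exp (m * f i)))\<bar> \<le> m\<^sup>2 * c\<^sup>2 / 2"
    and "\<bar>ln (\<Sum>i\<in>S. exp (m * f' i)) - ln (\<Sum>i\<in>S. exp (m * f i))\<bar> \<le> \<bar>m\<bar> * c"
proof -
  let ?M = "measure_pmf (pmf_of_set S)"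
  define g where "g i = (if i \<in> S then f i else 0)" for i
  define g' where "g' i = (if i \<in> S then f' i else 0)" for i
  have pos: "0 < (\<Sum>i\<in>S. exp (m * h i))" for h :: "'i \<Rightarrow> real" using S by (intro sum_pos) auto
  have int: "(\<integral>i. h i \<partial>?M) = sum h S / card S" for h :: "'i \<Rightarrow> real" by (rule integral_pmf_of_set) (use S in auto)
  have cS: "0 < real (card S)" using S by (simp add: card_gt_0_iff)
  have fe: "m * free_energy ?M m h = ln (\<Sum>i\<in>S. exp (m * h i)) - ln (card S)" for h
    using m pos[of h] cS by (simp add: free_energy_def int ln_div)
  have tm: "tilted_mean ?M m h k = (\<Sum>i\<in>S. exp (m * h i) * k i) / (\<Sum>i\<in>S. exp (m * h i))" for h k
    using cS by (simp add: tilted_mean_def int)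
  have eg: "exp_integrable ?M g"
    by (rule exp_integrable_bounded[OF measure_pmf.prob_space_axioms, where R = "\<Sum>i\<in>S. \<bar>f i\<bar>"])
       (use S in \<open>auto simp: g_def intro!: member_le_sum sum_nonneg\<close>)
  have dg: "\<bar>g' i - g i\<bar> \<le> c" for i using d c by (auto simp: g_def g'_def)
  have sg: "(\<Sum>i\<in>S. exp (m * g i)) = (\<Sum>i\<in>S. exp (m * f i))" "(\<Sum>i\<in>S. exp (m * g' i)) = (\<Sum>i\<in>S. exp (m * f' i))"
    "(\<Sum>i\<in>S. exp (m * g i) * (g' i - g i)) = (\<Sum>i\<in>S. exp (m * f i) * (f' i - f i))"
    by (auto simp: g_def g'_def intro!: sum.cong)
  have "\<bar>free_energy ?M m g' - free_energy ?M m g - tilted_mean ?M m g (\<lambda>u. g' u - g u)\<bar> \<le> \<bar>m\<bar> * c\<^sup>2 / 2"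
    by (rule measure_pmf.free_energy_diff[OF eg _ dg]) simp
  then have "\<bar>m\<bar> * \<bar>free_energy ?M m g' - free_energy ?M m g - tilted_mean ?M m g (\<lambda>u. g' u - g u)\<bar> \<le> \<bar>m\<bar> * (\<bar>m\<bar> * c\<^sup>2 / 2)"
    by (intro mult_left_mono) auto
  then have "\<bar>m * free_energy ?M m g' - m * free_energy ?M m g - m * tilted_mean ?M m g (\<lambda>u. g' u - g u)\<bar> \<le> m\<^sup>2 * c\<^sup>2 / 2"
    by (simp add: abs_mult[symmetric] right_diff_distrib power2_eq_square mult.assoc[symmetric])
  then show "\<bar>ln (\<Sum>i\<in>S. exp (m * f' i)) - ln (\<Sum>i\<in>S. exp (m * f i))
      - m * ((\<Sum>i\<in>S. exp (m * f i) * (f' i - f i)) / (\<Sum>i\<in>S. exp (m * f i)))\<bar> \<le> m\<^sup>2 * c\<^sup>2 / 2"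
    unfolding fe tm sg by simp
  have "\<bar>free_energy ?M m g' - free_energy ?M m g\<bar> \<le> c"
    by (rule measure_pmf.free_energy_nonexpansive[OF eg _ dg]) simp
  then have "\<bar>m\<bar> * \<bar>free_energy ?M m g' - free_energy ?M m g\<bar> \<le> \<bar>m\<bar> * c"
    by (intro mult_left_mono) auto
  then have "\<bar>m * free_energy ?M m g' - m * free_energy ?M m g\<bar> \<le> \<bar>m\<bar> * c"
    by (simp add: abs_mult[symmetric] right_diff_distrib)
  then show "\<bar>ln (\<Sum>i\<in>S. exp (m * f' i)) - ln (\<Sum>i\<in>S. exp (m * f i))\<bar> \<le> \<bar>m\<bar> * c"
    unfolding fe sg by simp
qed

definition cluster_sum ::
    "nat \<Rightarrow> (nat \<Rightarrow> real ^ 'n::finite) \<Rightarrow> (nat \<Rightarrow> real ^ 'm::finite) \<Rightarrow> real \<Rightarrow> real \<Rightarrow> nat \<Rightarrow> ('n, 'm) state \<Rightarrow> real" where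
  "cluster_sum l x y \<beta> t i w = (\<Sum>k=1..l. exp (\<beta> * interp_field x y t (i, k) w))"

definition partition_sum ::
    "nat \<Rightarrow> (nat \<Rightarrow> real ^ 'n::finite) \<Rightarrow> (nat \<Rightarrow> real ^ 'm::finite) \<Rightarrow> real \<Rightarrow> real \<Rightarrow> real \<Rightarrow> ('n, 'm) state \<Rightarrow> real" where
  "partition_sum l x y \<beta> s t w = (\<Sum>i=1..l. cluster_sum l x y \<beta> t i w powr s)"

definition gibbs_weight ::
    "nat \<Rightarrow> (nat \<Rightarrow> real ^ 'n::finite) \<Rightarrow> (nat \<Rightarrow> real ^ 'm::finite) \<Rightarrow> real \<Rightarrow> real \<Rightarrow> real \<Rightarrow>
      nat \<times> nat \<Rightarrow> ('n, 'm) state \<Rightarrow> real" where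
  "gibbs_weight l x y \<beta> s t j w = cluster_sum l x y \<beta> t (fst j) w powr s / partition_sum l x y \<beta> s t w
     * (exp (\<beta> * interp_field x y t j w) / cluster_sum l x y \<beta> t (fst j) w)"

lemma cluster_sum_pos: "1 \<le> l \<Longrightarrow> 0 < cluster_sum l x y \<beta> t i w"
  unfolding cluster_sum_def by (intro sum_pos) auto

lemma partition_sum_pos:
  assumes "1 \<le> l"
  shows "0 < partition_sum l x y \<beta> s t w"
  unfolding partition_sum_def
  using cluster_sum_pos[OF assms, of x y \<beta> t _ w] assms by (intro sum_pos) (auto simp: less_imp_neq[THEN not_sym])

lemma gibbs_weight_bounds:
  assumes l: "1 \<le> l" and j: "j \<in> {1..l} \<times> {1..l}"
  shows "\<bar>gibbs_weight l x y \<beta> s t j w\<bar> \<le> 1"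
proof -
  note C = cluster_sum_pos[OF l, of x y \<beta> t _ w] and Z = partition_sum_pos[OF l, of x y \<beta> s t w]
  have "cluster_sum l x y \<beta> t (fst j) w powr s \<le> partition_sum l x y \<beta> s t w"
    unfolding partition_sum_def using j by (intro member_le_sum) auto
  then have 1: "cluster_sum l x y \<beta> t (fst j) w powr s / partition_sum l x y \<beta> s t w \<le> 1" using Z by simp
  have "exp (\<beta> * interp_field x y t (fst j, snd j) w) \<le> cluster_sum l x y \<beta> t (fst j) w"
    unfolding cluster_sum_def using j by (intro member_le_sum[where f = "\<lambda>k. exp (\<beta> * interp_field x y t (fst j, k) w)"]) auto
  then have 2: "exp (\<beta> * interp_field x y t j w) / cluster_sum l x y \<beta> t (fst j) w \<le> 1" using C by simp
  have "0 \<le> gibbs_weight l x y \<beta> s t j w" unfolding gibbs_weight_def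
    using C[of "fst j"] Z by (intro mult_nonneg_nonneg divide_nonneg_pos) auto
  moreover have "gibbs_weight l x y \<beta> s t j w \<le> 1 * 1"
    unfolding gibbs_weight_def using C[of "fst j"] Z by (intro mult_mono 1 2 divide_nonneg_pos) auto
  ultimately show ?thesis by simp
qed

lemma continuous_on_gibbs_weight:
  assumes l: "1 \<le> l"
  shows "continuous_on UNIV (gibbs_weight l x y \<beta> s t j)"
proof -
  have f: "continuous_on UNIV (interp_field x y t j)" for j
    by (rule linear_continuous_on[OF bounded_linear_field])
  have C: "continuous_on UNIV (cluster_sum l x y \<beta> t i)" for i
    unfolding cluster_sum_def[abs_def] by (intro continuous_intros f)
  have Cn: "cluster_sum l x y \<beta> t i w \<noteq> 0" "partition_sum l x y \<beta> s t w \<noteq> 0" for i w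
    using cluster_sum_pos[OF l, of x y \<beta> t i w] partition_sum_pos[OF l, of x y \<beta> s t w] by auto
  have Z: "continuous_on UNIV (partition_sum l x y \<beta> s t)"
    unfolding partition_sum_def[abs_def] using Cn by (intro continuous_intros C) auto
  show ?thesis
    unfolding gibbs_weight_def[abs_def] using Cn by (intro continuous_intros C Z f) auto
qed

lemma log_partition_first_order:
  fixes x :: "nat \<Rightarrow> real ^ 'n::finite" and y :: "nat \<Rightarrow> real ^ 'm::finite" and \<beta> s t :: real
  assumes l: "1 \<le> l" and \<beta>: "0 < \<beta>" and s: "s \<noteq> 0"
  defines "F \<equiv> \<lambda>w. ln (partition_sum l x y \<beta> s t w)" and "J \<equiv> {1..l} \<times> {1..l}"
  obtains B K where "B-lipschitz_on UNIV F" "0 \<le> K"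
    "first_order J (\<lambda>j w. s * \<beta> * interp_field x y t j w) K F (gibbs_weight l x y \<beta> s t)"
proof -
  define d where "d = (\<Sum>j\<in>J. onorm (interp_field x y t j))"
  have onn: "0 \<le> onorm (interp_field x y t j)" for j by (rule onorm_pos_le[OF bounded_linear_field])
  have d: "0 \<le> d" unfolding d_def by (intro sum_nonneg onn)
  have fb: "\<bar>interp_field x y t j h\<bar> \<le> d * norm h" if "j \<in> J" for j h
  proof -
    have "\<bar>interp_field x y t j h\<bar> \<le> onorm (interp_field x y t j) * norm h"
      using onorm[OF bounded_linear_field, of x y t j h] by simp
    also have "\<dots> \<le> d * norm h"
      unfolding d_def by (intro mult_right_mono member_le_sum onn that) (auto simp: J_def)
    finally show ?thesis .
  qed
  define L where "L i w = ln (cluster_sum l x y \<beta> t i w)" for i w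
  have ne: "{1..l} \<noteq> {}" using l by auto
  have expL: "exp (s * L i w) = cluster_sum l x y \<beta> t i w powr s" for i w
    using cluster_sum_pos[OF l, of x y \<beta> t i w] by (simp add: L_def powr_def)
  have F: "F w = ln (\<Sum>i=1..l. exp (s * L i w))" for w
    unfolding F_def partition_sum_def expL ..
  have add: "interp_field x y t j (w + h) - interp_field x y t j w = interp_field x y t j h" for j w h
    using linear_add[OF linear_field, of x y t j w h] by simp
  define e where "e h = d * norm h" for h :: "('n, 'm) state"
  have e: "0 \<le> e h" for h using d by (simp add: e_def)
  define a where "a i w h = (\<Sum>k=1..l. exp (\<beta> * interp_field x y t (i, k) w) * (\<beta> * interp_field x y t (i, k) h)) / cluster_sum l x y \<beta> t i w" for i w h
  have L1: "\<bar>L i (w + h) - L i w - a i w h\<bar> \<le> (\<beta> * e h)\<^sup>2 / 2" and L2: "\<bar>L i (w + h) - L i w\<bar> \<le> \<beta> * e h"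
    if i: "i \<in> {1..l}" for i w h
  proof -
    have *: "\<bar>\<beta> * interp_field x y t (i, k) (w + h) - \<beta> * interp_field x y t (i, k) w\<bar> \<le> \<beta> * e h" if "k \<in> {1..l}" for k
      unfolding right_diff_distrib[symmetric] add abs_mult e_def
      using \<beta> fb[of "(i, k)" h] that i by (auto simp: J_def)
    have be: "0 \<le> \<beta> * e h" using \<beta> e by simp
    from ln_sum_exp_diff[OF _ ne _ be *, of 1] show "\<bar>L i (w + h) - L i w - a i w h\<bar> \<le> (\<beta> * e h)\<^sup>2 / 2"
      "\<bar>L i (w + h) - L i w\<bar> \<le> \<beta> * e h"
      by (simp_all add: L_def cluster_sum_def a_def right_diff_distrib[symmetric] add)
  qed
  define Z where "Z = partition_sum l x y \<beta> s t"
  have Zpos: "0 < Z w" for w unfolding Z_def by (rule partition_sum_pos[OF l])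
  have Zsum: "(\<Sum>i=1..l. cluster_sum l x y \<beta> t i w powr s) = Z w" for w by (simp add: Z_def partition_sum_def)
  have F1: "\<bar>F (w + h) - F w - s * ((\<Sum>i=1..l. cluster_sum l x y \<beta> t i w powr s * (L i (w + h) - L i w)) / Z w)\<bar>
      \<le> s\<^sup>2 * (\<beta> * e h)\<^sup>2 / 2"
    and F2: "\<bar>F (w + h) - F w\<bar> \<le> \<bar>s\<bar> * (\<beta> * e h)" for w h
    using ln_sum_exp_diff[where f = "\<lambda>i. L i w" and f' = "\<lambda>i. L i (w + h)" and c = "\<beta> * e h", OF _ ne s _ L2] \<beta> e[of h]
    unfolding F expL Zsum by (simp_all add: mult.assoc)
  have F3: "\<bar>s * ((\<Sum>i=1..l. cluster_sum l x y \<beta> t i w powr s * (L i (w + h) - L i w)) / Z w)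
      - s * ((\<Sum>i=1..l. cluster_sum l x y \<beta> t i w powr s * a i w h) / Z w)\<bar> \<le> \<bar>s\<bar> * ((\<beta> * e h)\<^sup>2 / 2)" for w h
  proof -
    have "\<bar>(\<Sum>i=1..l. cluster_sum l x y \<beta> t i w powr s * (L i (w + h) - L i w)) - (\<Sum>i=1..l. cluster_sum l x y \<beta> t i w powr s * a i w h)\<bar>
        \<le> (\<Sum>i=1..l. \<bar>cluster_sum l x y \<beta> t i w powr s * (L i (w + h) - L i w - a i w h)\<bar>)"
      unfolding sum_subtractf[symmetric] right_diff_distrib[symmetric] by (rule sum_abs)
    also have "\<dots> \<le> (\<Sum>i=1..l. cluster_sum l x y \<beta> t i w powr s * ((\<beta> * e h)\<^sup>2 / 2))"
      unfolding abs_mult by (intro sum_mono mult_mono L1) auto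
    also have "\<dots> = Z w * ((\<beta> * e h)\<^sup>2 / 2)" unfolding Zsum[symmetric] sum_distrib_right ..
    finally have "\<bar>(\<Sum>i=1..l. cluster_sum l x y \<beta> t i w powr s * (L i (w + h) - L i w)) / Z w - (\<Sum>i=1..l. cluster_sum l x y \<beta> t i w powr s * a i w h) / Z w\<bar>
        \<le> (\<beta> * e h)\<^sup>2 / 2"
      unfolding diff_divide_distrib[symmetric] abs_divide using Zpos[of w] by (simp add: pos_divide_le_eq mult.commute)
    then show ?thesis unfolding right_diff_distrib[symmetric] abs_mult by (intro mult_left_mono) auto
  qed
  have eqG: "s * ((\<Sum>i=1..l. cluster_sum l x y \<beta> t i w powr s * a i w h) / Z w)
      = (\<Sum>j\<in>J. gibbs_weight l x y \<beta> s t j w * (s * \<beta> * interp_field x y t j h))" for w h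
  proof -
    have "(\<Sum>j\<in>J. gibbs_weight l x y \<beta> s t j w * (s * \<beta> * interp_field x y t j h))
      = (\<Sum>i=1..l. \<Sum>k=1..l. gibbs_weight l x y \<beta> s t (i, k) w * (s * \<beta> * interp_field x y t (i, k) h))"
      unfolding J_def by (simp add: sum.cartesian_product case_prod_unfold)
    also have "\<dots> = s * ((\<Sum>i=1..l. cluster_sum l x y \<beta> t i w powr s * a i w h) / Z w)"
      by (simp add: a_def gibbs_weight_def Z_def sum_distrib_left sum_divide_distrib mult_ac)
    finally show ?thesis ..
  qed
  define K where "K = (s\<^sup>2 * (\<beta> * d)\<^sup>2 + \<bar>s\<bar> * (\<beta> * d)\<^sup>2) / 2"
  show thesis
  proof (rule that[of "\<bar>s\<bar> * (\<beta> * d)" K])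
    show "0 \<le> K" by (simp add: K_def)
    show "(\<bar>s\<bar> * (\<beta> * d))-lipschitz_on UNIV F"
    proof (rule lipschitz_onI)
      fix u v :: "('n, 'm) state"
      show "dist (F u) (F v) \<le> \<bar>s\<bar> * (\<beta> * d) * dist u v"
        using F2[of v "u - v"] by (simp add: dist_real_def dist_norm e_def mult.assoc)
    qed (use \<beta> d in simp)
    show "first_order J (\<lambda>j w. s * \<beta> * interp_field x y t j w) K F (gibbs_weight l x y \<beta> s t)"
      unfolding first_order_def
    proof (intro conjI allI ballI)
      fix w h
      have tri: "\<bar>p - r\<bar> \<le> a + b" if "\<bar>p - q\<bar> \<le> a" "\<bar>q - r\<bar> \<le> b" for p q r a b :: real
        using that by linarith
      have "K * norm h ^ 2 = s\<^sup>2 * (\<beta> * e h)\<^sup>2 / 2 + \<bar>s\<bar> * ((\<beta> * e h)\<^sup>2 / 2)"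
        by (simp add: K_def e_def power_mult_distrib field_simps)
      then show "\<bar>F (w + h) - F w - (\<Sum>j\<in>J. gibbs_weight l x y \<beta> s t j w * (s * \<beta> * interp_field x y t j h))\<bar> \<le> K * norm h ^ 2"
        using tri[OF F1[of w h] F3[of w h, unfolded eqG]] by simp
    next
      fix j assume "j \<in> J"
      then show "continuous_on UNIV (gibbs_weight l x y \<beta> s t j)" "\<bar>gibbs_weight l x y \<beta> s t j w\<bar> \<le> 1" for w
        unfolding J_def by (intro continuous_on_gibbs_weight[OF l] gibbs_weight_bounds[OF l])+
    qed
  qed
qed

section \<open>The recursion as a noise tower\<close>

text \<open>Nothing is assumed about \<open>p\<close> and \<open>q\<close> beyond \<open>r + 1\<close>; cutting off there makes every level satisfy the same
  noise bound.\<close>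

definition level_scale :: "nat \<Rightarrow> (nat \<Rightarrow> real) \<Rightarrow> (nat \<Rightarrow> real) \<Rightarrow> nat \<Rightarrow> real \<times> real \<times> real" where
  "level_scale r p q k = (if k \<le> r + 1 then (a_coef p q k, b_coef p k, c_coef q k) else 0)"

definition level_sum ::
    "nat \<Rightarrow> (nat \<Rightarrow> real) \<Rightarrow> (nat \<Rightarrow> real) \<Rightarrow> nat \<Rightarrow> (nat \<Rightarrow> ('n::finite, 'm::finite) level) \<Rightarrow> ('n, 'm) state" where
  "level_sum r p q k U = (\<Sum>j=Suc k..r + 1. level_noise (level_scale r p q j) (U j))"

lemma level_sum_update:
  assumes "k < r + 1"
  shows "level_sum r p q k (U(Suc k := u)) = level_sum r p q (Suc k) U + level_noise (level_scale r p q (Suc k)) u"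
proof -
  have "level_sum r p q k (U(Suc k := u)) = level_noise (level_scale r p q (Suc k)) u
      + (\<Sum>j=Suc (Suc k)..r + 1. level_noise (level_scale r p q j) ((U(Suc k := u)) j))"
    unfolding level_sum_def using assms by (subst sum.atLeast_Suc_atMost) auto
  also have "(\<Sum>j=Suc (Suc k)..r + 1. level_noise (level_scale r p q j) ((U(Suc k := u)) j)) = level_sum r p q (Suc k) U"
    unfolding level_sum_def by (intro sum.cong) auto
  finally show ?thesis by (simp only: add.commute)
qed

lemma level_sum_r: "level_sum r p q r U = level_noise (level_scale r p q (r + 1)) (U (r + 1))"
  by (simp add: level_sum_def)

lemma D0_eq_field: "D0 r x y p q t i k G U = interp_field x y t (i, k) ((G, 0) + level_sum r p q 0 U)"
proof -
  have "level_sum r p q 0 U = (0, \<Sum>k=1..r+1. a_coef p q k * fst (U k),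
      \<Sum>k=1..r+1. b_coef p k *\<^sub>R fst (snd (U k)), \<Sum>k=1..r+1. c_coef q k *\<^sub>R snd (snd (U k)))"
  proof -
    have "level_sum r p q 0 U = (\<Sum>k=1..r+1. level_noise (a_coef p q k, b_coef p k, c_coef q k) (U k))"
      unfolding level_sum_def by (intro sum.cong) (auto simp: level_scale_def)
    then show ?thesis
      by (simp add: level_noise_def prod_eq_iff fst_sum snd_sum del: sum.cl_ivl_Suc)
  qed
  then show ?thesis by (simp add: D0_def interp_field_def del: sum.cl_ivl_Suc)
qed

lemma C_wt_eq: "C_wt r l x y p q \<beta> t i G U = cluster_sum l x y \<beta> t i ((G, 0) + level_sum r p q 0 U)"
  by (simp add: C_wt_def A_wt_def cluster_sum_def D0_eq_field)

lemma Z_part_eq: "Z_part r l x y p q \<beta> s t G U = partition_sum l x y \<beta> s t ((G, 0) + level_sum r p q 0 U)"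
  by (simp add: Z_part_def partition_sum_def C_wt_eq)

lemma gamma0_eq: "gamma0 r l x y p q \<beta> s t i k G U = gibbs_weight l x y \<beta> s t (i, k) ((G, 0) + level_sum r p q 0 U)"
  by (simp add: gamma0_def gibbs_weight_def C_wt_eq Z_part_eq A_wt_def D0_eq_field)

abbreviation level_map ::
    "nat \<Rightarrow> (nat \<Rightarrow> real) \<Rightarrow> (nat \<Rightarrow> real) \<Rightarrow> nat \<Rightarrow> ('n::finite, 'm::finite) level \<Rightarrow> ('n, 'm) state" where
  "level_map r p q i \<equiv> level_noise (level_scale r p q i)"

lemma exp_energy_step:
  assumes M: "exp_moments M" and F: "B-lipschitz_on UNIV F" and A: "noise_map L A" and m: "m \<noteq> 0"
  shows "exp (m * energy_step M m A F w) = (\<integral>u. exp (m * F (w + A u)) \<partial>M)"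
  using m prob_space.integral_exp_pos[OF exp_moments_prob_space[OF M] step_exp_integrable[OF M F A, of w], of m]
  by (simp add: energy_step_def free_energy_def)

lemma zeta_eq_tower:
  fixes F :: "('n::finite, 'm::finite) state \<Rightarrow> real"
  assumes F: "B-lipschitz_on UNIV F" and A: "\<And>i. noise_map 1 (level_map r p q i :: ('n, 'm) level \<Rightarrow> _)"
    and m: "m 0 = 1" "\<forall>k\<in>{1..r}. m k \<noteq> 0"
    and Z: "\<And>G U. Z G U = exp (F ((G, 0) + level_sum r p q 0 U))" and k: "k \<le> r"
  shows "zeta m Z k G U = exp (m k * tower_energy gauss_level m (level_map r p q) F k ((G, 0) + level_sum r p q k U))"
  using k
proof (induction k arbitrary: G U)
  case 0
  then show ?case by (simp add: m Z)
next
  case (Suc k)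
  let ?E = "tower_energy gauss_level m (level_map r p q) F"
  have mk: "m k \<noteq> 0" "m (Suc k) \<noteq> 0" using m Suc.prems by (cases k; auto)+
  have lip: "B-lipschitz_on UNIV (?E k)" by (rule tower_energy_lipschitz[OF exp_moments_gauss_level F A])
  have IH: "zeta m Z k G (U(Suc k := u)) powr (m (Suc k) / m k)
      = exp (m (Suc k) * ?E k (((G, 0) + level_sum r p q (Suc k) U) + level_map r p q (Suc k) u))" for u
    using Suc mk by (simp add: level_sum_update powr_def add.assoc)
  have "zeta m Z (Suc k) G U
      = (\<integral>u. exp (m (Suc k) * ?E k (((G, 0) + level_sum r p q (Suc k) U) + level_map r p q (Suc k) u)) \<partial>gauss_level)"
    by (simp add: E_level_def IH)
  also have "\<dots> = exp (m (Suc k) * ?E (Suc k) ((G, 0) + level_sum r p q (Suc k) U))"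
    by (simp add: exp_energy_step[OF exp_moments_gauss_level lip A mk(2)])
  finally show ?case .
qed

lemma Phi_eq_mean_step:
  fixes F :: "('n::finite, 'm::finite) state \<Rightarrow> real"
  assumes F: "B-lipschitz_on UNIV F" and A: "\<And>i. noise_map 1 (level_map r p q i :: ('n, 'm) level \<Rightarrow> _)"
    and m: "m 0 = 1" "\<forall>k\<in>{1..r}. m k \<noteq> 0"
    and Z: "\<And>G U. Z G U = exp (F ((G, 0) + level_sum r p q 0 U))" and k: "k < r"
    and g: "\<And>G U. f G U = g ((G, 0) + level_sum r p q k U)"
  shows "Phi m Z (Suc k) f G U = mean_step gauss_level (m (Suc k)) (level_map r p q (Suc k))
     (tower_energy gauss_level m (level_map r p q) F k) g ((G, 0) + level_sum r p q (Suc k) U)"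
proof -
  let ?E = "tower_energy gauss_level m (level_map r p q) F"
  let ?w = "(G, 0) + level_sum r p q (Suc k) U"
  have mk: "m k \<noteq> 0" "m (Suc k) \<noteq> 0" using m k by (cases k; auto)+
  have lip: "B-lipschitz_on UNIV (?E k)" by (rule tower_energy_lipschitz[OF exp_moments_gauss_level F A])
  note ze = zeta_eq_tower[OF F A m Z]
  have 1: "zeta m Z k G (U(Suc k := u)) powr (m (Suc k) / m k) = exp (m (Suc k) * ?E k (?w + level_map r p q (Suc k) u))" for u
    using k mk by (simp add: ze level_sum_update powr_def add.assoc)
  have upd: "level_sum r p q (Suc k) (U(Suc k := u)) = level_sum r p q (Suc k) U" for u
    unfolding level_sum_def by (intro sum.cong) auto
  have 2: "zeta m Z (Suc k) G (U(Suc k := u)) = (\<integral>u. exp (m (Suc k) * ?E k (?w + level_map r p q (Suc k) u)) \<partial>gauss_level)" for u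
    using ze[of "Suc k" G "U(Suc k := u)"] k
    by (simp add: upd exp_energy_step[OF exp_moments_gauss_level lip A mk(2)] del: zeta.simps)
  have 3: "f G (U(Suc k := u)) = g (?w + level_map r p q (Suc k) u)" for u
    using k by (simp add: g level_sum_update add.assoc)
  show ?thesis
    unfolding Phi_def E_level_def diff_Suc_1 1 2 3 mean_step_def tilted_mean_def by simp
qed

lemma Phi_prod_eq_tower_mean:
  fixes F :: "('n::finite, 'm::finite) state \<Rightarrow> real"
  assumes F: "B-lipschitz_on UNIV F" and A: "\<And>i. noise_map 1 (level_map r p q i :: ('n, 'm) level \<Rightarrow> _)"
    and m: "m 0 = 1" "\<forall>k\<in>{1..r}. m k \<noteq> 0"
    and Z: "\<And>G U. Z G U = exp (F ((G, 0) + level_sum r p q 0 U))" and k: "k + n \<le> r"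
    and g: "\<And>G U. f G U = g ((G, 0) + level_sum r p q k U)"
  shows "Phi_prod m Z (k + n) (Suc k) f G U
     = tower_mean gauss_level m (level_map r p q) F k g n ((G, 0) + level_sum r p q (k + n) U)"
  using k
proof (induction n arbitrary: G U)
  case 0
  then show ?case by (simp add: Phi_prod_def g)
next
  case (Suc n)
  have "Phi_prod m Z (k + Suc n) (Suc k) f = Phi m Z (Suc (k + n)) (Phi_prod m Z (k + n) (Suc k) f)"
    by (simp add: Phi_prod_def)
  then show ?case
    using Phi_eq_mean_step[OF F A m Z, of "k + n" "Phi_prod m Z (k + n) (Suc k) f"
        "tower_mean gauss_level m (level_map r p q) F k g n" G U] Suc by simp
qed

lemma noise_map_Pair_0: "noise_map 1 (\<lambda>G :: real ^ 'n::finite ^ 'm::finite. (G, 0 :: ('n, 'm) level))"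
  by (auto simp: noise_map_def norm_Pair intro!: continuous_intros)

lemma
  fixes h :: "('n::finite, 'm::finite) state \<Rightarrow> real"
  assumes A: "noise_map 1 (level_map r p q (r + 1) :: ('n, 'm) level \<Rightarrow> _)"
    and h: "continuous_on UNIV h" "\<And>w. \<bar>h w\<bar> \<le> C + B * norm w" and B: "0 \<le> B"
  shows outer_integrable: "integrable (gauss_mat \<Otimes>\<^sub>M gauss_level) (\<lambda>(G, u). h ((G, 0) + level_map r p q (r + 1) u))"
    and outer_integral: "(\<integral>(G, u). h ((G, 0) + level_map r p q (r + 1) u) \<partial>(gauss_mat \<Otimes>\<^sub>M gauss_level))
      = (\<integral>G. energy_step gauss_level 0 (level_map r p q (r + 1)) h (G, 0) \<partial>gauss_mat)"
proof -
  let ?P = "gauss_mat \<Otimes>\<^sub>M gauss_level :: (_ \<times> ('n, 'm) level) measure"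
  note eP = exp_moments_pair[OF exp_moments_gauss_mat exp_moments_gauss_level]
  interpret G: prob_space "gauss_mat :: (real ^ 'n ^ 'm) measure" by (rule exp_moments_prob_space[OF exp_moments_gauss_mat])
  interpret L: prob_space "gauss_level :: ('n, 'm) level measure" by (rule exp_moments_prob_space[OF exp_moments_gauss_level])
  interpret P: pair_prob_space "gauss_mat :: (real ^ 'n ^ 'm) measure" "gauss_level :: ('n, 'm) level measure" ..
  have "exp_integrable ?P (\<lambda>p'. h ((fst p', 0) + level_map r p q (r + 1) (snd p')))"
  proof (rule exp_moments_exp_integrable[OF eP])
    show "(\<lambda>p'. h ((fst p', 0) + level_map r p q (r + 1) (snd p'))) \<in> borel_measurable ?P"
      by (intro exp_moments_continuous[OF eP] continuous_on_compose2[OF h(1)] continuous_intros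
          continuous_on_compose2[OF continuous_on_level_noise]) auto
    fix p' :: "(real ^ 'n ^ 'm) \<times> ('n, 'm) level"
    have "norm ((fst p', 0) + level_map r p q (r + 1) (snd p')) \<le> norm (fst p') + norm (snd p')"
      using noise_mapD(3)[OF A, of "snd p'"] norm_triangle_ineq[of "(fst p', 0)" "level_map r p q (r + 1) (snd p')"]
      by (simp add: norm_Pair)
    also have "\<dots> \<le> 2 * norm p'" using norm_fst_le[of "fst p'" "snd p'"] norm_snd_le[of "snd p'" "fst p'"] by simp
    finally have "B * norm ((fst p', 0) + level_map r p q (r + 1) (snd p')) \<le> B * (2 * norm p')"
      using B by (intro mult_left_mono)
    with h(2)[of "(fst p', 0) + level_map r p q (r + 1) (snd p')"]
    show "\<bar>h ((fst p', 0) + level_map r p q (r + 1) (snd p'))\<bar> \<le> C + (2 * B) * norm p'" by simp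
  qed
  from exp_integrable_integrable[OF this]
  show i: "integrable ?P (\<lambda>(G, u). h ((G, 0) + level_map r p q (r + 1) u))"
    by (simp add: case_prod_unfold)
  show "(\<integral>(G, u). h ((G, 0) + level_map r p q (r + 1) u) \<partial>?P)
      = (\<integral>G. energy_step gauss_level 0 (level_map r p q (r + 1)) h (G, 0) \<partial>gauss_mat)"
    using P.integral_fst[OF i] by (simp add: energy_step_def free_energy_def)
qed

lemma E_outer_eq:
  assumes "\<And>G U. f G U = h ((G, 0) + level_sum r p q r U)"
  shows "E_outer r f = (\<integral>(G, u). h ((G, 0) + level_map r p q (r + 1) u) \<partial>(gauss_mat \<Otimes>\<^sub>M gauss_level))"
  unfolding E_outer_def by (simp add: assms level_sum_r)

lemma mean_step_0:
  assumes "exp_moments M"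
  shows "mean_step M 0 A F g = energy_step M 0 A g"
  using prob_space.prob_space[OF exp_moments_prob_space[OF assms]]
  by (simp add: fun_eq_iff mean_step_def tilted_mean_def energy_step_def free_energy_def)

lemma psi_eq_tower:
  fixes x :: "nat \<Rightarrow> real ^ 'n::finite" and y :: "nat \<Rightarrow> real ^ 'm::finite"
  assumes l: "1 \<le> l" and \<beta>: "0 < \<beta>" and s: "s \<noteq> 0"
    and A: "\<And>i. noise_map 1 (level_map r p q i :: ('n, 'm) level \<Rightarrow> _)"
    and m: "m 0 = 1" "\<forall>k\<in>{1..r}. m k \<noteq> 0" "m (r + 1) = 0"
  shows "psi r l x y p q m \<beta> s t = 1 / (\<beta> * \<bar>s\<bar> * sqrt (real CARD('n))) *
     (\<integral>G. tower_energy gauss_level m (level_map r p q) (\<lambda>w. ln (partition_sum l x y \<beta> s t w)) (r + 1) (G, 0) \<partial>gauss_mat)"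
proof -
  let ?F = "\<lambda>w. ln (partition_sum l x y \<beta> s t w)"
  let ?E = "tower_energy gauss_level m (level_map r p q) ?F"
  let ?c = "1 / (\<beta> * \<bar>s\<bar> * sqrt (real CARD('n)))"
  obtain B where B: "B-lipschitz_on UNIV ?F" using log_partition_first_order[OF l \<beta> s] by blast
  have Z: "Z_part r l x y p q \<beta> s t G U = exp (?F ((G, 0) + level_sum r p q 0 U))" for G U
    using partition_sum_pos[OF l, of x y \<beta> s t "(G, 0) + level_sum r p q 0 U"] by (simp add: Z_part_eq)
  have mr: "m r \<noteq> 0" using m by (cases r) auto
  have lip: "B-lipschitz_on UNIV (?E r)" by (rule tower_energy_lipschitz[OF exp_moments_gauss_level B A])
  have "psi r l x y p q m \<beta> s t = (\<integral>(G, u). ?c * ?E r ((G, 0) + level_map r p q (r + 1) u) \<partial>(gauss_mat \<Otimes>\<^sub>M gauss_level))"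
    unfolding psi_def
  proof (rule E_outer_eq)
    show "1 / (\<beta> * \<bar>s\<bar> * sqrt (real CARD('n)) * m r) * ln (zeta m (Z_part r l x y p q \<beta> s t) r G U)
        = ?c * ?E r ((G, 0) + level_sum r p q r U)" for G U
      using mr by (simp add: zeta_eq_tower[OF B A m(1,2) Z order_refl])
  qed
  also have "\<dots> = ?c * (\<integral>(G, u). ?E r ((G, 0) + level_map r p q (r + 1) u) \<partial>(gauss_mat \<Otimes>\<^sub>M gauss_level))"
    by (simp add: case_prod_unfold)
  also have "(\<integral>(G, u). ?E r ((G, 0) + level_map r p q (r + 1) u) \<partial>(gauss_mat \<Otimes>\<^sub>M gauss_level))
      = (\<integral>G. energy_step gauss_level 0 (level_map r p q (r + 1)) (?E r) (G, 0) \<partial>gauss_mat)"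
  proof (rule outer_integral[OF A lipschitz_on_continuous_on[OF lip]])
    show "\<bar>?E r w\<bar> \<le> \<bar>?E r 0\<bar> + B * norm w" for w
      using lipschitz_add[OF lip, of 0 w] by simp
    show "0 \<le> B" by (rule lipschitz_on_nonneg[OF B])
  qed
  finally show ?thesis using m(3) by simp
qed

lemma tower_mean_cmult: "tower_mean M m A F k (\<lambda>w. c * g w) n = (\<lambda>w. c * tower_mean M m A F k g n w)"
  by (induction n) (simp_all add: mean_step_def[abs_def] tilted_mean_cmult)

lemma tower_mean_sum:
  assumes M: "exp_moments M" and F: "B-lipschitz_on UNIV F" and A: "\<And>i. noise_map L (A i)" and J: "finite J"
    and g: "\<And>j. j \<in> J \<Longrightarrow> continuous_on UNIV (g j)" "\<And>j w. j \<in> J \<Longrightarrow> \<bar>g j w\<bar> \<le> R j"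
  shows "tower_mean M m A F k (\<lambda>w. \<Sum>j\<in>J. g j w) n = (\<lambda>w. \<Sum>j\<in>J. tower_mean M m A F k (g j) n w)"
proof (induction n)
  case (Suc n)
  have "mean_step M (m (Suc (k + n))) (A (Suc (k + n))) (tower_energy M m A F (k + n)) (\<lambda>w. \<Sum>j\<in>J. tower_mean M m A F k (g j) n w) w
     = (\<Sum>j\<in>J. mean_step M (m (Suc (k + n))) (A (Suc (k + n))) (tower_energy M m A F (k + n)) (tower_mean M m A F k (g j) n) w)" for w
    unfolding mean_step_def
    by (rule tilted_mean_sum[OF step_exp_integrable[OF M tower_energy_lipschitz[OF M F A] A] J
          step_measurable[OF M tower_mean_bounded_continuous(1)[OF M F A g] A]
          tower_mean_bounded_continuous(2)[OF M F A g]])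
  then show ?case by (simp add: Suc)
qed simp

lemma tower_mean_quad_form:
  assumes M: "exp_moments M" and F: "B-lipschitz_on UNIV F" and A: "\<And>i. noise_map L (A i)" and J: "finite J"
    and \<Gamma>: "\<And>j. j \<in> J \<Longrightarrow> continuous_on UNIV (\<Gamma> j)" "\<And>j w. j \<in> J \<Longrightarrow> \<bar>\<Gamma> j w\<bar> \<le> 1"
  shows "tower_mean M m A F k (quad_form J c \<Gamma>) n
    = (\<lambda>w. \<Sum>i\<in>J. \<Sum>j\<in>J. c i j * tower_mean M m A F k (\<lambda>w. \<Gamma> i w * \<Gamma> j w) n w)"
proof -
  have cont: "continuous_on UNIV (\<lambda>w. c i j * (\<Gamma> i w * \<Gamma> j w))" if "i \<in> J" "j \<in> J" for i j
    using that by (intro continuous_intros \<Gamma>)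
  have bnd: "\<bar>c i j * (\<Gamma> i w * \<Gamma> j w)\<bar> \<le> \<bar>c i j\<bar>" if "i \<in> J" "j \<in> J" for i j w
  proof -
    have "\<bar>c i j\<bar> * (\<bar>\<Gamma> i w\<bar> * \<bar>\<Gamma> j w\<bar>) \<le> \<bar>c i j\<bar> * (1 * 1)"
      using that by (intro mult_left_mono mult_mono \<Gamma>) auto
    then show ?thesis by (simp add: abs_mult)
  qed
  have cont': "continuous_on UNIV (\<lambda>w. \<Sum>j\<in>J. c i j * (\<Gamma> i w * \<Gamma> j w))" if "i \<in> J" for i
    using that by (intro continuous_on_sum cont)
  have bnd': "\<bar>\<Sum>j\<in>J. c i j * (\<Gamma> i w * \<Gamma> j w)\<bar> \<le> (\<Sum>j\<in>J. \<bar>c i j\<bar>)" if "i \<in> J" for i w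
    by (rule order_trans[OF sum_abs]) (intro sum_mono bnd that)
  have qf: "quad_form J c \<Gamma> = (\<lambda>w. \<Sum>i\<in>J. \<Sum>j\<in>J. c i j * (\<Gamma> i w * \<Gamma> j w))"
    by (simp add: fun_eq_iff quad_form_def mult_ac)
  have "tower_mean M m A F k (\<lambda>w. \<Sum>i\<in>J. \<Sum>j\<in>J. c i j * (\<Gamma> i w * \<Gamma> j w)) n
      = (\<lambda>w. \<Sum>i\<in>J. tower_mean M m A F k (\<lambda>w. \<Sum>j\<in>J. c i j * (\<Gamma> i w * \<Gamma> j w)) n w)"
    by (rule tower_mean_sum[OF M F A J cont' bnd'])
  also have "\<dots> = (\<lambda>w. \<Sum>i\<in>J. \<Sum>j\<in>J. tower_mean M m A F k (\<lambda>w. c i j * (\<Gamma> i w * \<Gamma> j w)) n w)"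
    by (intro ext sum.cong refl fun_cong[OF tower_mean_sum[OF M F A J cont bnd]])
  finally show ?thesis by (simp add: qf tower_mean_cmult)
qed

definition replica_mean ::
    "nat \<Rightarrow> nat \<Rightarrow> (nat \<Rightarrow> real ^ 'n::finite) \<Rightarrow> (nat \<Rightarrow> real ^ 'm::finite) \<Rightarrow> (nat \<Rightarrow> real) \<Rightarrow> (nat \<Rightarrow> real) \<Rightarrow>
      (nat \<Rightarrow> real) \<Rightarrow> real \<Rightarrow> real \<Rightarrow> real \<Rightarrow> nat \<Rightarrow> nat \<times> nat \<Rightarrow> nat \<times> nat \<Rightarrow> real" where
  "replica_mean r l x y p q m \<beta> s t k i j =
     (let A = level_map r p q; F = \<lambda>w. ln (partition_sum l x y \<beta> s t w);
          \<Gamma> = \<lambda>j. tower_mean gauss_level m A F 0 (gibbs_weight l x y \<beta> s t j) k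
      in \<integral>G. tower_mean gauss_level m A F k (\<lambda>w. \<Gamma> i w * \<Gamma> j w) (Suc (r - k)) (G, 0) \<partial>gauss_mat)"

lemma E_gamma_eq:
  fixes x :: "nat \<Rightarrow> real ^ 'n::finite" and y :: "nat \<Rightarrow> real ^ 'm::finite"
  assumes l: "1 \<le> l" and \<beta>: "0 < \<beta>" and s: "s \<noteq> 0"
    and A: "\<And>i. noise_map 1 (level_map r p q i :: ('n, 'm) level \<Rightarrow> _)"
    and m: "m 0 = 1" "\<forall>k\<in>{1..r}. m k \<noteq> 0" "m (r + 1) = 0" and k: "k \<le> r"
  shows "E_gamma r l x y p q m \<beta> s t k f = (\<Sum>i\<in>{1..l} \<times> {1..l}. \<Sum>j\<in>{1..l} \<times> {1..l}.
     replica_mean r l x y p q m \<beta> s t k i j * f (fst i) (snd i) (fst j) (snd j))"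
proof -
  let ?M = "gauss_level :: ('n, 'm) level measure"
  let ?F = "\<lambda>w. ln (partition_sum l x y \<beta> s t w)"
  let ?Z = "Z_part r l x y p q \<beta> s t"
  let ?A = "level_map r p q :: nat \<Rightarrow> ('n, 'm) level \<Rightarrow> _"
  let ?J = "{1..l} \<times> {1..l}"
  note M = exp_moments_gauss_level
  obtain B where B: "B-lipschitz_on UNIV ?F" using log_partition_first_order[OF l \<beta> s] by blast
  have Z: "?Z G U = exp (?F ((G, 0) + level_sum r p q 0 U))" for G U
    using partition_sum_pos[OF l, of x y \<beta> s t "(G, 0) + level_sum r p q 0 U"] by (simp add: Z_part_eq)
  define \<Gamma> where "\<Gamma> j = tower_mean ?M m ?A ?F 0 (gibbs_weight l x y \<beta> s t j) k" for j
  have \<Gamma>: "continuous_on UNIV (\<Gamma> j)" "\<bar>\<Gamma> j w\<bar> \<le> 1" if "j \<in> ?J" for j w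
    unfolding \<Gamma>_def
    using tower_mean_bounded_continuous[where A = ?A, OF M B A continuous_on_gibbs_weight[OF l] gibbs_weight_bounds[OF l that]] by blast+
  define H where "H i j = tower_mean ?M m ?A ?F k (\<lambda>w. \<Gamma> i w * \<Gamma> j w) (r - k)" for i j
  have \<Gamma>\<Gamma>: "continuous_on UNIV (\<lambda>w. \<Gamma> i w * \<Gamma> j w)" "\<bar>\<Gamma> i w * \<Gamma> j w\<bar> \<le> 1" if "i \<in> ?J" "j \<in> ?J" for i j w
  proof -
    show "continuous_on UNIV (\<lambda>w. \<Gamma> i w * \<Gamma> j w)" using that by (intro continuous_intros \<Gamma>)
    have "\<bar>\<Gamma> i w\<bar> * \<bar>\<Gamma> j w\<bar> \<le> 1 * 1" using that by (intro mult_mono \<Gamma>) auto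
    then show "\<bar>\<Gamma> i w * \<Gamma> j w\<bar> \<le> 1" by (simp add: abs_mult)
  qed
  have H: "continuous_on UNIV (H i j)" "\<bar>H i j w\<bar> \<le> 1 + 0 * norm w" if "i \<in> ?J" "j \<in> ?J" for i j w
    unfolding H_def using tower_mean_bounded_continuous[where A = ?A, OF M B A \<Gamma>\<Gamma>[OF that]] by simp_all
  have gw: "gamma_wt r l x y p q m \<beta> s t k i1 i2 p1 p2 G U = H (i1, i2) (p1, p2) ((G, 0) + level_sum r p q r U)"
    for i1 i2 p1 p2 G U
  proof -
    have inner: "Phi_prod m ?Z k 1 (gamma0 r l x y p q \<beta> s t a b) G U = \<Gamma> (a, b) ((G, 0) + level_sum r p q k U)" for a b G U
      using Phi_prod_eq_tower_mean[OF B A m(1,2) Z, of 0 k "gamma0 r l x y p q \<beta> s t a b" "gibbs_weight l x y \<beta> s t (a, b)" G U] k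
      by (simp add: gamma0_eq \<Gamma>_def)
    show ?thesis
      using Phi_prod_eq_tower_mean[OF B A m(1,2) Z, of k "r - k" _ "\<lambda>w. \<Gamma> (i1, i2) w * \<Gamma> (p1, p2) w" G U] k
      by (simp add: gamma_wt_def Let_def inner[simplified] H_def)
  qed
  let ?P = "gauss_mat \<Otimes>\<^sub>M ?M"
  let ?V = "\<lambda>(G, u). (G, 0) + ?A (r + 1) u"
  have int: "integrable ?P (\<lambda>p. H i j (?V p))" if "i \<in> ?J" "j \<in> ?J" for i j
    using outer_integrable[OF A H[OF that]] by (simp add: case_prod_unfold)
  have rm: "(\<integral>p. H i j (?V p) \<partial>?P) = replica_mean r l x y p q m \<beta> s t k i j" if "i \<in> ?J" "j \<in> ?J" for i j
    using outer_integral[OF A H[OF that]] k m(3)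
    by (simp add: case_prod_unfold replica_mean_def Let_def \<Gamma>_def[symmetric] H_def[symmetric] mean_step_0[OF M])
  have "E_gamma r l x y p q m \<beta> s t k f = (\<integral>(G, u). (\<lambda>w. \<Sum>i\<in>?J. \<Sum>j\<in>?J. H i j w * f (fst i) (snd i) (fst j) (snd j)) ((G, 0) + ?A (r + 1) u) \<partial>?P)"
    unfolding E_gamma_def
  proof (rule E_outer_eq)
    have "(\<Sum>i\<in>?J. g i) = (\<Sum>a=1..l. \<Sum>b=1..l. g (a, b))" for g :: "nat \<times> nat \<Rightarrow> real"
      by (simp add: sum.cartesian_product case_prod_unfold)
    then show "(\<Sum>i1=1..l. \<Sum>i2=1..l. \<Sum>p1=1..l. \<Sum>p2=1..l. gamma_wt r l x y p q m \<beta> s t k i1 i2 p1 p2 G U * f i1 i2 p1 p2)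
        = (\<lambda>w. \<Sum>i\<in>?J. \<Sum>j\<in>?J. H i j w * f (fst i) (snd i) (fst j) (snd j)) ((G, 0) + level_sum r p q r U)" for G U
      by (simp add: gw)
  qed
  also have "\<dots> = (\<integral>p. (\<Sum>i\<in>?J. \<Sum>j\<in>?J. H i j (?V p) * f (fst i) (snd i) (fst j) (snd j)) \<partial>?P)"
    by (simp only: case_prod_unfold)
  also have "\<dots> = (\<Sum>i\<in>?J. \<Sum>j\<in>?J. (\<integral>p. H i j (?V p) \<partial>?P) * f (fst i) (snd i) (fst j) (snd j))"
    using int by (simp add: integral_sum integrable_sum)
  also have "\<dots> = (\<Sum>i\<in>?J. \<Sum>j\<in>?J. replica_mean r l x y p q m \<beta> s t k i j * f (fst i) (snd i) (fst j) (snd j))"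
    by (intro sum.cong refl) (simp only: rm)
  finally show ?thesis .
qed

definition admissible :: "nat \<Rightarrow> (nat \<Rightarrow> real) \<Rightarrow> bool" where
  "admissible r p \<longleftrightarrow> p 0 \<le> 1 \<and> (\<forall>k\<in>{0..r}. p (k + 1) \<le> p k) \<and> p (r + 1) = 0"

lemma admissible_bounds:
  assumes p: "admissible r p" and i: "i \<le> r + 1"
  shows "0 \<le> p i" "p i \<le> 1"
proof -
  have le: "p (Suc n) \<le> p n" if "n \<le> r" for n using p that by (auto simp: admissible_def)
  show "0 \<le> p i" using i
  proof (induction rule: inc_induct)
    case (step n)
    then show ?case using le[of n] by simp
  qed (use p in \<open>simp add: admissible_def\<close>)
  show "p i \<le> 1" using i
  proof (induction i)
    case (Suc i)
    then show ?case using le[of i] by simp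
  qed (use p in \<open>simp add: admissible_def\<close>)
qed

lemma admissible_step:
  assumes p: "admissible r p" and i: "i \<le> r + 1"
  shows "p i \<le> p (i - 1)"
  using assms by (cases i) (auto simp: admissible_def)

lemma admissible_variances:
  assumes p: "admissible r p" and q: "admissible r q" and i: "i \<le> r + 1"
  shows "0 \<le> p (i - 1) * q (i - 1) - p i * q i" "p (i - 1) * q (i - 1) - p i * q i \<le> 1"
    "0 \<le> p (i - 1) - p i" "p (i - 1) - p i \<le> 1"
proof -
  have i': "i - 1 \<le> r + 1" using i by simp
  note b = admissible_bounds[OF p i] admissible_bounds[OF q i] admissible_bounds[OF p i'] admissible_bounds[OF q i']
  note st = admissible_step[OF p i] admissible_step[OF q i]
  show "0 \<le> p (i - 1) * q (i - 1) - p i * q i" using mult_mono[OF st] b by simp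
  have "p (i - 1) * q (i - 1) \<le> 1 * 1" using b by (intro mult_mono) auto
  moreover have "0 \<le> p i * q i" using b by simp
  ultimately show "p (i - 1) * q (i - 1) - p i * q i \<le> 1" by linarith
  show "0 \<le> p (i - 1) - p i" "p (i - 1) - p i \<le> 1" using st b by linarith+
qed

lemma noise_map_level_map:
  assumes p: "admissible r p" and q: "admissible r q"
  shows "noise_map 1 (level_map r p q i :: ('n::finite, 'm::finite) level \<Rightarrow> _)"
proof (cases "i \<le> r + 1")
  case True
  note v = admissible_variances[OF p q True] admissible_variances[OF q p True]
  have "noise_map 1 (level_noise (a_coef p q i, b_coef p i, c_coef q i) :: ('n, 'm) level \<Rightarrow> _)"
    by (rule noise_map_level_noise) (use v in \<open>simp_all add: a_coef_def b_coef_def c_coef_def\<close>)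
  then show ?thesis using True by (simp add: level_scale_def)
next
  case False
  have "noise_map 1 (level_noise (0, 0, 0) :: ('n, 'm) level \<Rightarrow> _)" by (rule noise_map_level_noise) simp_all
  then show ?thesis using False by (simp add: level_scale_def zero_prod_def)
qed

lemma noise_family_level_map:
  assumes "\<And>v. v \<in> I \<Longrightarrow> admissible r (P v)" "\<And>v. v \<in> I \<Longrightarrow> admissible r (Q v)"
    and cont: "\<And>j. continuous_on I (\<lambda>v. P v j)" "\<And>j. continuous_on I (\<lambda>v. Q v j)"
  shows "noise_family I 1 (\<lambda>v. level_map r (P v) (Q v) i :: ('n::finite, 'm::finite) level \<Rightarrow> _)"
  unfolding noise_family_def
proof (intro conjI ballI allI)
  fix v assume "v \<in> I"
  then show "noise_map 1 (level_map r (P v) (Q v) i :: ('n, 'm) level \<Rightarrow> _)"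
    by (intro noise_map_level_map assms)
next
  fix u :: "('n, 'm) level"
  show "continuous_on I (\<lambda>v. level_map r (P v) (Q v) i u)"
    by (cases "i \<le> r + 1")
       (auto simp: level_noise_def level_scale_def a_coef_def b_coef_def c_coef_def intro!: continuous_intros cont)
qed

lemma level_noise_increment:
  assumes nn: "0 \<le> va" "0 \<le> vb" "0 \<le> vc" "0 \<le> \<alpha>" "0 \<le> \<mu>" "0 \<le> \<nu>" "0 \<le> h"
  shows "distr (gauss_level \<Otimes>\<^sub>M gauss_level) borel
      (\<lambda>(u, u'). level_noise (sqrt va, sqrt vb, sqrt vc) u + sqrt h *\<^sub>R level_noise (sqrt \<alpha>, sqrt \<mu>, sqrt \<nu>) u')
    = distr gauss_level borel
       (level_noise (sqrt (va + h * \<alpha>), sqrt (vb + h * \<mu>), sqrt (vc + h * \<nu>)) :: ('n::finite, 'm::finite) level \<Rightarrow> _)"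
proof -
  have sc: "sqrt h *\<^sub>R level_noise (sqrt \<alpha>, sqrt \<mu>, sqrt \<nu>) u = level_noise (sqrt (h * \<alpha>), sqrt (h * \<mu>), sqrt (h * \<nu>)) u"
    for u :: "('n, 'm) level"
    by (simp add: level_noise_def real_sqrt_mult)
  show ?thesis
    unfolding sc using level_noise_distr[of "sqrt va" "sqrt vb" "sqrt vc" "sqrt (h * \<alpha>)" "sqrt (h * \<mu>)" "sqrt (h * \<nu>)"] nn
    by simp
qed

lemma psi_derivative:
  fixes x :: "nat \<Rightarrow> real ^ 'n::finite" and y :: "nat \<Rightarrow> real ^ 'm::finite" and P Q :: "real \<Rightarrow> nat \<Rightarrow> real"
  assumes l: "1 \<le> l" and \<beta>: "0 < \<beta>" and s: "s \<noteq> 0" and t: "0 \<le> t" "t \<le> 1"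
    and m: "m 0 = 1" "\<forall>k\<in>{1..r}. m k \<noteq> 0" "m (r + 1) = 0" and k: "1 \<le> k" "k \<le> r"
    and adm: "\<And>v. v \<in> I \<Longrightarrow> admissible r (P v)" "\<And>v. v \<in> I \<Longrightarrow> admissible r (Q v)"
    and cont: "\<And>j. continuous_on I (\<lambda>v. P v j)" "\<And>j. continuous_on I (\<lambda>v. Q v j)"
    and fixed: "\<And>v v' j. j \<noteq> k \<Longrightarrow> P v j = P v' j" "\<And>v v' j. j \<noteq> k \<Longrightarrow> Q v j = Q v' j"
    and \<tau>: "0 \<le> \<alpha>" "\<alpha> \<le> 1" "0 \<le> \<mu>" "\<mu> \<le> 1" "0 \<le> \<nu>" "\<nu> \<le> 1"
    and inc: "\<And>a b. P b k * Q b k = P a k * Q a k + (b - a) * \<alpha>" "\<And>a b. P b k = P a k + (b - a) * \<mu>"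
      "\<And>a b. Q b k = Q a k + (b - a) * \<nu>"
    and v: "v \<in> I"
  shows "((\<lambda>v. psi r l x y (P v) (Q v) m \<beta> s t) has_real_derivative
     1 / (\<beta> * \<bar>s\<bar> * sqrt (real CARD('n))) * ((m (k + 1) - m k) / 2 * (s * \<beta>)\<^sup>2 *
       (\<Sum>i\<in>{1..l} \<times> {1..l}. \<Sum>j\<in>{1..l} \<times> {1..l}. replica_mean r l x y (P v) (Q v) m \<beta> s t k i j *
          ((1 - t) * \<mu> * (norm (x (fst i)) * norm (x (fst j)) * (y (snd j) \<bullet> y (snd i)))
           + (1 - t) * \<nu> * (norm (y (snd i)) * norm (y (snd j)) * (x (fst i) \<bullet> x (fst j)))
           + t * \<alpha> * (norm (x (fst i)) * norm (x (fst j)) * norm (y (snd i)) * norm (y (snd j)))))))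
     (at v within I)"
proof -
  let ?M = "gauss_level :: ('n, 'm) level measure"
  let ?F = "\<lambda>w. ln (partition_sum l x y \<beta> s t w)"
  let ?J = "{1..l} \<times> {1..l}"
  let ?c = "1 / (\<beta> * \<bar>s\<bar> * sqrt (real CARD('n)))"
  let ?\<tau> = "level_noise (sqrt \<alpha>, sqrt \<mu>, sqrt \<nu>) :: ('n, 'm) level \<Rightarrow> _"
  let ?A = "\<lambda>i v. level_map r (P v) (Q v) i :: ('n, 'm) level \<Rightarrow> _"
  let ?D = "\<lambda>j w. s * \<beta> * interp_field x y t j w"
  note M = exp_moments_gauss_level
  obtain B K where B: "B-lipschitz_on UNIV ?F" and K: "0 \<le> K"
    and fo: "first_order ?J ?D K ?F (gibbs_weight l x y \<beta> s t)"
    using log_partition_first_order[OF l \<beta> s] by blast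
  have D: "bounded_linear (?D j)" for j
    by (rule bounded_linear_const_mult[OF bounded_linear_field])
  have \<tau>n: "noise_map 1 ?\<tau>" by (rule noise_map_level_noise) (use \<tau> in auto)
  have \<tau>0: "(\<integral>u. ?D j (?\<tau> u) \<partial>?M) = 0" for j
    by (simp add: field_noise_mean[OF t])
  have fam: "noise_family I 1 (?A i)" for i by (rule noise_family_level_map[OF adm cont])
  have nA: "noise_map 1 (?A i v)" if "v \<in> I" for i v by (rule noise_map_level_map[OF adm[OF that]])
  have const: "?A i v = ?A i v'" if "i \<noteq> k" "i \<noteq> Suc k" for i v v'
  proof -
    have "i - 1 \<noteq> k" using that k by auto
    then have "level_scale r (P v) (Q v) i = level_scale r (P v') (Q v') i"
      using that fixed[of i v v'] fixed[of "i - 1" v v'] by (simp add: level_scale_def a_coef_def b_coef_def c_coef_def)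
    then show ?thesis by simp
  qed
  have k1: "k - 1 \<noteq> k" "Suc k \<noteq> k" using k by auto
  have conv: "distr (?M \<Otimes>\<^sub>M ?M) borel (\<lambda>(u, u'). ?A k b u + sqrt (b - a) *\<^sub>R ?\<tau> u') = distr ?M borel (?A k a)"
    if ab: "a \<in> I" "b \<in> I" "a \<le> b" for a b
  proof -
    note var = admissible_variances[OF adm(1)[OF ab(2)] adm(2)[OF ab(2)], of k]
      admissible_variances[OF adm(2)[OF ab(2)] adm(1)[OF ab(2)], of k]
    have e: "P a (k - 1) * Q a (k - 1) - P a k * Q a k = P b (k - 1) * Q b (k - 1) - P b k * Q b k + (b - a) * \<alpha>"
      "P a (k - 1) - P a k = P b (k - 1) - P b k + (b - a) * \<mu>" "Q a (k - 1) - Q a k = Q b (k - 1) - Q b k + (b - a) * \<nu>"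
      using inc[of b a] fixed[OF k1(1), of a b] by simp_all
    show ?thesis
      using k ab var \<tau> unfolding level_scale_def a_coef_def b_coef_def c_coef_def e
      by (simp add: level_noise_increment)
  qed
  have conv': "distr (?M \<Otimes>\<^sub>M ?M) borel (\<lambda>(u, u'). ?A (Suc k) a u + sqrt (b - a) *\<^sub>R ?\<tau> u') = distr ?M borel (?A (Suc k) b)"
    if ab: "a \<in> I" "b \<in> I" "a \<le> b" for a b
  proof -
    note var = admissible_variances[OF adm(1)[OF ab(1)] adm(2)[OF ab(1)], of "Suc k"]
      admissible_variances[OF adm(2)[OF ab(1)] adm(1)[OF ab(1)], of "Suc k"]
    have e: "P b (Suc k - 1) * Q b (Suc k - 1) - P b (Suc k) * Q b (Suc k)
        = P a (Suc k - 1) * Q a (Suc k - 1) - P a (Suc k) * Q a (Suc k) + (b - a) * \<alpha>"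
      "P b (Suc k - 1) - P b (Suc k) = P a (Suc k - 1) - P a (Suc k) + (b - a) * \<mu>"
      "Q b (Suc k - 1) - Q b (Suc k) = Q a (Suc k - 1) - Q a (Suc k) + (b - a) * \<nu>"
      using inc[where a = a and b = b] fixed[OF k1(2), of a b] by simp_all
    show ?thesis
      using k ab var \<tau> unfolding level_scale_def a_coef_def b_coef_def c_coef_def e
      by (simp add: level_noise_increment)
  qed
  let ?\<Gamma> = "\<lambda>j. tower_mean ?M m (\<lambda>i. ?A i v) ?F 0 (gibbs_weight l x y \<beta> s t j) k"
  have der: "((\<lambda>v. \<integral>G. tower_energy ?M m (\<lambda>i. ?A i v) ?F (Suc (k + (r - k))) (G, 0) \<partial>gauss_mat) has_real_derivative
      (\<integral>G. tower_mean ?M m (\<lambda>i. ?A i v) ?F k (\<lambda>w. (m (Suc k) - m k) / 2 *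
        quad_form ?J (noise_cov ?M ?D ?\<tau>) ?\<Gamma> w) (Suc (r - k)) (G, 0) \<partial>gauss_mat))
      (at v within I)"
    by (rule tower_derivative[where A = ?A and D = ?D and L = 1 and B = B and K = K, OF M _ D \<tau>n \<tau>0 B fo K fam const k(1) v conv conv'
        exp_moments_gauss_mat noise_map_Pair_0]) auto
  have \<Gamma>: "continuous_on UNIV (?\<Gamma> j)" "\<bar>?\<Gamma> j w\<bar> \<le> 1" if "j \<in> ?J" for j w
    using tower_mean_bounded_continuous[where A = "\<lambda>i. ?A i v", OF M B nA[OF v] continuous_on_gibbs_weight[OF l] gibbs_weight_bounds[OF l that]]
    by blast+
  let ?H = "\<lambda>i j. tower_mean ?M m (\<lambda>i. ?A i v) ?F k (\<lambda>w. ?\<Gamma> i w * ?\<Gamma> j w) (Suc (r - k))"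
  have intH: "integrable gauss_mat (\<lambda>G. ?H i j (G, 0))" if "i \<in> ?J" "j \<in> ?J" for i j
  proof -
    have c: "continuous_on UNIV (\<lambda>w. ?\<Gamma> i w * ?\<Gamma> j w)" using that by (intro continuous_intros \<Gamma>)
    have b: "\<bar>?\<Gamma> i w * ?\<Gamma> j w\<bar> \<le> 1" for w
    proof -
      have "\<bar>?\<Gamma> i w\<bar> * \<bar>?\<Gamma> j w\<bar> \<le> 1 * 1" using that by (intro mult_mono \<Gamma>) auto
      then show ?thesis by (simp add: abs_mult)
    qed
    note H = tower_mean_bounded_continuous[where A = "\<lambda>i. ?A i v", OF M B nA[OF v] c b]
    show ?thesis
    proof (rule exp_moments_integrable_growth[OF exp_moments_gauss_mat, where k = 0 and C = 1])
      show "(\<lambda>G. ?H i j (G, 0)) \<in> borel_measurable gauss_mat"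
        by (intro exp_moments_continuous[OF exp_moments_gauss_mat] continuous_on_compose2[OF H(1)]) (auto intro!: continuous_intros)
      show "\<bar>?H i j (G, 0)\<bar> \<le> 1 * norm G ^ 0" for G using H(2) by (simp del: tower_mean.simps)
    qed
  qed
  have cov: "noise_cov ?M ?D ?\<tau> i j = (s * \<beta>)\<^sup>2 * noise_cov ?M (interp_field x y t) ?\<tau> i j" for i j
    unfolding noise_cov_def by (simp add: power2_eq_square mult_ac flip: Bochner_Integration.integral_mult_right_zero)
  have val: "(\<integral>G. tower_mean ?M m (\<lambda>i. ?A i v) ?F k (\<lambda>w. (m (Suc k) - m k) / 2 *
        quad_form ?J (noise_cov ?M ?D ?\<tau>) ?\<Gamma> w) (Suc (r - k)) (G, 0) \<partial>gauss_mat)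
     = (m (Suc k) - m k) / 2 * (\<Sum>i\<in>?J. \<Sum>j\<in>?J. noise_cov ?M ?D ?\<tau> i j * replica_mean r l x y (P v) (Q v) m \<beta> s t k i j)"
  proof -
    have "(\<integral>G. tower_mean ?M m (\<lambda>i. ?A i v) ?F k (\<lambda>w. (m (Suc k) - m k) / 2 *
        quad_form ?J (noise_cov ?M ?D ?\<tau>) ?\<Gamma> w) (Suc (r - k)) (G, 0) \<partial>gauss_mat)
      = (m (Suc k) - m k) / 2 * (\<integral>G. (\<Sum>i\<in>?J. \<Sum>j\<in>?J. noise_cov ?M ?D ?\<tau> i j * ?H i j (G, 0)) \<partial>gauss_mat)"
      unfolding tower_mean_cmult
      by (subst tower_mean_quad_form[where A = "\<lambda>i. ?A i v" and \<Gamma> = ?\<Gamma>, OF M B nA[OF v] _ \<Gamma>])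
         (simp_all del: tower_mean.simps)
    also have "(\<integral>G. (\<Sum>i\<in>?J. \<Sum>j\<in>?J. noise_cov ?M ?D ?\<tau> i j * ?H i j (G, 0)) \<partial>gauss_mat)
      = (\<Sum>i\<in>?J. \<Sum>j\<in>?J. noise_cov ?M ?D ?\<tau> i j * (\<integral>G. ?H i j (G, 0) \<partial>gauss_mat))"
      using intH by (simp add: integral_sum integrable_sum del: tower_mean.simps)
    finally show ?thesis by (simp only: replica_mean_def Let_def)
  qed
  have psi: "?c * (\<integral>G. tower_energy ?M m (\<lambda>i. ?A i w) ?F (Suc (k + (r - k))) (G, 0) \<partial>gauss_mat) = psi r l x y (P w) (Q w) m \<beta> s t"
    if "w \<in> I" for w
    using psi_eq_tower[where p = "P w" and q = "Q w", OF l \<beta> s nA[OF that] m] k by simp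
  have sq: "(sqrt \<alpha>)\<^sup>2 = \<alpha>" "(sqrt \<mu>)\<^sup>2 = \<mu>" "(sqrt \<nu>)\<^sup>2 = \<nu>" using \<tau> by simp_all
  from DERIV_cmult[OF der, of ?c, unfolded val]
  have "((\<lambda>v. psi r l x y (P v) (Q v) m \<beta> s t) has_real_derivative
      ?c * ((m (Suc k) - m k) / 2 * (\<Sum>i\<in>?J. \<Sum>j\<in>?J. noise_cov ?M ?D ?\<tau> i j * replica_mean r l x y (P v) (Q v) m \<beta> s t k i j)))
      (at v within I)"
    by (rule has_field_derivative_transform_within[OF _ zero_less_one v]) (rule psi)
  moreover have "(\<Sum>i\<in>?J. \<Sum>j\<in>?J. noise_cov ?M ?D ?\<tau> i j * replica_mean r l x y (P v) (Q v) m \<beta> s t k i j)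
     = (s * \<beta>)\<^sup>2 * (\<Sum>i\<in>?J. \<Sum>j\<in>?J. replica_mean r l x y (P v) (Q v) m \<beta> s t k i j *
          ((1 - t) * \<mu> * (norm (x (fst i)) * norm (x (fst j)) * (y (snd j) \<bullet> y (snd i)))
           + (1 - t) * \<nu> * (norm (y (snd i)) * norm (y (snd j)) * (x (fst i) \<bullet> x (fst j)))
           + t * \<alpha> * (norm (x (fst i)) * norm (x (fst j)) * norm (y (snd i)) * norm (y (snd j)))))"
    unfolding cov field_noise_cov[OF t] sq sum_distrib_left by (intro sum.cong refl) (simp only: mult_ac)
  ultimately show ?thesis by (simp only: Suc_eq_plus1 mult.assoc)
qed

lemma admissible_update:
  assumes p: "admissible r p" and k: "1 \<le> k" "k \<le> r" and v: "v \<in> {p (k + 1)..p (k - 1)}"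
  shows "admissible r (p(k := v))"
  using assms by (auto simp: admissible_def)

theorem theorem1:
  fixes x :: "nat \<Rightarrow> real ^ 'n::finite" and y :: "nat \<Rightarrow> real ^ 'm::finite"
    and p q m :: "nat \<Rightarrow> real" and \<beta> s t :: real and r l :: nat
  assumes "l \<ge> 1"
    and "m 0 = 1" and "m (r + 1) = 0" and "\<forall>k\<in>{1..r}. m k \<noteq> 0"
    and "p 0 \<le> 1" and "\<forall>k\<in>{0..r}. p (k + 1) \<le> p k" and "p (r + 1) = 0"
    and "q 0 \<le> 1" and "\<forall>k\<in>{0..r}. q (k + 1) \<le> q k" and "q (r + 1) = 0"
    and "\<beta> > 0" and "s \<noteq> 0" and "0 \<le> t" and "t \<le> 1"
  shows "\<forall>k1\<in>{1..r}.
      (p (k1 + 1) < p (k1 - 1) \<longrightarrow>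
        ((\<lambda>v. psi r l x y (p(k1 := v)) q m \<beta> s t) has_real_derivative
           sgn s * s * \<beta> / (2 * sqrt (real CARD('n))) * phi_p r l x y p q m \<beta> s t k1)
          (at (p k1) within {p (k1 + 1)..p (k1 - 1)})) \<and>
      (q (k1 + 1) < q (k1 - 1) \<longrightarrow>
        ((\<lambda>v. psi r l x y p (q(k1 := v)) m \<beta> s t) has_real_derivative
           sgn s * s * \<beta> / (2 * sqrt (real CARD('n))) * phi_q r l x y p q m \<beta> s t k1)
          (at (q k1) within {q (k1 + 1)..q (k1 - 1)}))"
proof (intro ballI conjI impI)
  fix k assume "k \<in> {1..r}"
  then have k: "1 \<le> k" "k \<le> r" by auto
  have p: "admissible r p" and q: "admissible r q" using assms by (auto simp: admissible_def)
  have A: "noise_map 1 (level_map r p q i :: ('n, 'm) level \<Rightarrow> _)" for i by (rule noise_map_level_map[OF p q])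
  note eg = E_gamma_eq[OF \<open>l \<ge> 1\<close> \<open>\<beta> > 0\<close> \<open>s \<noteq> 0\<close> A assms(2,4,3) k(2)]
  have Iv: "p k \<in> {p (k + 1)..p (k - 1)}" "q k \<in> {q (k + 1)..q (k - 1)}"
    using p q k admissible_step[of r _ "k + 1"] admissible_step[of r _ k] by auto
  have bnd: "0 \<le> p k" "p k \<le> 1" "0 \<le> q k" "q k \<le> 1"
    using admissible_bounds[OF p, of k] admissible_bounds[OF q, of k] k by auto
  have upd: "continuous_on I (\<lambda>v. (f(k := v)) j)" for I f and j :: nat
    by (cases "j = k") (auto intro!: continuous_intros)
  have scal: "1 / (\<beta> * \<bar>s\<bar> * N) * ((m (k + 1) - m k) / 2 * (s * \<beta>)\<^sup>2 * X)
      = sgn s * s * \<beta> / (2 * N) * (- (m k - m (k + 1)) * X)" for N X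
  proof -
    have 1: "sgn s * s = \<bar>s\<bar>" by (simp add: abs_sgn mult.commute)
    have 2: "(s * \<beta>)\<^sup>2 = \<bar>s\<bar> * \<beta> * (\<bar>s\<bar> * \<beta>)" by (simp add: power2_eq_square)
    have "1 / (z * N) * (d / 2 * (z * z) * X) = z / (2 * N) * (d * X)" if "z \<noteq> 0" for z d :: real
      using that by (cases "N = 0") (simp_all add: field_simps)
    from this[of "\<bar>s\<bar> * \<beta>" "m (k + 1) - m k"] show ?thesis
      using \<open>s \<noteq> 0\<close> \<open>\<beta> > 0\<close> unfolding 1 2 by (simp add: mult_ac)
  qed
  let ?J = "{1..l} \<times> {1..l}"
  have lin: "(\<Sum>i\<in>?J. \<Sum>j\<in>?J. R i j * (a * f i j + b * g i j + c * h i j))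
      = a * (\<Sum>i\<in>?J. \<Sum>j\<in>?J. R i j * f i j) + b * (\<Sum>i\<in>?J. \<Sum>j\<in>?J. R i j * g i j)
        + c * (\<Sum>i\<in>?J. \<Sum>j\<in>?J. R i j * h i j)" for R f g h :: "nat \<times> nat \<Rightarrow> nat \<times> nat \<Rightarrow> real" and a b c
    by (simp add: distrib_left sum.distrib sum_distrib_left mult.left_commute)
  show "((\<lambda>v. psi r l x y (p(k := v)) q m \<beta> s t) has_real_derivative
           sgn s * s * \<beta> / (2 * sqrt (real CARD('n))) * phi_p r l x y p q m \<beta> s t k)
          (at (p k) within {p (k + 1)..p (k - 1)})"
  proof -
    have "((\<lambda>v. psi r l x y (p(k := v)) q m \<beta> s t) has_real_derivative
     1 / (\<beta> * \<bar>s\<bar> * sqrt (real CARD('n))) * ((m (k + 1) - m k) / 2 * (s * \<beta>)\<^sup>2 *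
       (\<Sum>i\<in>?J. \<Sum>j\<in>?J. replica_mean r l x y (p(k := p k)) q m \<beta> s t k i j *
          ((1 - t) * 1 * (norm (x (fst i)) * norm (x (fst j)) * (y (snd j) \<bullet> y (snd i)))
           + (1 - t) * 0 * (norm (y (snd i)) * norm (y (snd j)) * (x (fst i) \<bullet> x (fst j)))
           + t * q k * (norm (x (fst i)) * norm (x (fst j)) * norm (y (snd i)) * norm (y (snd j)))))))
     (at (p k) within {p (k + 1)..p (k - 1)})"
      by (rule psi_derivative[where P = "\<lambda>v. p(k := v)" and Q = "\<lambda>v. q"])
         (use assms k p q bnd Iv upd admissible_update[OF p k] in \<open>auto simp: algebra_simps\<close>)
    then show ?thesis
      unfolding fun_upd_triv scal phi_p_def eg lin
      by (rule back_subst[of "\<lambda>d. (_ has_real_derivative _ * d) _"]) (simp add: algebra_simps)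
  qed
  show "((\<lambda>v. psi r l x y p (q(k := v)) m \<beta> s t) has_real_derivative
           sgn s * s * \<beta> / (2 * sqrt (real CARD('n))) * phi_q r l x y p q m \<beta> s t k)
          (at (q k) within {q (k + 1)..q (k - 1)})"
  proof -
    have "((\<lambda>v. psi r l x y p (q(k := v)) m \<beta> s t) has_real_derivative
     1 / (\<beta> * \<bar>s\<bar> * sqrt (real CARD('n))) * ((m (k + 1) - m k) / 2 * (s * \<beta>)\<^sup>2 *
       (\<Sum>i\<in>?J. \<Sum>j\<in>?J. replica_mean r l x y p (q(k := q k)) m \<beta> s t k i j *
          ((1 - t) * 0 * (norm (x (fst i)) * norm (x (fst j)) * (y (snd j) \<bullet> y (snd i)))
           + (1 - t) * 1 * (norm (y (snd i)) * norm (y (snd j)) * (x (fst i) \<bullet> x (fst j)))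
           + t * p k * (norm (x (fst i)) * norm (x (fst j)) * norm (y (snd i)) * norm (y (snd j)))))))
     (at (q k) within {q (k + 1)..q (k - 1)})"
      by (rule psi_derivative[where P = "\<lambda>v. p" and Q = "\<lambda>v. q(k := v)"])
         (use assms k p q bnd Iv upd admissible_update[OF q k] in \<open>auto simp: algebra_simps\<close>)
    then show ?thesis
      unfolding fun_upd_triv scal phi_q_def eg lin
      by (rule back_subst[of "\<lambda>d. (_ has_real_derivative _ * d) _"]) (simp add: algebra_simps)
  qed
qed

end
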